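(* Let $(R,\mathfrak{m},k)$ be a regular local ring of dimension $d$. If $\operatorname{char}k\neq 2$ and $d\geq 8$, then there is a differential $R$-module $D$ such that $\operatorname{length}_R H(D)$ is non-zero and finite, $D$ admits a free flag, and $\operatorname{rank}_R D<2^d$. Consequently, it is not true that for every local ring $R$ and every differential $R$-module $F$ that admits a free flag and has $\operatorname{length}_R H(F)$ finite and non-zero one has $\operatorname{rank}_R F\geq 2^{\dim R}$.
   Context: Local rings are commutative and noetherian. A differential module over a ring $R$ is an $R$-module $F$ equipped with an $R$-linear endomorphism $d$ satisfying $d^2=0$; its homology is $H(F)=\operatorname{Ker}(d)/\operatorname{Im}(d)$. A free flag on $F$ is a chain of submodules \[ 0=F(-1)\subseteq F(0)\subseteq F(1)\subseteq\cdots\subseteq\bigcup_{i\geq 0}F(i)=F \] such that each $F(i)/F(i-1)$ is a free $R$-module and $d(F(i))\subseteq F(i-1)$ for all $i$. In particular the underlying $R$-module of $F$ is free, and $\operatorname{rank}_R F$ is its rank. $\dim R$ is the Krull dimension. *)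

theory Defs
  imports "HOL-Algebra.Algebra" "HOL-Library.Extended_Nat" Complex_Main
begin

section \<open>Local rings\<close>

definition krull_dim :: "('a, 'm) ring_scheme \<Rightarrow> enat" where
  "krull_dim R = Sup {enat n | n. \<exists>P :: nat \<Rightarrow> 'a set.
     (\<forall>i\<le>n. primeideal (P i) R) \<and> (\<forall>i<n. P i \<subset> P (Suc i))}"

text \<open>Local rings are commutative and noetherian by convention. Uniqueness of the maximal
  ideal includes its existence, so the zero ring is excluded.\<close>

locale local_ring = R?: cring R + noetherian_ring R for R (structure) +
  assumes ex1_maximalideal: "\<exists>!\<mm>. maximalideal \<mm> R"

definition max_ideal :: "('a, 'm) ring_scheme \<Rightarrow> 'a set" where
  "max_ideal R = (THE \<mm>. maximalideal \<mm> R)"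

definition residue_field :: "('a, 'm) ring_scheme \<Rightarrow> 'a set ring" where
  "residue_field R = R Quot (max_ideal R)"

definition ring_char :: "('a, 'm) ring_scheme \<Rightarrow> nat" where
  "ring_char R =
     (if \<exists>n::nat. n > 0 \<and> [n] \<cdot>\<^bsub>R\<^esub> \<one>\<^bsub>R\<^esub> = \<zero>\<^bsub>R\<^esub>
      then LEAST n::nat. n > 0 \<and> [n] \<cdot>\<^bsub>R\<^esub> \<one>\<^bsub>R\<^esub> = \<zero>\<^bsub>R\<^esub>
      else 0)"

text \<open>Least number of generators; meaningful for finitely generated ideals.\<close>

definition min_generators :: "('a, 'm) ring_scheme \<Rightarrow> 'a set \<Rightarrow> nat" where
  "min_generators R I =
     (LEAST n. \<exists>S \<subseteq> carrier R. finite S \<and> card S = n \<and> I = Idl\<^bsub>R\<^esub> S)"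

locale regular_local_ring = local_ring +
  assumes regular: "enat (min_generators R (max_ideal R)) = krull_dim R"


section \<open>Quotients, length, freeness and rank of modules\<close>

text \<open>A HOL-Algebra module record extends the ring record; the module axioms ignore
  the fields \<open>mult\<close> and \<open>one\<close>.\<close>

definition quot_module ::
    "('a, 'b, 'm) module_scheme \<Rightarrow> 'b set \<Rightarrow> ('a, 'b set) module" where
  "quot_module M N =
     \<lparr>carrier = a_rcosets\<^bsub>M\<^esub> N, monoid.mult = undefined, monoid.one = undefined,
      ring.zero = N, ring.add = set_add M,
      module.smult = (\<lambda>a C. \<Union>x\<in>C. N +>\<^bsub>M\<^esub> (a \<odot>\<^bsub>M\<^esub> x))\<rparr>"

definition mod_length ::
    "('a, 'r) ring_scheme \<Rightarrow> ('a, 'b, 'm) module_scheme \<Rightarrow> enat" where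
  "mod_length R M = Sup {enat n | n. \<exists>N :: nat \<Rightarrow> 'b set.
     (\<forall>i\<le>n. submodule (N i) R M) \<and> (\<forall>i<n. N i \<subset> N (Suc i))}"

definition is_basis ::
    "('a, 'r) ring_scheme \<Rightarrow> ('a, 'b, 'm) module_scheme \<Rightarrow> 'b set \<Rightarrow> bool" where
  "is_basis R M B \<longleftrightarrow>
     B \<subseteq> carrier M \<and>
     (\<forall>x \<in> carrier M. \<exists>A a. finite A \<and> A \<subseteq> B \<and> a \<in> A \<rightarrow> carrier R \<and>
        x = (\<Oplus>\<^bsub>M\<^esub> b\<in>A. a b \<odot>\<^bsub>M\<^esub> b)) \<and>
     (\<forall>A a. finite A \<longrightarrow> A \<subseteq> B \<longrightarrow> a \<in> A \<rightarrow> carrier R \<longrightarrow>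
        (\<Oplus>\<^bsub>M\<^esub> b\<in>A. a b \<odot>\<^bsub>M\<^esub> b) = \<zero>\<^bsub>M\<^esub> \<longrightarrow> (\<forall>b\<in>A. a b = \<zero>\<^bsub>R\<^esub>))"

definition free_module ::
    "('a, 'r) ring_scheme \<Rightarrow> ('a, 'b, 'm) module_scheme \<Rightarrow> bool" where
  "free_module R M \<longleftrightarrow> (\<exists>B. is_basis R M B)"

text \<open>The cardinality of a basis, with value \<open>\<infinity>\<close> for infinite bases. Over a nonzero
  commutative ring all bases of a free module have the same cardinality, so the infimum
  is the value taken at every basis.\<close>

definition mod_rank ::
    "('a, 'r) ring_scheme \<Rightarrow> ('a, 'b, 'm) module_scheme \<Rightarrow> enat" where
  "mod_rank R M = (INF B \<in> {B. is_basis R M B}. if finite B then enat (card B) else \<infinity>)"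


section \<open>Differential modules\<close>

locale differential_module = module R F for R (structure) and F (structure) +
  fixes \<delta> :: "'c \<Rightarrow> 'c"
  assumes diff_closed: "x \<in> carrier F \<Longrightarrow> \<delta> x \<in> carrier F"
    and diff_add: "\<lbrakk>x \<in> carrier F; y \<in> carrier F\<rbrakk> \<Longrightarrow> \<delta> (x \<oplus>\<^bsub>F\<^esub> y) = \<delta> x \<oplus>\<^bsub>F\<^esub> \<delta> y"
    and diff_smult: "\<lbrakk>a \<in> carrier R; x \<in> carrier F\<rbrakk> \<Longrightarrow> \<delta> (a \<odot>\<^bsub>F\<^esub> x) = a \<odot>\<^bsub>F\<^esub> \<delta> x"
    and diff_diff: "x \<in> carrier F \<Longrightarrow> \<delta> (\<delta> x) = \<zero>\<^bsub>F\<^esub>"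

definition homology ::
    "('a, 'b, 'm) module_scheme \<Rightarrow> ('b \<Rightarrow> 'b) \<Rightarrow> ('a, 'b set) module" where
  "homology F \<delta> =
     quot_module (F\<lparr>carrier := {x \<in> carrier F. \<delta> x = \<zero>\<^bsub>F\<^esub>}\<rparr>) (\<delta> ` carrier F)"

text \<open>The index is shifted by one: \<open>G i\<close> stands for the member \<open>F(i-1)\<close> of the flag, so that
  \<open>G 0\<close> is \<open>F(-1) = 0\<close>.\<close>

definition is_free_flag ::
    "('a, 'r) ring_scheme \<Rightarrow> ('a, 'b, 'm) module_scheme \<Rightarrow> ('b \<Rightarrow> 'b) \<Rightarrow> (nat \<Rightarrow> 'b set) \<Rightarrow> bool" where
  "is_free_flag R F \<delta> G \<longleftrightarrow>
     (\<forall>i. submodule (G i) R F) \<and>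
     G 0 = {\<zero>\<^bsub>F\<^esub>} \<and>
     (\<forall>i. G i \<subseteq> G (Suc i)) \<and>
     (\<Union>i. G i) = carrier F \<and>
     (\<forall>i. free_module R (quot_module (F\<lparr>carrier := G (Suc i)\<rparr>) (G i))) \<and>
     (\<forall>i. \<delta> ` G (Suc i) \<subseteq> G i)"

definition admits_free_flag ::
    "('a, 'r) ring_scheme \<Rightarrow> ('a, 'b, 'm) module_scheme \<Rightarrow> ('b \<Rightarrow> 'b) \<Rightarrow> bool" where
  "admits_free_flag R F \<delta> \<longleftrightarrow> (\<exists>G. is_free_flag R F \<delta> G)"

end

theory Submission
  imports Defs "HOL-Computational_Algebra.Polynomial" "HOL-Computational_Algebra.Fraction_Field"
    "HOL-Library.Countable"
begin

text \<open>
  Let \<open>x\<^sub>1, \<dots>, x\<^sub>d\<close> generate the maximal ideal and let \<open>K\<close> be the Koszul complex on them: the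
  exterior algebra on \<open>e\<^sub>1, \<dots>, e\<^sub>d\<close>, of rank \<open>2\<^sup>d\<close>, with the contraction by
  \<open>(x\<^sub>1, \<dots>, x\<^sub>d)\<close> as its differential. The contraction \<open>\<iota>\<^sub>i\<close> by the \<open>i\<close>-th coordinate
  anticommutes with the differential, so
  \<open>W = \<iota>\<^sub>1\<iota>\<^sub>2 + \<iota>\<^sub>3\<iota>\<^sub>4 + \<iota>\<^sub>5\<iota>\<^sub>6 + \<iota>\<^sub>7\<iota>\<^sub>8\<close> is a chain endomorphism of degree \<open>-2\<close>.
  The cone of \<open>W\<close> has homology of finite length, because every \<open>x\<^sub>i\<^sup>2\<close> kills it, and its rank is
  \<open>2 \<cdot> 2\<^sup>d\<close>. But \<open>W\<close> has integer entries, and its image and kernel are free direct summands as soon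
  as \<open>2\<close> is invertible; hence all of the cone except \<open>ker W \<oplus> coker W\<close> can be cancelled. What
  remains is a differential module \<open>D\<close> of rank \<open>2 \<cdot> rank (ker W)\<close> and with a free flag. It has nonzero
  homology because the unit \<open>1\<close> of the exterior algebra lies in \<open>ker W\<close> and is a cycle, and no boundary
  has a unit in that coordinate.

  The kernel of \<open>W\<close> is small because \<open>W\<close> is close to having maximal rank, as the Lefschetz property of a
  symplectic form suggests; for \<open>d = 8\<close> its rank is \<open>126 < 128\<close>. The rank is computed by adding the four pairs of
  generators one at a time. On \<open>K \<otimes> \<Lambda>(e, e')\<close> the new operator is the old one on the summands
  \<open>K e\<close> and \<open>K e'\<close>, and \<open>(a, b) \<mapsto> (W a + b, W b)\<close> on \<open>K \<oplus> K e'e\<close>, whose kernel is isomorphic to that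
  of \<open>W\<^sup>2\<close>. So the ranks \<open>r\<close> and \<open>s\<close> of the kernels of \<open>W\<close> and \<open>W\<^sup>2\<close> change by
  \<open>r \<mapsto> 2 r + s\<close> (\<open>graded_split_pair_op\<close>) and, while \<open>W\<^sup>3 = 0\<close>, by \<open>s \<mapsto> m + 2 s + r\<close>, with \<open>m\<close> the rank of
  \<open>K\<close> (\<open>graded_split_pair_op_square\<close>). Starting from \<open>m = r = s = 1\<close> this gives \<open>r = 3, 10, 35, 126\<close>.
  All further generators only multiply the ranks by two, so \<open>D\<close> has rank
  \<open>252 \<cdot> 2\<^bsup>d - 8\<^esup> < 2\<^sup>d\<close>. The cancellation is \<open>reduced_cone\<close>, and the resulting module is
  assembled in \<open>small_differential_module\<close>.

  The second claim needs one local ring to which the construction applies and whose elements are real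
  numbers: the localisation of \<open>\<rat>[x\<^sub>1, \<dots>, x\<^sub>8]\<close> at the origin, which is countable. It is noetherian by Hilbert's
  basis theorem, its maximal ideal has eight generators, and its dimension is at least eight and finite.
  That suffices, since then \<open>252 < 2\<^sup>8 \<le> 2\<^bsup>dim\<^esup>\<close>.
\<close>

section \<open>Linear operators on sequences\<close>

text \<open>Rewriting with these rules moves all subtracted terms of an equation to the other side; what
  remains is an identity modulo associativity and commutativity. The operator identities below are
  all proved in this way.\<close>

lemma (in abelian_group) sub_arith:
  "x \<in> carrier G \<Longrightarrow> \<ominus> x = \<zero> \<ominus> x"
  "x \<in> carrier G \<Longrightarrow> y \<in> carrier G \<Longrightarrow> z \<in> carrier G \<Longrightarrow> x \<oplus> (y \<ominus> z) = (x \<oplus> y) \<ominus> z"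
  "x \<in> carrier G \<Longrightarrow> y \<in> carrier G \<Longrightarrow> z \<in> carrier G \<Longrightarrow> (x \<ominus> y) \<oplus> z = (x \<oplus> z) \<ominus> y"
  "x \<in> carrier G \<Longrightarrow> y \<in> carrier G \<Longrightarrow> z \<in> carrier G \<Longrightarrow> (x \<ominus> y) \<ominus> z = x \<ominus> (y \<oplus> z)"
  "x \<in> carrier G \<Longrightarrow> y \<in> carrier G \<Longrightarrow> z \<in> carrier G \<Longrightarrow> x \<ominus> (y \<ominus> z) = (x \<oplus> z) \<ominus> y"
  "x \<in> carrier G \<Longrightarrow> y \<in> carrier G \<Longrightarrow> z \<in> carrier G \<Longrightarrow> x \<ominus> y = z \<longleftrightarrow> x = z \<oplus> y"
  "x \<in> carrier G \<Longrightarrow> y \<in> carrier G \<Longrightarrow> z \<in> carrier G \<Longrightarrow> x = y \<ominus> z \<longleftrightarrow> x \<oplus> z = y"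
proof -
  have 1: "x \<ominus> y = z \<longleftrightarrow> x = z \<oplus> y"
    if "x \<in> carrier G" "y \<in> carrier G" "z \<in> carrier G" for x y z
    using that add.inv_solve_right[of z x y] by (auto simp: a_minus_def)
  then show "x \<in> carrier G \<Longrightarrow> y \<in> carrier G \<Longrightarrow> z \<in> carrier G \<Longrightarrow> x \<ominus> y = z \<longleftrightarrow> x = z \<oplus> y" .
  show "x \<in> carrier G \<Longrightarrow> y \<in> carrier G \<Longrightarrow> z \<in> carrier G \<Longrightarrow> x = y \<ominus> z \<longleftrightarrow> x \<oplus> z = y"
    using 1[of y z x] by auto
qed (auto simp: a_minus_def minus_add a_ac)

text \<open>All free modules below are coordinate submodules of one module of sequences. Operators can then be
  defined on the whole of it, so that identities between them need no bookkeeping of index sets;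
  these matter only for ranks and gradings. The fields \<open>mult\<close> and \<open>one\<close> carry no information.\<close>

definition seq_module :: "('a, 'm) ring_scheme \<Rightarrow> ('a, nat \<Rightarrow> 'a) module" where
  "seq_module R = \<lparr>carrier = {f. \<forall>i. f i \<in> carrier R}, monoid.mult = undefined, monoid.one = undefined,
     ring.zero = (\<lambda>_. \<zero>\<^bsub>R\<^esub>), ring.add = (\<lambda>f g i. f i \<oplus>\<^bsub>R\<^esub> g i),
     module.smult = (\<lambda>a f i. a \<otimes>\<^bsub>R\<^esub> f i)\<rparr>"

lemma seq_module_simps:
  "carrier (seq_module R) = {f. \<forall>i. f i \<in> carrier R}"
  "\<zero>\<^bsub>seq_module R\<^esub> = (\<lambda>_. \<zero>\<^bsub>R\<^esub>)"
  "f \<oplus>\<^bsub>seq_module R\<^esub> g = (\<lambda>i. f i \<oplus>\<^bsub>R\<^esub> g i)"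
  "a \<odot>\<^bsub>seq_module R\<^esub> f = (\<lambda>i. a \<otimes>\<^bsub>R\<^esub> f i)"
  by (simp_all add: seq_module_def)

lemma (in cring) seq_module_is_module: "module R (seq_module R)"
proof (rule moduleI)
  show "cring R" by (rule is_cring)
  show "abelian_group (seq_module R)"
  proof (rule abelian_groupI)
    fix x assume "x \<in> carrier (seq_module R)"
    then show "\<exists>y\<in>carrier (seq_module R). y \<oplus>\<^bsub>seq_module R\<^esub> x = \<zero>\<^bsub>seq_module R\<^esub>"
      by (intro bexI[of _ "\<lambda>i. \<ominus> x i"]) (auto simp: seq_module_simps l_neg)
  qed (auto simp: seq_module_simps fun_eq_iff a_ac)
qed (auto simp: seq_module_simps fun_eq_iff l_distr r_distr m_assoc)

type_synonym 'a seq_op = "(nat \<Rightarrow> 'a) \<Rightarrow> (nat \<Rightarrow> 'a)"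

definition lin :: "('a, 'm) ring_scheme \<Rightarrow> 'a seq_op \<Rightarrow> bool" where
  "lin R T \<longleftrightarrow> (\<forall>x\<in>carrier (seq_module R). T x \<in> carrier (seq_module R)) \<and>
     (\<forall>x\<in>carrier (seq_module R). \<forall>y\<in>carrier (seq_module R). T (x \<oplus>\<^bsub>seq_module R\<^esub> y) = T x \<oplus>\<^bsub>seq_module R\<^esub> T y) \<and>
     (\<forall>a\<in>carrier R. \<forall>x\<in>carrier (seq_module R). T (a \<odot>\<^bsub>seq_module R\<^esub> x) = a \<odot>\<^bsub>seq_module R\<^esub> T x)"

text \<open>Interleaving identifies the module of sequences with the direct sum of two copies of itself, so that
  a direct sum of free modules is again a module of sequences.\<close>

definition weave :: "(nat \<Rightarrow> 'a) \<Rightarrow> (nat \<Rightarrow> 'a) \<Rightarrow> (nat \<Rightarrow> 'a)" where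
  "weave f g = (\<lambda>i. if even i then f (i div 2) else g (i div 2))"

definition evens :: "(nat \<Rightarrow> 'a) \<Rightarrow> (nat \<Rightarrow> 'a)" where
  "evens f = (\<lambda>i. f (2 * i))"

definition odds :: "(nat \<Rightarrow> 'a) \<Rightarrow> (nat \<Rightarrow> 'a)" where
  "odds f = (\<lambda>i. f (2 * i + 1))"

lemma evens_weave [simp]: "evens (weave f g) = f"
  by (simp add: evens_def weave_def)

lemma odds_weave [simp]: "odds (weave f g) = g"
  by (simp add: odds_def weave_def)

lemma weave_surj [simp]: "weave (evens f) (odds f) = f"
  by (auto simp: evens_def odds_def weave_def fun_eq_iff)

lemma weave_eq_iff [simp]: "weave a b = weave c d \<longleftrightarrow> a = c \<and> b = d"
  by (metis evens_weave odds_weave)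

abbreviation quad where "quad a b c e \<equiv> weave (weave a b) (weave c e)"

definition weave_set :: "nat set \<Rightarrow> nat set \<Rightarrow> nat set" where
  "weave_set A B = {i. if even i then i div 2 \<in> A else i div 2 \<in> B}"

lemma weave_set_eq: "weave_set A B = (\<lambda>i. 2 * i) ` A \<union> (\<lambda>i. 2 * i + 1) ` B"
proof -
  have "i \<in> weave_set A B \<longleftrightarrow> i \<in> (\<lambda>i. 2 * i) ` A \<union> (\<lambda>i. 2 * i + 1) ` B" for i
  proof (cases "even i")
    case True
    then obtain k where "i = 2 * k" by blast
    then show ?thesis by (auto simp: weave_set_def image_iff) presburger
  next
    case False
    then obtain k where "i = 2 * k + 1" by (rule oddE)
    then show ?thesis by (auto simp: weave_set_def image_iff) presburger
  qed
  then show ?thesis by blast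
qed

lemma finite_weave_set: "finite A \<Longrightarrow> finite B \<Longrightarrow> finite (weave_set A B)"
  by (simp add: weave_set_eq)

lemma card_weave_set:
  assumes "finite A" "finite B"
  shows "card (weave_set A B) = card A + card B"
proof -
  have "(\<lambda>i. 2 * i) ` A \<inter> (\<lambda>i. 2 * i + 1) ` B = {}"
    by auto presburger
  then show ?thesis
    using assms by (simp add: weave_set_eq card_Un_disjoint card_image inj_on_def)
qed

lemma weave_set_mono: "A \<subseteq> A' \<Longrightarrow> B \<subseteq> B' \<Longrightarrow> weave_set A B \<subseteq> weave_set A' B'"
  by (auto simp: weave_set_def)

lemma weave_set_empty [simp]: "weave_set {} {} = {}"
  by (simp add: weave_set_def)

definition supported :: "('a, 'm) ring_scheme \<Rightarrow> nat set \<Rightarrow> (nat \<Rightarrow> 'a) set" where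
  "supported R I = {f. (\<forall>i. f i \<in> carrier R) \<and> (\<forall>i. i \<notin> I \<longrightarrow> f i = \<zero>\<^bsub>R\<^esub>)}"

text \<open>A grading of a free module by its coordinates: \<open>J n\<close> is the set of the coordinates of degree less
  than \<open>n\<close>, and \<open>r\<close> is the number of all coordinates. Integer indices avoid truncated subtraction when
  a grading is shifted.\<close>

definition graded :: "(int \<Rightarrow> nat set) \<Rightarrow> nat \<Rightarrow> bool" where
  "graded J r \<longleftrightarrow> mono J \<and> (\<forall>n\<le>0. J n = {}) \<and>
     (\<exists>N. (\<forall>n\<ge>N. J n = J N) \<and> finite (J N) \<and> card (J N) = r)"

lemma graded_weave_set:
  assumes J: "graded J r" and K: "graded K s" and "k \<ge> 0" "l \<ge> 0"
  shows "graded (\<lambda>n. weave_set (J (n - k)) (K (n - l))) (r + s)"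
proof -
  obtain N where N: "\<And>n. n \<ge> N \<Longrightarrow> J n = J N" "finite (J N)" "card (J N) = r"
    using J unfolding graded_def by blast
  obtain M where M: "\<And>n. n \<ge> M \<Longrightarrow> K n = K M" "finite (K M)" "card (K M) = s"
    using K unfolding graded_def by blast
  have JK: "mono J" "mono K" "\<And>n. n \<le> 0 \<Longrightarrow> J n = {}" "\<And>n. n \<le> 0 \<Longrightarrow> K n = {}"
    using J K unfolding graded_def by blast+
  define P where "P = max (N + k) (M + l)"
  have P: "J (n - k) = J N" "K (n - l) = K M" if "n \<ge> P" for n
    by (rule N(1), use that in \<open>simp add: P_def\<close>) (rule M(1), use that in \<open>simp add: P_def\<close>)
  show ?thesis
    unfolding graded_def
  proof (intro conjI exI[of _ P] allI impI)
    show "mono (\<lambda>n. weave_set (J (n - k)) (K (n - l)))"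
      using monoD[OF JK(1)] monoD[OF JK(2)] by (intro monoI weave_set_mono) simp_all
    show "weave_set (J (n - k)) (K (n - l)) = {}" if "n \<le> 0" for n
      using JK(3)[of "n - k"] JK(4)[of "n - l"] that assms(3,4) by simp
  qed (simp_all add: P N(2,3) M(2,3) finite_weave_set card_weave_set)
qed

lemma graded_weave_set0:
  assumes J: "graded J r" and K: "graded K s"
  shows "l \<ge> 0 \<Longrightarrow> graded (\<lambda>n. weave_set (J n) (K (n - l))) (r + s)"
    and "graded (\<lambda>n. weave_set (J n) (K n)) (r + s)"
  using graded_weave_set[OF J K order_refl, of l] graded_weave_set[OF J K order_refl order_refl]
  by (simp_all only: diff_0_right)

locale seq_operators = cring R for R (structure)
begin

abbreviation "\<Omega> \<equiv> carrier (seq_module R)"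
abbreviation plus (infixl "\<^bold>+" 65) where "f \<^bold>+ g \<equiv> f \<oplus>\<^bsub>seq_module R\<^esub> g"
abbreviation neg ("\<^bold>- _" [80] 80) where "\<^bold>- f \<equiv> \<ominus>\<^bsub>seq_module R\<^esub> f"
abbreviation scal (infixr "\<bullet>" 75) where "a \<bullet> f \<equiv> a \<odot>\<^bsub>seq_module R\<^esub> f"
abbreviation nul ("\<^bold>0") where "\<^bold>0 \<equiv> \<zero>\<^bsub>seq_module R\<^esub>"

sublocale Om: module R "seq_module R" by (rule seq_module_is_module)

lemmas Omega_arith = Om.M.sub_arith

lemma lin_simps:
  assumes "lin R T"
  shows "x \<in> \<Omega> \<Longrightarrow> T x \<in> \<Omega>"
    and "x \<in> \<Omega> \<Longrightarrow> y \<in> \<Omega> \<Longrightarrow> T (x \<^bold>+ y) = T x \<^bold>+ T y"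
    and "a \<in> carrier R \<Longrightarrow> x \<in> \<Omega> \<Longrightarrow> T (a \<bullet> x) = a \<bullet> T x"
    and "x \<in> \<Omega> \<Longrightarrow> T (\<^bold>- x) = \<^bold>- T x"
    and "T \<^bold>0 = \<^bold>0"
proof -
  have cl: "x \<in> \<Omega> \<Longrightarrow> T x \<in> \<Omega>" for x using assms by (auto simp: lin_def)
  have sm: "a \<in> carrier R \<Longrightarrow> x \<in> \<Omega> \<Longrightarrow> T (a \<bullet> x) = a \<bullet> T x" for a x
    using assms by (auto simp: lin_def)
  show "x \<in> \<Omega> \<Longrightarrow> T x \<in> \<Omega>" by (rule cl)
  show "x \<in> \<Omega> \<Longrightarrow> y \<in> \<Omega> \<Longrightarrow> T (x \<^bold>+ y) = T x \<^bold>+ T y" using assms by (auto simp: lin_def)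
  show "a \<in> carrier R \<Longrightarrow> x \<in> \<Omega> \<Longrightarrow> T (a \<bullet> x) = a \<bullet> T x" by (rule sm)
  show "x \<in> \<Omega> \<Longrightarrow> T (\<^bold>- x) = \<^bold>- T x"
    using sm[of "\<ominus> \<one>" x] cl[of x] by (simp add: Om.smult_l_minus)
  show "T \<^bold>0 = \<^bold>0"
    using sm[of \<zero> "\<^bold>0"] cl[of "\<^bold>0"] by simp
qed

lemma in_Omega_iff: "f \<in> \<Omega> \<longleftrightarrow> (\<forall>i. f i \<in> carrier R)"
  by (simp add: seq_module_simps)

lemma neg_apply: "f \<in> \<Omega> \<Longrightarrow> (\<^bold>- f) i = \<ominus> f i"
proof -
  assume f: "f \<in> \<Omega>"
  have "\<^bold>- f = (\<ominus> \<one>) \<bullet> f"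
    using f by (simp add: Om.smult_l_minus)
  then show ?thesis
    using f by (simp add: seq_module_simps l_minus)
qed

lemma weave_simps [simp]:
  "a \<in> \<Omega> \<Longrightarrow> b \<in> \<Omega> \<Longrightarrow> weave a b \<in> \<Omega>"
  "x \<in> \<Omega> \<Longrightarrow> evens x \<in> \<Omega>"
  "x \<in> \<Omega> \<Longrightarrow> odds x \<in> \<Omega>"
  "evens (x \<^bold>+ y) = evens x \<^bold>+ evens y"
  "odds (x \<^bold>+ y) = odds x \<^bold>+ odds y"
  "evens (c \<bullet> x) = c \<bullet> evens x"
  "odds (c \<bullet> x) = c \<bullet> odds x"
  "evens \<^bold>0 = \<^bold>0"
  "odds \<^bold>0 = \<^bold>0"
  "weave \<^bold>0 \<^bold>0 = \<^bold>0"
  "weave a b \<^bold>+ weave a' b' = weave (a \<^bold>+ a') (b \<^bold>+ b')"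
  "c \<bullet> weave a b = weave (c \<bullet> a) (c \<bullet> b)"
  by (auto simp: in_Omega_iff seq_module_simps(2-4) weave_def evens_def odds_def fun_eq_iff)

lemma weave_neg [simp]:
  "x \<in> \<Omega> \<Longrightarrow> evens (\<^bold>- x) = \<^bold>- evens x"
  "x \<in> \<Omega> \<Longrightarrow> odds (\<^bold>- x) = \<^bold>- odds x"
  "a \<in> \<Omega> \<Longrightarrow> b \<in> \<Omega> \<Longrightarrow> \<^bold>- weave a b = weave (\<^bold>- a) (\<^bold>- b)"
proof -
  show 1: "x \<in> \<Omega> \<Longrightarrow> evens (\<^bold>- x) = \<^bold>- evens x" "x \<in> \<Omega> \<Longrightarrow> odds (\<^bold>- x) = \<^bold>- odds x" for x
    by (rule ext, simp add: evens_def odds_def neg_apply in_Omega_iff)+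
  show "a \<in> \<Omega> \<Longrightarrow> b \<in> \<Omega> \<Longrightarrow> \<^bold>- weave a b = weave (\<^bold>- a) (\<^bold>- b)"
    by (rule ext) (simp add: weave_def neg_apply in_Omega_iff)
qed

lemma weave_zero_iff [simp]: "weave a b = \<^bold>0 \<longleftrightarrow> a = \<^bold>0 \<and> b = \<^bold>0"
  using weave_eq_iff[of a b "\<^bold>0" "\<^bold>0"] by (simp del: weave_eq_iff)

lemma weave_cases:
  assumes "x \<in> \<Omega>"
  obtains a b where "x = weave a b" "a \<in> \<Omega>" "b \<in> \<Omega>"
  using that[of "evens x" "odds x"] assms by simp

lemma quad_cases:
  assumes "x \<in> \<Omega>"
  obtains a b c e where "x = quad a b c e" "a \<in> \<Omega>" "b \<in> \<Omega>" "c \<in> \<Omega>" "e \<in> \<Omega>"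
proof -
  obtain y z where "x = weave y z" "y \<in> \<Omega>" "z \<in> \<Omega>" using assms by (rule weave_cases)
  moreover obtain a b where "y = weave a b" "a \<in> \<Omega>" "b \<in> \<Omega>" using \<open>y \<in> \<Omega>\<close> by (rule weave_cases)
  moreover obtain c e where "z = weave c e" "c \<in> \<Omega>" "e \<in> \<Omega>" using \<open>z \<in> \<Omega>\<close> by (rule weave_cases)
  ultimately show thesis by (auto intro: that)
qed

lemma supported_eq: "f \<in> supported R I \<longleftrightarrow> f \<in> \<Omega> \<and> (\<forall>i. i \<notin> I \<longrightarrow> f i = \<zero>)"
  by (auto simp: supported_def seq_module_simps)

lemma supported_Omega [dest]: "f \<in> supported R I \<Longrightarrow> f \<in> \<Omega>"
  by (simp add: supported_eq)

lemma supported_closed [simp]: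
  "\<^bold>0 \<in> supported R I"
  "x \<in> supported R I \<Longrightarrow> y \<in> supported R I \<Longrightarrow> x \<^bold>+ y \<in> supported R I"
  "x \<in> supported R I \<Longrightarrow> \<^bold>- x \<in> supported R I"
  "c \<in> carrier R \<Longrightarrow> x \<in> supported R I \<Longrightarrow> c \<bullet> x \<in> supported R I"
  by (simp_all add: supported_eq neg_apply) (auto simp: seq_module_simps)

lemma supported_mono: "I \<subseteq> J \<Longrightarrow> f \<in> supported R I \<Longrightarrow> f \<in> supported R J"
  by (auto simp: supported_def)

lemma supported_empty: "supported R {} = {\<^bold>0}"
  by (auto simp: supported_def seq_module_simps)

lemma supported_weave_set [simp]: "weave a b \<in> supported R (weave_set A B) \<longleftrightarrow> a \<in> supported R A \<and> b \<in> supported R B"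
proof
  assume "a \<in> supported R A \<and> b \<in> supported R B"
  then show "weave a b \<in> supported R (weave_set A B)" by (auto simp: supported_def weave_def weave_set_def)
next
  assume x: "weave a b \<in> supported R (weave_set A B)"
  define z where "z = weave a b"
  have z: "a = evens z" "b = odds z" by (simp_all add: z_def)
  have "z \<in> supported R (weave_set A B)" using x by (simp add: z_def)
  then show "a \<in> supported R A \<and> b \<in> supported R B"
    unfolding z by (auto simp: supported_def evens_def odds_def weave_set_def)
qed

lemma linI:
  assumes "\<And>x. x \<in> \<Omega> \<Longrightarrow> T x \<in> \<Omega>"
    and "\<And>x y. x \<in> \<Omega> \<Longrightarrow> y \<in> \<Omega> \<Longrightarrow> T (x \<^bold>+ y) = T x \<^bold>+ T y"
    and "\<And>a x. a \<in> carrier R \<Longrightarrow> x \<in> \<Omega> \<Longrightarrow> T (a \<bullet> x) = a \<bullet> T x"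
  shows "lin R T"
  using assms by (auto simp: lin_def)

lemma lin_intros:
  "lin R (\<lambda>f. f)" "lin R (\<lambda>f. \<^bold>0)"
  "lin R T \<Longrightarrow> lin R S \<Longrightarrow> lin R (\<lambda>f. T f \<^bold>+ S f)"
  "lin R T \<Longrightarrow> lin R (\<lambda>f. \<^bold>- T f)"
  "c \<in> carrier R \<Longrightarrow> lin R T \<Longrightarrow> lin R (\<lambda>f. c \<bullet> T f)"
  "lin R T \<Longrightarrow> lin R S \<Longrightarrow> lin R (\<lambda>f. weave (T f) (S f))"
  "lin R T \<Longrightarrow> lin R (\<lambda>f. evens (T f))" "lin R T \<Longrightarrow> lin R (\<lambda>f. odds (T f))"
proof -
  show "lin R (\<lambda>f. f)" "lin R (\<lambda>f. \<^bold>0)" by (auto intro!: linI)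
next
  assume T: "lin R T" and S: "lin R S"
  note [simp] = lin_simps[OF T] lin_simps[OF S]
  show "lin R (\<lambda>f. T f \<^bold>+ S f)"
    by (auto intro!: linI simp: Om.smult_r_distr Om.M.a_ac)
  show "lin R (\<lambda>f. weave (T f) (S f))" by (auto intro!: linI)
next
  assume T: "lin R T"
  note [simp] = lin_simps[OF T]
  show "lin R (\<lambda>f. \<^bold>- T f)"
    by (auto intro!: linI simp: Om.smult_r_minus Om.M.minus_add)
  show "lin R (\<lambda>f. evens (T f))" "lin R (\<lambda>f. odds (T f))" by (auto intro!: linI)
  assume "c \<in> carrier R"
  then show "lin R (\<lambda>f. c \<bullet> T f)"
    by (auto intro!: linI simp: Om.smult_r_distr simp flip: Om.smult_assoc1 simp: m_comm)
qed

lemma lin_comp: "lin R T \<Longrightarrow> lin R S \<Longrightarrow> lin R (\<lambda>f. T (S f))"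
  by (auto simp: lin_def)

end

section \<open>Splittings of an operator and of its square\<close>

text \<open>A splitting of \<open>W\<close>: the partial inverse \<open>V\<close> makes \<open>1 - V W\<close> and \<open>1 - W V\<close> projections onto the
  kernel of \<open>W\<close> and onto a complement of its image, and \<open>p\<close>, \<open>j\<close> and \<open>q\<close>, \<open>s\<close> factor these projections
  through coordinate modules for the kernel and the cokernel.\<close>

definition splitting :: "('a, 'm) ring_scheme \<Rightarrow> 'a seq_op \<Rightarrow>
    'a seq_op \<Rightarrow> 'a seq_op \<Rightarrow>
    'a seq_op \<Rightarrow> 'a seq_op \<Rightarrow>
    'a seq_op \<Rightarrow> bool" where
  "splitting R W V p j q s \<longleftrightarrow>
     lin R W \<and> lin R V \<and> lin R p \<and> lin R j \<and> lin R q \<and> lin R s \<and>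
     (\<forall>x\<in>carrier (seq_module R).
        j (p x) = x \<oplus>\<^bsub>seq_module R\<^esub> \<ominus>\<^bsub>seq_module R\<^esub> V (W x) \<and> p (j x) = x \<and>
        s (q x) = x \<oplus>\<^bsub>seq_module R\<^esub> \<ominus>\<^bsub>seq_module R\<^esub> W (V x) \<and> q (s x) = x \<and>
        W (j x) = \<zero>\<^bsub>seq_module R\<^esub> \<and> q (W x) = \<zero>\<^bsub>seq_module R\<^esub> \<and> p (V x) = \<zero>\<^bsub>seq_module R\<^esub> \<and> V (s x) = \<zero>\<^bsub>seq_module R\<^esub>)"

text \<open>The operator \<open>T\<close> has degree \<open>k\<close> with respect to the filtrations given by \<open>J\<close> and \<open>K\<close>.\<close>

definition shifts :: "('a, 'm) ring_scheme \<Rightarrow> (int \<Rightarrow> nat set) \<Rightarrow> int \<Rightarrow> (int \<Rightarrow> nat set) \<Rightarrow>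
    'a seq_op \<Rightarrow> bool" where
  "shifts R J k K T \<longleftrightarrow> (\<forall>n. \<forall>f\<in>supported R (J n). T f \<in> supported R (K (n + k)))"

text \<open>The kernel and the cokernel of the operator \<open>W\<close> of degree \<open>-k\<close> are graded free modules of rank
  \<open>r\<close>, compatibly with the gradings.\<close>

definition graded_split :: "('a, 'm) ring_scheme \<Rightarrow> (int \<Rightarrow> nat set) \<Rightarrow>
    'a seq_op \<Rightarrow> int \<Rightarrow> nat \<Rightarrow> bool" where
  "graded_split R J W k r \<longleftrightarrow> (\<exists>K C V p j q s. graded K r \<and> graded C r \<and> splitting R W V p j q s \<and>
     shifts R J k J V \<and> shifts R J 0 K p \<and> shifts R K 0 J j \<and> shifts R J 0 C q \<and> shifts R C 0 J s)"

definition quad_grade :: "(int \<Rightarrow> nat set) \<Rightarrow> int \<Rightarrow> nat set" where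
  "quad_grade J n = weave_set (weave_set (J n) (J (n - 1))) (weave_set (J (n - 1)) (J (n - 2)))"

context seq_operators
begin

text \<open>The effect of adding two generators \<open>e\<close>, \<open>e'\<close> to the exterior algebra and one summand to the
  operator: \<open>quad a b c d\<close> stands for \<open>a + b e + c e' + d e'e\<close>, and the new summand maps \<open>e'e\<close> to \<open>1\<close>
  and the other three basis elements to \<open>0\<close>.\<close>

definition pair_op :: "'a seq_op \<Rightarrow> (nat \<Rightarrow> 'a) \<Rightarrow> (nat \<Rightarrow> 'a)" where
  "pair_op W f = quad (W (evens (evens f)) \<^bold>+ odds (odds f)) (W (odds (evens f))) (W (evens (odds f))) (W (odds (odds f)))"

lemma pair_op_quad [simp]: "pair_op W (quad a b c e) = quad (W a \<^bold>+ e) (W b) (W c) (W e)"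
  by (simp add: pair_op_def)

lemma lin_pair_op: "lin R W \<Longrightarrow> lin R (pair_op W)"
  unfolding pair_op_def[abs_def] by (assumption | rule lin_intros | rule lin_comp[of W])+

lemma splittingI:
  assumes "lin R W" "lin R V" "lin R p" "lin R j" "lin R q" "lin R s"
    and "\<And>x. x \<in> \<Omega> \<Longrightarrow> j (p x) = x \<^bold>+ \<^bold>- V (W x)" "\<And>x. x \<in> \<Omega> \<Longrightarrow> p (j x) = x"
    and "\<And>x. x \<in> \<Omega> \<Longrightarrow> s (q x) = x \<^bold>+ \<^bold>- W (V x)" "\<And>x. x \<in> \<Omega> \<Longrightarrow> q (s x) = x"
    and "\<And>x. x \<in> \<Omega> \<Longrightarrow> W (j x) = \<^bold>0" "\<And>x. x \<in> \<Omega> \<Longrightarrow> q (W x) = \<^bold>0"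
    and "\<And>x. x \<in> \<Omega> \<Longrightarrow> p (V x) = \<^bold>0" "\<And>x. x \<in> \<Omega> \<Longrightarrow> V (s x) = \<^bold>0"
  shows "splitting R W V p j q s"
  using assms by (auto simp: splitting_def)

lemma splittingD:
  assumes "splitting R W V p j q s"
  shows "lin R W" "lin R V" "lin R p" "lin R j" "lin R q" "lin R s"
    and "\<And>x. x \<in> \<Omega> \<Longrightarrow> j (p x) = x \<^bold>+ \<^bold>- V (W x)" "\<And>x. x \<in> \<Omega> \<Longrightarrow> p (j x) = x"
    and "\<And>x. x \<in> \<Omega> \<Longrightarrow> s (q x) = x \<^bold>+ \<^bold>- W (V x)" "\<And>x. x \<in> \<Omega> \<Longrightarrow> q (s x) = x"
    and "\<And>x. x \<in> \<Omega> \<Longrightarrow> W (j x) = \<^bold>0" "\<And>x. x \<in> \<Omega> \<Longrightarrow> q (W x) = \<^bold>0"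
    and "\<And>x. x \<in> \<Omega> \<Longrightarrow> p (V x) = \<^bold>0" "\<And>x. x \<in> \<Omega> \<Longrightarrow> V (s x) = \<^bold>0"
  using assms by (auto simp: splitting_def)

lemma shiftsD: "shifts R J k K T \<Longrightarrow> f \<in> supported R (J n) \<Longrightarrow> n + k = m \<Longrightarrow> T f \<in> supported R (K m)"
  by (auto simp: shifts_def)

lemma quad_supportedE:
  assumes "x \<in> supported R (weave_set (weave_set A B) (weave_set C E))"
  obtains a b c e where "x = quad a b c e" "a \<in> supported R A" "b \<in> supported R B" "c \<in> supported R C" "e \<in> supported R E"
proof -
  obtain a b c e where "x = quad a b c e" using quad_cases[OF supported_Omega[OF assms]] by metis
  with assms that show thesis by simp
qed

lemma triple_supportedE:
  assumes "x \<in> supported R (weave_set A (weave_set C E))"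
  obtains a c e where "x = weave a (weave c e)" "a \<in> supported R A" "c \<in> supported R C" "e \<in> supported R E"
proof -
  obtain a b where ab: "x = weave a b" "b \<in> \<Omega>" using weave_cases[OF supported_Omega[OF assms]] by metis
  moreover obtain c e where "b = weave c e" using weave_cases[OF ab(2)] by metis
  ultimately show thesis using assms that by simp
qed

lemma graded_shift:
  assumes "graded J r" "k \<ge> 0"
  shows "graded (\<lambda>n. J (n - k)) r"
proof -
  obtain N where N: "\<And>n. n \<ge> N \<Longrightarrow> J n = J N" "finite (J N)" "card (J N) = r"
    using assms(1) unfolding graded_def by blast
  have J: "mono J" "\<And>n. n \<le> 0 \<Longrightarrow> J n = {}"
    using assms(1) unfolding graded_def by blast+
  show ?thesis
    unfolding graded_def
  proof (intro conjI exI[of _ "N + k"] allI impI)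
    show "J (n - k) = J (N + k - k)" if "n \<ge> N + k" for n using N(1)[of "n - k"] that by simp
    show "J (n - k) = {}" if "n \<le> 0" for n using J(2)[of "n - k"] that assms(2) by simp
    show "mono (\<lambda>n. J (n - k))" using monoD[OF J(1)] by (intro monoI) simp
  qed (simp_all add: N(2,3))
qed

lemma graded_quad: "graded J m \<Longrightarrow> graded (quad_grade J) (4 * m)"
  using graded_weave_set[OF graded_weave_set0(1)[of J m J m 1] graded_weave_set0(1)[of J m J m 1], of 0 1]
  by (simp add: quad_grade_def[abs_def] numeral_eq_Suc add.assoc)

lemma pair_op_shifts:
  assumes W: "shifts R J (-2) J W"
  shows "shifts R (quad_grade J) (-2) (quad_grade J) (pair_op W)"
  unfolding shifts_def quad_grade_def
proof (intro allI ballI)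
  fix n f assume "f \<in> supported R (weave_set (weave_set (J n) (J (n - 1))) (weave_set (J (n - 1)) (J (n - 2))))"
  then obtain a b c e where "f = quad a b c e" and
    "a \<in> supported R (J n)" "b \<in> supported R (J (n - 1))" "c \<in> supported R (J (n - 1))" "e \<in> supported R (J (n - 2))"
    by (rule quad_supportedE)
  then show "pair_op W f \<in> supported R (weave_set (weave_set (J (n + - 2)) (J (n + - 2 - 1)))
      (weave_set (J (n + - 2 - 1)) (J (n + - 2 - 2))))"
    apply simp
    apply (intro conjI supported_closed(2))
    apply (simp_all add: shiftsD[OF W])
    done
qed

text \<open>On the components \<open>(a, e)\<close> the operator is \<open>(a, e) \<mapsto> (W a + e, W e)\<close>. Its kernel consists of
  the pairs \<open>(a, - W a)\<close> with \<open>W\<^sup>2 a = 0\<close>, and \<open>(x, y)\<close> is in its image exactly if \<open>y - W x\<close> is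
  in the image of \<open>W\<^sup>2\<close>; so a splitting of \<open>W\<^sup>2\<close> gives one here. The middle components \<open>b\<close> and \<open>c\<close> contribute a splitting
  of \<open>W\<close> each.\<close>

lemma graded_split_pair_op:
  assumes W: "lin R W" "shifts R J (-2) J W"
    and r1: "graded_split R J W 2 r" and r2: "graded_split R J (\<lambda>f. W (W f)) 4 r2"
  shows "graded_split R (quad_grade J) (pair_op W) 2 (2 * r + r2)"
proof -
  obtain K C V p j q s where 1: "graded K r" "graded C r" "splitting R W V p j q s"
     "shifts R J 2 J V" "shifts R J 0 K p" "shifts R K 0 J j" "shifts R J 0 C q" "shifts R C 0 J s"
    using r1 unfolding graded_split_def by blast
  obtain K2 C2 V2 p2 j2 q2 s2 where 2: "graded K2 r2" "graded C2 r2"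
     "splitting R (\<lambda>f. W (W f)) V2 p2 j2 q2 s2"
     "shifts R J 4 J V2" "shifts R J 0 K2 p2" "shifts R K2 0 J j2" "shifts R J 0 C2 q2" "shifts R C2 0 J s2"
    using r2 unfolding graded_split_def by blast
  note S1 = splittingD[OF 1(3)] and S2 = splittingD[OF 2(3)]
  note lins = S1(1-6) S2(2-6)
  note [simp] = lins[THEN lin_simps(1)] lins[THEN lin_simps(2)] lins[THEN lin_simps(4)] lins[THEN lin_simps(5)]
    S1(7-14) S2(7-14)
  define V' where "V' = (\<lambda>f. quad (\<^bold>- V2 (odds (odds f) \<^bold>+ \<^bold>- W (evens (evens f)))) (V (odds (evens f))) (V (evens (odds f)))
      (evens (evens f) \<^bold>+ W (V2 (odds (odds f) \<^bold>+ \<^bold>- W (evens (evens f))))))"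
  define p' where "p' = (\<lambda>f. weave (p2 (evens (evens f))) (weave (p (odds (evens f))) (p (evens (odds f)))))"
  define j' where "j' = (\<lambda>f. quad (j2 (evens f)) (j (evens (odds f))) (j (odds (odds f))) (\<^bold>- W (j2 (evens f))))"
  define q' where "q' = (\<lambda>f. weave (q2 (odds (odds f) \<^bold>+ \<^bold>- W (evens (evens f)))) (weave (q (odds (evens f))) (q (evens (odds f)))))"
  define s' where "s' = (\<lambda>f. quad \<^bold>0 (s (evens (odds f))) (s (odds (odds f))) (s2 (evens f)))"
  have "splitting R (pair_op W) V' p' j' q' s'"
  proof (rule splittingI)
    show "lin R (pair_op W)" using W(1) by (rule lin_pair_op)
    show "lin R V'" "lin R p'" "lin R j'" "lin R q'" "lin R s'"
      unfolding V'_def p'_def j'_def q'_def s'_def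
      by (rule lins | rule lin_intros | rule lins[THEN lin_comp])+
  next
    fix x assume x: "x \<in> \<Omega>"
    obtain a b c e where q: "x = quad a b c e" and [simp]: "a \<in> \<Omega>" "b \<in> \<Omega>" "c \<in> \<Omega>" "e \<in> \<Omega>"
      using x by (rule quad_cases)
    note defs = q V'_def p'_def j'_def s'_def q'_def
    show "j' (p' x) = x \<^bold>+ \<^bold>- V' (pair_op W x)" "p' (j' x) = x"
      "s' (q' x) = x \<^bold>+ \<^bold>- pair_op W (V' x)" "q' (s' x) = x"
      "pair_op W (j' x) = \<^bold>0" "q' (pair_op W x) = \<^bold>0"
      "p' (V' x) = \<^bold>0" "V' (s' x) = \<^bold>0"
      by (simp_all add: defs, simp_all add: Omega_arith Om.M.a_ac)
  qed
  moreover define K' where "K' = (\<lambda>n. weave_set (K2 n) (weave_set (K (n - 1)) (K (n - 1))))"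
  define C' where "C' = (\<lambda>n. weave_set (C2 (n - 2)) (weave_set (C (n - 1)) (C (n - 1))))"
  have "graded K' (2 * r + r2)"
    using graded_weave_set0(2)[OF 2(1) graded_weave_set[OF 1(1) 1(1), of 1 1]]
    by (simp add: K'_def[abs_def] mult_2 add_ac)
  moreover have "graded C' (2 * r + r2)"
    using graded_weave_set0(2)[OF graded_shift[OF 2(2), of 2] graded_weave_set[OF 1(2) 1(2), of 1 1]]
    by (simp add: C'_def[abs_def] mult_2 add_ac)
  moreover have "shifts R (quad_grade J) 2 (quad_grade J) V'" "shifts R (quad_grade J) 0 K' p'"
    "shifts R (quad_grade J) 0 C' q'"
    unfolding shifts_def quad_grade_def K'_def C'_def
    by (auto elim!: quad_supportedE simp: V'_def p'_def q'_def
        intro!: supported_closed(2,3) shiftsD[OF 1(4)] shiftsD[OF 1(5)] shiftsD[OF 1(7)]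
          shiftsD[OF 2(4)] shiftsD[OF 2(5)] shiftsD[OF 2(7)] shiftsD[OF W(2)])
  moreover have "shifts R K' 0 (quad_grade J) j'" "shifts R C' 0 (quad_grade J) s'"
    unfolding shifts_def quad_grade_def K'_def C'_def
    by (auto elim!: triple_supportedE simp: j'_def s'_def
        intro!: supported_closed(2,3) shiftsD[OF 1(6)] shiftsD[OF 1(8)]
          shiftsD[OF 2(6)] shiftsD[OF 2(8)] shiftsD[OF W(2)])
  ultimately show ?thesis unfolding graded_split_def by blast
qed

text \<open>The square acts by \<open>(a, e) \<mapsto> (W\<^sup>2 a + 2 W e, W\<^sup>2 e)\<close> on the outer components. In the new coordinate
  \<open>e + W a / 2\<close> in place of \<open>e\<close> this is \<open>(a, e) \<mapsto> (2 W e, W\<^sup>2 e)\<close>, because \<open>W\<^sup>3 = 0\<close>: the component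
  \<open>a\<close> lies in the kernel altogether, and for \<open>e\<close> a splitting of \<open>W\<close> suffices. This is the one place where
  \<open>2\<close> has to be invertible.\<close>

lemma graded_split_pair_op_square:
  assumes half: "h \<in> carrier R" "h \<otimes> (\<one> \<oplus> \<one>) = \<one>"
    and W: "lin R W" "shifts R J (-2) J W" "\<And>x. x \<in> \<Omega> \<Longrightarrow> W (W (W x)) = \<^bold>0"
    and J: "graded J m"
    and r1: "graded_split R J W 2 r" and r2: "graded_split R J (\<lambda>f. W (W f)) 4 r2"
  shows "graded_split R (quad_grade J) (\<lambda>f. pair_op W (pair_op W f)) 4 (m + 2 * r2 + r)"
proof -
  obtain K C V p j q s where 1: "graded K r" "graded C r" "splitting R W V p j q s"
     "shifts R J 2 J V" "shifts R J 0 K p" "shifts R K 0 J j" "shifts R J 0 C q" "shifts R C 0 J s"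
    using r1 unfolding graded_split_def by blast
  obtain K2 C2 V2 p2 j2 q2 s2 where 2: "graded K2 r2" "graded C2 r2"
     "splitting R (\<lambda>f. W (W f)) V2 p2 j2 q2 s2"
     "shifts R J 4 J V2" "shifts R J 0 K2 p2" "shifts R K2 0 J j2" "shifts R J 0 C2 q2" "shifts R C2 0 J s2"
    using r2 unfolding graded_split_def by blast
  have halve: "h \<bullet> (x \<^bold>+ x) = x" "h \<bullet> x \<^bold>+ h \<bullet> x = x" if "x \<in> \<Omega>" for x
  proof -
    have "(h \<otimes> (\<one> \<oplus> \<one>)) \<bullet> x = h \<bullet> (x \<^bold>+ x)"
      using that half(1) by (simp add: Om.smult_assoc1 Om.smult_l_distr)
    then show "h \<bullet> (x \<^bold>+ x) = x" using half(2) that by simp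
    then show "h \<bullet> x \<^bold>+ h \<bullet> x = x" using that half(1) by (simp add: Om.smult_r_distr)
  qed
  have halve': "h \<bullet> x \<^bold>+ (h \<bullet> x \<^bold>+ y) = x \<^bold>+ y" if "x \<in> \<Omega>" "y \<in> \<Omega>" for x y
    using halve(2)[OF that(1)] that half(1) by (simp flip: Om.M.a_assoc)
  note S1 = splittingD[OF 1(3)] and S2 = splittingD[OF 2(3)]
  note lins = S1(1-6) S2(2-6)
  note [simp] = half(1) W(3) lins[THEN lin_simps(1)] lins[THEN lin_simps(2)] lins[THEN lin_simps(3)]
    lins[THEN lin_simps(4)] lins[THEN lin_simps(5)] S1(7-14) S2(7-14) halve
    Om.smult_r_distr Om.smult_r_minus
  define V' where "V' = (\<lambda>f. quad \<^bold>0 (V2 (odds (evens f))) (V2 (evens (odds f))) (h \<bullet> V (evens (evens f))))"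
  define p' where "p' = (\<lambda>f. quad (evens (evens f)) (p2 (odds (evens f))) (p2 (evens (odds f)))
      (p (odds (odds f) \<^bold>+ h \<bullet> W (evens (evens f)))))"
  define j' where "j' = (\<lambda>f. quad (evens (evens f)) (j2 (odds (evens f))) (j2 (evens (odds f)))
      (j (odds (odds f)) \<^bold>+ \<^bold>- (h \<bullet> W (evens (evens f)))))"
  define q' where "q' = (\<lambda>f. quad (q (evens (evens f))) (q2 (odds (evens f))) (q2 (evens (odds f)))
      (odds (odds f) \<^bold>+ \<^bold>- (h \<bullet> W (evens (evens f)))))"
  define s' where "s' = (\<lambda>f. quad (s (evens (evens f))) (s2 (odds (evens f))) (s2 (evens (odds f)))
      (odds (odds f) \<^bold>+ h \<bullet> W (s (evens (evens f)))))"
  have "splitting R (\<lambda>f. pair_op W (pair_op W f)) V' p' j' q' s'"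
  proof (rule splittingI)
    show "lin R (\<lambda>f. pair_op W (pair_op W f))" by (rule lin_comp[OF lin_pair_op[OF W(1)] lin_pair_op[OF W(1)]])
    show "lin R V'" "lin R p'" "lin R j'" "lin R q'" "lin R s'"
      unfolding V'_def p'_def j'_def q'_def s'_def
      by (rule half lins | rule lin_intros | rule lins[THEN lin_comp])+
  next
    fix x assume x: "x \<in> \<Omega>"
    obtain a b c e where q: "x = quad a b c e" and [simp]: "a \<in> \<Omega>" "b \<in> \<Omega>" "c \<in> \<Omega>" "e \<in> \<Omega>"
      using x by (rule quad_cases)
    note defs = q V'_def p'_def j'_def s'_def q'_def
    show "j' (p' x) = x \<^bold>+ \<^bold>- V' (pair_op W (pair_op W x))" "p' (j' x) = x"
      "s' (q' x) = x \<^bold>+ \<^bold>- pair_op W (pair_op W (V' x))" "q' (s' x) = x"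
      "pair_op W (pair_op W (j' x)) = \<^bold>0" "q' (pair_op W (pair_op W x)) = \<^bold>0"
      "p' (V' x) = \<^bold>0" "V' (s' x) = \<^bold>0"
      by (simp_all add: defs, simp_all add: Omega_arith Om.M.a_ac halve')
  qed
  moreover define K' where
    "K' = (\<lambda>n. weave_set (weave_set (J n) (K2 (n - 1))) (weave_set (K2 (n - 1)) (K (n - 2))))"
  define C' where
    "C' = (\<lambda>n. weave_set (weave_set (C n) (C2 (n - 1))) (weave_set (C2 (n - 1)) (J (n - 2))))"
  have "graded K' (m + 2 * r2 + r)"
    using graded_weave_set0(2)[OF graded_weave_set0(1)[OF J 2(1), of 1] graded_weave_set[OF 2(1) 1(1), of 1 2]]
    by (simp add: K'_def[abs_def] mult_2 add_ac)
  moreover have "graded C' (m + 2 * r2 + r)"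
    using graded_weave_set0(2)[OF graded_weave_set0(1)[OF 1(2) 2(2), of 1] graded_weave_set[OF 2(2) J, of 1 2]]
    by (simp add: C'_def[abs_def] mult_2 add_ac)
  moreover have "shifts R (quad_grade J) 4 (quad_grade J) V'" "shifts R (quad_grade J) 0 K' p'"
    "shifts R (quad_grade J) 0 C' q'" "shifts R K' 0 (quad_grade J) j'" "shifts R C' 0 (quad_grade J) s'"
    unfolding shifts_def quad_grade_def K'_def C'_def
    by (auto elim!: quad_supportedE simp: V'_def p'_def q'_def j'_def s'_def
        intro!: supported_closed(2-4) half(1) shiftsD[OF 1(4)] shiftsD[OF 1(5)] shiftsD[OF 1(7)]
          shiftsD[OF 2(4)] shiftsD[OF 2(5)] shiftsD[OF 2(7)] shiftsD[OF W(2)]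
          shiftsD[OF 1(6)] shiftsD[OF 1(8)] shiftsD[OF 2(6)] shiftsD[OF 2(8)])
  ultimately show ?thesis unfolding graded_split_def by blast
qed

section \<open>Koszul complexes\<close>

text \<open>The unit \<open>1\<close> of the exterior algebra: interleaving keeps the empty product at index \<open>0\<close>.\<close>

definition unit0 :: "nat \<Rightarrow> 'a" where
  "unit0 = (\<lambda>i. if i = 0 then \<one> else \<zero>)"

lemma unit0_Omega [simp]: "unit0 \<in> \<Omega>"
  by (simp add: unit0_def seq_module_simps)

lemma unit0_weave: "unit0 = weave unit0 \<^bold>0"
  by (auto simp: unit0_def weave_def seq_module_simps fun_eq_iff)

text \<open>What is used of the Koszul complex on \<open>xs\<close> with differential \<open>D\<close>. The homotopy \<open>h\<close> for \<open>x\<close> is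
  exterior multiplication by the corresponding generator; it shows that \<open>x\<close> acts as zero on the homology. The
  condition at index \<open>0\<close> says that the unit of the exterior algebra does not occur in a boundary with a
  coefficient outside \<open>I\<close>.\<close>

definition koszul_like ::
    "'a set \<Rightarrow> (int \<Rightarrow> nat set) \<Rightarrow> 'a seq_op \<Rightarrow> 'a list \<Rightarrow> bool" where
  "koszul_like I J D xs \<longleftrightarrow> lin R D \<and> (\<forall>f\<in>\<Omega>. D (D f) = \<^bold>0) \<and> shifts R J (-1) J D \<and>
     (\<forall>x\<in>set xs. \<exists>h. lin R h \<and> shifts R J 1 J h \<and> (\<forall>f\<in>\<Omega>. D (h f) \<^bold>+ h (D f) = x \<bullet> f)) \<and>
     (\<forall>f\<in>\<Omega>. D f 0 \<in> I) \<and> D unit0 = \<^bold>0 \<and> unit0 \<in> supported R (J 1)"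

text \<open>The Koszul complex on one more element is the cone of multiplication by it.\<close>

definition koszul_ext :: "'a \<Rightarrow> 'a seq_op \<Rightarrow> (nat \<Rightarrow> 'a) \<Rightarrow> (nat \<Rightarrow> 'a)" where
  "koszul_ext x D f = weave (D (evens f) \<^bold>+ x \<bullet> odds f) (\<^bold>- D (odds f))"

lemma koszul_ext_weave [simp]: "koszul_ext x D (weave a b) = weave (D a \<^bold>+ x \<bullet> b) (\<^bold>- D b)"
  by (simp add: koszul_ext_def)

lemma lin_koszul_ext: "x \<in> carrier R \<Longrightarrow> lin R D \<Longrightarrow> lin R (koszul_ext x D)"
  unfolding koszul_ext_def[abs_def] by (assumption | rule lin_intros | rule lin_comp[of D])+

lemma weave_supportedE:
  assumes "x \<in> supported R (weave_set A B)"
  obtains a b where "x = weave a b" "a \<in> supported R A" "b \<in> supported R B"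
proof -
  obtain a b where "x = weave a b" using weave_cases[OF supported_Omega[OF assms]] by metis
  with assms that show thesis by simp
qed

lemma shiftsI:
  assumes "\<And>n f. f \<in> supported R (J n) \<Longrightarrow> T f \<in> supported R (K (n + k))"
  shows "shifts R J k K T"
  using assms by (simp add: shifts_def)

text \<open>The homotopy for the new element moves the first summand of the cone identically to the second; those for
  the old elements act on both summands, with opposite signs because the differential does.\<close>

lemma koszul_like_ext:
  assumes K: "koszul_like I J D xs" and x: "x \<in> carrier R" and I: "ideal I R" "x \<in> I"
    and xs: "set xs \<subseteq> carrier R"
  shows "koszul_like I (\<lambda>n. weave_set (J n) (J (n - 1))) (koszul_ext x D) (x # xs)"
proof -
  interpret I: ideal I R by fact
  have D: "lin R D" "\<And>f. f \<in> \<Omega> \<Longrightarrow> D (D f) = \<^bold>0" "shifts R J (-1) J D"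
    "\<And>f. f \<in> \<Omega> \<Longrightarrow> D f 0 \<in> I" "D unit0 = \<^bold>0" "unit0 \<in> supported R (J 1)"
    and h: "\<And>y. y \<in> set xs \<Longrightarrow> \<exists>h. lin R h \<and> shifts R J 1 J h \<and> (\<forall>f\<in>\<Omega>. D (h f) \<^bold>+ h (D f) = y \<bullet> f)"
    using K by (auto simp: koszul_like_def)
  note [simp] = x lin_simps[OF D(1)] D(2)
  show ?thesis
    unfolding koszul_like_def
  proof (intro conjI ballI)
    show "lin R (koszul_ext x D)" using x D(1) by (rule lin_koszul_ext)
    show "koszul_ext x D unit0 = \<^bold>0" by (subst unit0_weave) (simp add: D(5))
    show "unit0 \<in> supported R (weave_set (J 1) (J (1 - 1)))" by (subst unit0_weave) (simp add: D(6))
    show "shifts R (\<lambda>n. weave_set (J n) (J (n - 1))) (- 1) (\<lambda>n. weave_set (J n) (J (n - 1))) (koszul_ext x D)"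
      by (auto elim!: weave_supportedE intro!: shiftsI supported_closed(2-4) shiftsD[OF D(3)])
  next
    fix f assume "f \<in> \<Omega>"
    then obtain a b where f: "f = weave a b" and [simp]: "a \<in> \<Omega>" "b \<in> \<Omega>" by (rule weave_cases)
    show "koszul_ext x D (koszul_ext x D f) = \<^bold>0"
      by (simp add: f Om.smult_r_minus, simp add: Omega_arith)
    have "b 0 \<in> carrier R" using \<open>b \<in> \<Omega>\<close> by (simp only: in_Omega_iff)
    moreover have "koszul_ext x D f 0 = D a 0 \<oplus> x \<otimes> b 0"
      by (simp add: f) (simp add: weave_def seq_module_simps)
    ultimately show "koszul_ext x D f 0 \<in> I"
      using D(4)[of a] I(2) by (simp add: I.I_r_closed)
  next
    fix y assume y: "y \<in> set (x # xs)"
    show "\<exists>h. lin R h \<and> shifts R (\<lambda>n. weave_set (J n) (J (n - 1))) 1 (\<lambda>n. weave_set (J n) (J (n - 1))) h \<and>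
       (\<forall>f\<in>\<Omega>. koszul_ext x D (h f) \<^bold>+ h (koszul_ext x D f) = y \<bullet> f)"
    proof (cases "y \<in> set xs")
      case True
      then obtain h where h: "lin R h" "shifts R J 1 J h" "\<forall>f\<in>\<Omega>. D (h f) \<^bold>+ h (D f) = y \<bullet> f"
        using h by blast
      have [simp]: "y \<in> carrier R" using True xs by auto
      note [simp] = lin_simps[OF h(1)]
      let ?h = "\<lambda>f. weave (h (evens f)) (\<^bold>- h (odds f))"
      have "lin R ?h"
        by (rule h(1) | rule lin_intros | rule lin_comp[of h])+
      moreover have "shifts R (\<lambda>n. weave_set (J n) (J (n - 1))) 1 (\<lambda>n. weave_set (J n) (J (n - 1))) ?h"
        by (auto elim!: weave_supportedE intro!: shiftsI supported_closed(2-4) shiftsD[OF h(2)])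
      moreover have "koszul_ext x D (?h f) \<^bold>+ ?h (koszul_ext x D f) = y \<bullet> f" if "f \<in> \<Omega>" for f
      proof -
        obtain a b where f: "f = weave a b" and [simp]: "a \<in> \<Omega>" "b \<in> \<Omega>" using \<open>f \<in> \<Omega>\<close> by (rule weave_cases)
        have "y \<bullet> a = D (h a) \<^bold>+ h (D a)" "y \<bullet> b = D (h b) \<^bold>+ h (D b)" using h(3) by auto
        then show ?thesis
          by (simp add: f Om.smult_r_minus, simp add: Omega_arith Om.M.a_ac)
      qed
      ultimately show ?thesis by blast
    next
      case False
      then have [simp]: "y = x" using y by simp
      let ?h = "\<lambda>f. weave \<^bold>0 (evens f)"
      have "lin R ?h" by (rule lin_intros)+
      moreover have "shifts R (\<lambda>n. weave_set (J n) (J (n - 1))) 1 (\<lambda>n. weave_set (J n) (J (n - 1))) ?h"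
        by (auto elim!: weave_supportedE intro!: shiftsI)
      moreover have "koszul_ext x D (?h f) \<^bold>+ ?h (koszul_ext x D f) = y \<bullet> f" if "f \<in> \<Omega>" for f
      proof -
        obtain a b where f: "f = weave a b" and [simp]: "a \<in> \<Omega>" "b \<in> \<Omega>" using \<open>f \<in> \<Omega>\<close> by (rule weave_cases)
        show ?thesis by (simp add: f, simp add: Omega_arith Om.M.a_ac)
      qed
      ultimately show ?thesis by blast
    qed
  qed
qed

text \<open>What is used of a sum of double contractions \<open>\<iota>\<^sub>i\<iota>\<^sub>j\<close>.\<close>

definition contraction :: "(int \<Rightarrow> nat set) \<Rightarrow> 'a seq_op \<Rightarrow> 'a seq_op \<Rightarrow> bool" where
  "contraction J D W \<longleftrightarrow> lin R W \<and> shifts R J (-2) J W \<and> (\<forall>f\<in>\<Omega>. W (D f) = D (W f)) \<and> W unit0 = \<^bold>0"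

lemma contraction_pair_op:
  assumes W: "contraction J D W" and D: "lin R D" and xy: "x \<in> carrier R" "y \<in> carrier R"
  shows "contraction (quad_grade J) (koszul_ext y (koszul_ext x D)) (pair_op W)"
  unfolding contraction_def
proof (intro conjI ballI)
  have W: "lin R W" "shifts R J (-2) J W" "\<And>f. f \<in> \<Omega> \<Longrightarrow> W (D f) = D (W f)" "W unit0 = \<^bold>0"
    using assms(1) by (auto simp: contraction_def)
  note [simp] = xy lin_simps[OF W(1)] lin_simps[OF D] W(3,4)
  show "lin R (pair_op W)" "shifts R (quad_grade J) (- 2) (quad_grade J) (pair_op W)"
    using W by (simp_all add: lin_pair_op pair_op_shifts)
  have "unit0 = quad unit0 \<^bold>0 \<^bold>0 \<^bold>0"
    by (subst unit0_weave, subst (1) unit0_weave) simp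
  then show "pair_op W unit0 = \<^bold>0" by (rule ssubst) (simp only: pair_op_quad, simp)
  fix f assume "f \<in> \<Omega>"
  then obtain a b c e where f: "f = quad a b c e" and [simp]: "a \<in> \<Omega>" "b \<in> \<Omega>" "c \<in> \<Omega>" "e \<in> \<Omega>"
    by (rule quad_cases)
  show "pair_op W (koszul_ext y (koszul_ext x D) f) = koszul_ext y (koszul_ext x D) (pair_op W f)"
    by (simp add: f, simp add: Omega_arith Om.M.a_ac)
qed

section \<open>Cancellation in the cone\<close>

text \<open>The cone has the differential \<open>(a, b) \<mapsto> (D a, W a - D b)\<close>. By homological perturbation the
  splitting of \<open>W\<close> gives chain maps between the cone and \<open>ker W \<oplus> coker W\<close>, namely
  \<open>(u, v) \<mapsto> (j u + V D s v, s v)\<close> into the cone and \<open>(a, b) \<mapsto> (p a - p D V b, q b)\<close> out of it,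
  whose composite on \<open>ker W \<oplus> coker W\<close> is the identity, for the differential
  \<open>(u, v) \<mapsto> (p D j u + p D V D s v, - q D s v)\<close>. So this squares to zero, and an element of the ring that
  kills the homology of the cone also kills the homology of the reduced module.

  The second-order term \<open>p D V D s\<close> has degree \<open>0\<close>, and leads from the cokernel to the kernel. The flag therefore
  adds the degrees of the two summands alternately, first those of the kernel.\<close>

lemma reduced_cone:
  assumes K: "koszul_like I J D xs" and W: "contraction J D W" and J: "graded J m"
    and red: "graded_split R J W 2 r" and xs: "set xs \<subseteq> carrier R" and I: "\<one> \<notin> I"
  obtains \<delta> G B where "lin R \<delta>" "\<And>f. f \<in> \<Omega> \<Longrightarrow> \<delta> (\<delta> f) = \<^bold>0"
    and "finite B" "card B = 2 * r"
    and "mono G" "G (0::nat) = {}" "(\<Union>i. G i) = B"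
    and "\<And>i f. f \<in> supported R (G (Suc i)) \<Longrightarrow> \<delta> f \<in> supported R (G i)"
    and "\<And>x z. x \<in> set xs \<Longrightarrow> z \<in> supported R B \<Longrightarrow> \<delta> z = \<^bold>0 \<Longrightarrow>
      \<exists>w\<in>supported R B. \<delta> w = x \<bullet> (x \<bullet> z)"
    and "\<exists>z\<in>supported R B. \<delta> z = \<^bold>0 \<and> (\<forall>w\<in>\<Omega>. \<delta> w \<noteq> z)"
proof -
  have D: "lin R D" "\<And>f. f \<in> \<Omega> \<Longrightarrow> D (D f) = \<^bold>0" "shifts R J (-1) J D"
    "\<And>f. f \<in> \<Omega> \<Longrightarrow> D f 0 \<in> I" "D unit0 = \<^bold>0" "unit0 \<in> supported R (J 1)"
    and h: "\<And>y. y \<in> set xs \<Longrightarrow> \<exists>h. lin R h \<and> shifts R J 1 J h \<and> (\<forall>f\<in>\<Omega>. D (h f) \<^bold>+ h (D f) = y \<bullet> f)"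
    using K by (auto simp: koszul_like_def)
  have W: "lin R W" "shifts R J (-2) J W" "\<And>f. f \<in> \<Omega> \<Longrightarrow> W (D f) = D (W f)" "W unit0 = \<^bold>0"
    using W by (auto simp: contraction_def)
  obtain K C V p j q s where 1: "graded K r" "graded C r" "splitting R W V p j q s"
     "shifts R J 2 J V" "shifts R J 0 K p" "shifts R K 0 J j" "shifts R J 0 C q" "shifts R C 0 J s"
    using red unfolding graded_split_def by blast
  note S = splittingD[OF 1(3)]
  note lins = S(1-6) D(1)
  note [simp] = lins[THEN lin_simps(1)] lins[THEN lin_simps(2)] lins[THEN lin_simps(3)]
    lins[THEN lin_simps(4)] lins[THEN lin_simps(5)] S(7-14) D(2,5) W(3,4)
  define \<delta>1 where "\<delta>1 = (\<lambda>u v. p (D (j u)) \<^bold>+ p (D (V (D (s v)))))"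
  define \<delta>2 where "\<delta>2 = (\<lambda>v. \<^bold>- q (D (s v)))"
  define \<delta> where "\<delta> = (\<lambda>f. weave (\<delta>1 (evens f) (odds f)) (\<delta>2 (odds f)))"
  \<comment> \<open>the first component of the inclusion into the cone\<close>
  define g where "g = (\<lambda>u v. j u \<^bold>+ V (D (s v)))"
  have [simp]: "v \<in> \<Omega> \<Longrightarrow> \<delta>2 v \<in> \<Omega>" "u \<in> \<Omega> \<Longrightarrow> v \<in> \<Omega> \<Longrightarrow> \<delta>1 u v \<in> \<Omega>"
    "u \<in> \<Omega> \<Longrightarrow> v \<in> \<Omega> \<Longrightarrow> g u v \<in> \<Omega>" for u v
    by (simp_all add: \<delta>1_def \<delta>2_def g_def)
  have Dg: "D (g u v) = g (\<delta>1 u v) (\<delta>2 v)" and Wg: "W (g u v) \<^bold>+ \<^bold>- D (s v) = s (\<delta>2 v)"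
    if "u \<in> \<Omega>" "v \<in> \<Omega>" for u v
    using that by (simp_all add: \<delta>1_def \<delta>2_def g_def, simp_all add: Omega_arith Om.M.a_ac)
  have pg: "p (g u v) = u" if "u \<in> \<Omega>" "v \<in> \<Omega>" for u v
    using that by (simp add: g_def)
  have qDW [simp]: "q (D (W x)) = \<^bold>0" if "x \<in> \<Omega>" for x
    using S(12)[of "D x"] that by simp
  have lin_\<delta>: "lin R \<delta>"
    unfolding \<delta>_def \<delta>1_def \<delta>2_def by (rule lins | rule lin_intros | rule lins[THEN lin_comp])+
  have \<delta>\<delta>: "\<delta> (\<delta> f) = \<^bold>0" if "f \<in> \<Omega>" for f
  proof -
    obtain u v where f: "f = weave u v" and [simp]: "u \<in> \<Omega>" "v \<in> \<Omega>" using \<open>f \<in> \<Omega>\<close> by (rule weave_cases)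
    have "g (\<delta>1 (\<delta>1 u v) (\<delta>2 v)) (\<delta>2 (\<delta>2 v)) = D (g (\<delta>1 u v) (\<delta>2 v))"
      by (rule Dg[symmetric]) simp_all
    also have "\<dots> = D (D (g u v))"
      by (simp only: Dg[OF \<open>u \<in> \<Omega>\<close> \<open>v \<in> \<Omega>\<close>])
    also have "\<dots> = \<^bold>0"
      by simp
    finally have *: "g (\<delta>1 (\<delta>1 u v) (\<delta>2 v)) (\<delta>2 (\<delta>2 v)) = \<^bold>0" .
    have "\<delta>1 (\<delta>1 u v) (\<delta>2 v) = p (g (\<delta>1 (\<delta>1 u v) (\<delta>2 v)) (\<delta>2 (\<delta>2 v)))"
      by (rule pg[symmetric]) simp_all
    also have "\<dots> = \<^bold>0"
      by (simp only: * lins[THEN lin_simps(5)])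
    finally have "\<delta>1 (\<delta>1 u v) (\<delta>2 v) = \<^bold>0" .
    moreover have "\<delta>2 (\<delta>2 v) = \<^bold>0"
      by (simp add: \<delta>2_def)
    ultimately show ?thesis by (simp add: \<delta>_def f)
  qed
  \<comment> \<open>the projection from the cone is a chain map\<close>
  have proj: "\<delta>1 (p a \<^bold>+ \<^bold>- p (D (V b))) (q b) = p (D a) \<^bold>+ \<^bold>- p (D (V (W a \<^bold>+ \<^bold>- D b)))"
     "\<delta>2 (q b) = q (W a \<^bold>+ \<^bold>- D b)"
    if "a \<in> \<Omega>" "b \<in> \<Omega>" for a b
    using that by (simp_all add: \<delta>1_def \<delta>2_def g_def, simp_all add: Omega_arith Om.M.a_ac)
  have monoJ: "J (int P) \<subseteq> J (int P + 1)" for P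
  proof -
    have "mono J" using J unfolding graded_def by blast
    then show ?thesis by (rule monoD) simp
  qed
  have \<delta>_weave: "\<delta> (weave u v) = weave (\<delta>1 u v) (\<delta>2 v)" for u v
    by (simp add: \<delta>_def)
  obtain M where M: "\<And>n. n \<ge> M \<Longrightarrow> K n = K M" "finite (K M)" "card (K M) = r"
    using 1(1) unfolding graded_def by blast
  obtain N where N: "\<And>n. n \<ge> N \<Longrightarrow> C n = C N" "finite (C N)" "card (C N) = r"
    using 1(2) unfolding graded_def by blast
  have KC: "mono K" "mono C" "K 0 = {}" "C 0 = {}"
    using 1(1,2) unfolding graded_def by blast+
  define P where "P = nat (max M N)"
  have P0: "M \<le> int P" "N \<le> int P"
    unfolding P_def by linarith+
  have KP: "K n \<subseteq> K (int P)" and CP: "C n \<subseteq> C (int P)" for n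
  proof -
    have "K (max n (int P)) = K M" "K (int P) = K M" "C (max n (int P)) = C N" "C (int P) = C N"
      by (rule M(1) N(1); use P0 in linarith)+
    then show "K n \<subseteq> K (int P)" "C n \<subseteq> C (int P)"
      using monoD[OF KC(1), of n "max n (int P)"] monoD[OF KC(2), of n "max n (int P)"] by auto
  qed
  define B where "B = weave_set (K (int P)) (C (int P))"
  \<comment> \<open>one degree of the kernel, then the same degree of the cokernel\<close>
  define G where "G = (\<lambda>i::nat. weave_set (K (int ((i + 1) div 2))) (C (int (i div 2))))"
  have P: "K (int P) = K M" "C (int P) = C N"
    using M(1)[OF P0(1)] N(1)[OF P0(2)] .
  have B: "finite B" "card B = 2 * r"
    using M(2,3) N(2,3) by (simp_all add: B_def P finite_weave_set card_weave_set)
  have G: "mono G" "G 0 = {}"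
  proof -
    show "mono G"
      unfolding G_def
      by (intro monoI weave_set_mono monoD[OF KC(1)] monoD[OF KC(2)]) (simp_all add: div_le_mono)
    show "G 0 = {}" by (simp add: G_def KC)
  qed
  have GB: "(\<Union>i. G i) = B"
  proof
    show "(\<Union>i. G i) \<subseteq> B"
      unfolding B_def G_def by (intro UN_least weave_set_mono KP CP)
    have "B = G (2 * P)" by (simp add: B_def G_def)
    then show "B \<subseteq> (\<Union>i. G i)" by blast
  qed
  have lower: "\<delta> f \<in> supported R (G i)" if "f \<in> supported R (G (Suc i))" for i f
  proof -
    obtain u v where f: "f = weave u v"
      and u: "u \<in> supported R (K (int ((i + 2) div 2)))" and v: "v \<in> supported R (C (int ((i + 1) div 2)))"
      using \<open>f \<in> supported R (G (Suc i))\<close> by (auto simp: G_def elim: weave_supportedE)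
    have "p (D (j u)) \<in> supported R (K (int (i div 2)))"
      using shiftsD[OF 1(5) shiftsD[OF D(3) shiftsD[OF 1(6) u refl] refl] refl] by simp
    then have a: "p (D (j u)) \<in> supported R (K (int ((i + 1) div 2)))"
      by (rule supported_mono[rotated]) (intro monoD[OF KC(1)], simp add: div_le_mono)
    have b: "p (D (V (D (s v)))) \<in> supported R (K (int ((i + 1) div 2)))"
      using shiftsD[OF 1(5) shiftsD[OF D(3) shiftsD[OF 1(4) shiftsD[OF D(3) shiftsD[OF 1(8) v refl] refl] refl] refl] refl] by simp
    have "q (D (s v)) \<in> supported R (C (int ((i + 1) div 2) - 1))"
      using shiftsD[OF 1(7) shiftsD[OF D(3) shiftsD[OF 1(8) v refl] refl] refl] by simp
    then have c: "q (D (s v)) \<in> supported R (C (int (i div 2)))"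
      by (rule supported_mono[rotated]) (intro monoD[OF KC(2)], linarith)
    show ?thesis
      using a b c by (simp add: f \<delta>_weave \<delta>1_def \<delta>2_def G_def)
  qed
  have kill: "\<exists>w\<in>supported R B. \<delta> w = x \<bullet> (x \<bullet> z)"
    if x: "x \<in> set xs" and z: "z \<in> supported R B" "\<delta> z = \<^bold>0" for x z
  proof -
    obtain h where h: "lin R h" "shifts R J 1 J h" "\<And>f. f \<in> \<Omega> \<Longrightarrow> D (h f) \<^bold>+ h (D f) = x \<bullet> f"
      using h[OF x] by blast
    have [simp]: "x \<in> carrier R" using x xs by auto
    note [simp] = lin_simps[OF h(1)]
    obtain u v where zz: "z = weave u v" and u: "u \<in> supported R (K P)" and v: "v \<in> supported R (C P)"
      using z(1) unfolding B_def by (rule weave_supportedE)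
    have [simp]: "u \<in> \<Omega>" "v \<in> \<Omega>" using u v by auto
    define U where "U = g u v"
    \<comment> \<open>If \<open>(U, s v)\<close> is a cycle of the cone, then \<open>x (U, s v)\<close> is the boundary of \<open>(h U, 0)\<close> up to \<open>(0, Y)\<close>, and \<open>x Y\<close> is the boundary of \<open>h Y\<close>.\<close>
    define A where "A = h U"
    define Y where "Y = x \<bullet> s v \<^bold>+ \<^bold>- W A"
    have [simp]: "U \<in> \<Omega>" "A \<in> \<Omega>" "Y \<in> \<Omega>" by (simp_all add: U_def A_def Y_def)
    have z0: "\<delta>1 u v = \<^bold>0" "\<delta>2 v = \<^bold>0"
      using z(2) by (simp_all add: zz \<delta>_weave)
    have DU: "D U = \<^bold>0"
      using Dg[of u v] by (simp add: z0 U_def) (simp add: g_def)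
    have WU: "W U = D (s v)"
      using Wg[of u v] by (simp add: z0 flip: U_def) (simp add: Omega_arith)
    have DA: "D A = x \<bullet> U"
      using h(3)[of U] by (simp add: A_def DU)
    have DY: "D Y = \<^bold>0"
      using W(3)[of A] by (simp add: Y_def Om.smult_r_minus DA WU)
        (simp add: DA WU Om.M.r_neg flip: W(3))
    have DhY: "D (h Y) = x \<bullet> Y"
      using h(3)[of Y] by (simp add: DY)
    \<comment> \<open>the projection of \<open>(x A, - h Y)\<close>, whose boundary in the cone is \<open>x\<^sup>2 (U, s v)\<close>\<close>
    define w where "w = weave (p (x \<bullet> A) \<^bold>+ \<^bold>- p (D (V (\<^bold>- h Y)))) (q (\<^bold>- h Y))"
    have e1: "D (x \<bullet> A) = x \<bullet> (x \<bullet> U)"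
      by (simp add: DA)
    have e2: "W (x \<bullet> A) \<^bold>+ \<^bold>- D (\<^bold>- h Y) = x \<bullet> (x \<bullet> s v)"
      by (simp add: DhY) (simp add: Y_def Om.smult_r_minus Om.smult_r_distr, simp add: Omega_arith Om.M.a_ac)
    have "\<delta> w = weave (p (x \<bullet> (x \<bullet> U)) \<^bold>+ \<^bold>- p (D (V (x \<bullet> (x \<bullet> s v))))) (q (x \<bullet> (x \<bullet> s v)))"
    proof -
      have cl: "x \<bullet> A \<in> \<Omega>" "\<^bold>- h Y \<in> \<Omega>" by simp_all
      show ?thesis unfolding w_def \<delta>_weave proj[OF cl] e1 e2 ..
    qed
    also have "\<dots> = x \<bullet> (x \<bullet> z)"
      by (simp add: zz U_def pg)
    finally have "\<delta> w = x \<bullet> (x \<bullet> z)" .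
    moreover have "w \<in> supported R B"
    proof -
      have "j u \<in> supported R (J (int P))" by (rule shiftsD[OF 1(6) u]) simp
      moreover have sv: "s v \<in> supported R (J (int P))" by (rule shiftsD[OF 1(8) v]) simp
      moreover have "V (D (s v)) \<in> supported R (J (int P + 1))"
        using shiftsD[OF 1(4) shiftsD[OF D(3) sv refl] refl] by (simp add: add.commute)
      ultimately have "U \<in> supported R (J (int P + 1))"
        using supported_mono[OF monoJ] by (simp add: U_def g_def)
      then have A: "A \<in> supported R (J (int P + 2))"
        unfolding A_def by (rule shiftsD[OF h(2)]) simp
      then have "W A \<in> supported R (J (int P))"
        by (rule shiftsD[OF W(2)]) simp
      then have "Y \<in> supported R (J (int P))"
        using sv by (simp add: Y_def)
      then have hY: "h Y \<in> supported R (J (int P + 1))"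
        by (rule shiftsD[OF h(2)]) simp
      have "p A \<in> supported R (K (int P + 2))"
        by (rule shiftsD[OF 1(5) A]) simp
      moreover have "p (D (V (h Y))) \<in> supported R (K (int P + 2))"
        using shiftsD[OF 1(5) shiftsD[OF D(3) shiftsD[OF 1(4) hY refl] refl] refl] by (simp add: add.commute)
      moreover have "q (h Y) \<in> supported R (C (int P + 1))"
        by (rule shiftsD[OF 1(7) hY]) simp
      ultimately show ?thesis
        using supported_mono[OF KP] supported_mono[OF CP] by (simp add: w_def B_def)
    qed
    ultimately show ?thesis by blast
  qed
  have nonzero: "p unit0 \<in> \<Omega>" "\<delta> (weave (p unit0) \<^bold>0) = \<^bold>0" "weave (p unit0) \<^bold>0 \<in> supported R B"
    "\<delta> w \<noteq> weave (p unit0) \<^bold>0" if "w \<in> \<Omega>" for w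
  proof -
    show "p unit0 \<in> \<Omega>" by simp
    have e0: "g (p unit0) \<^bold>0 = unit0"
      by (simp add: g_def)
    show "\<delta> (weave (p unit0) \<^bold>0) = \<^bold>0"
      by (simp add: \<delta>_weave \<delta>1_def \<delta>2_def)
    have "p unit0 \<in> supported R (K 1)" by (rule shiftsD[OF 1(5) D(6)]) simp
    then show "weave (p unit0) \<^bold>0 \<in> supported R B"
      using supported_mono[OF KP] by (simp add: B_def)
    show "\<delta> w \<noteq> weave (p unit0) \<^bold>0"
    proof
      assume eq: "\<delta> w = weave (p unit0) \<^bold>0"
      obtain u v where w: "w = weave u v" and [simp]: "u \<in> \<Omega>" "v \<in> \<Omega>" using \<open>w \<in> \<Omega>\<close> by (rule weave_cases)
      have "D (g u v) = unit0"
        using Dg[of u v] eq by (simp add: w \<delta>_weave e0)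
      then show False using D(4)[of "g u v"] I by (simp add: unit0_def)
    qed
  qed
  have "\<exists>z\<in>supported R B. \<delta> z = \<^bold>0 \<and> (\<forall>w\<in>\<Omega>. \<delta> w \<noteq> z)"
    using nonzero(2,3)[of "\<^bold>0"] nonzero(4) by (intro bexI[of _ "weave (p unit0) \<^bold>0"]) auto
  then show thesis
    using that[OF lin_\<delta> \<delta>\<delta> B G GB lower kill] by blast
qed

section \<open>Eight generators\<close>

lemma lin_zero: "lin R (\<lambda>f. \<^bold>0)"
  by (rule lin_intros)

lemma koszul_like_Nil:
  assumes "ideal I R"
  shows "koszul_like I (\<lambda>n. if n \<ge> 1 then {0} else {}) (\<lambda>f. \<^bold>0) []"
proof -
  interpret I: ideal I R by fact
  show ?thesis
    unfolding koszul_like_def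
  proof (intro conjI ballI)
    show "shifts R (\<lambda>n. if n \<ge> 1 then {0} else {}) (- 1) (\<lambda>n. if n \<ge> 1 then {0} else {}) (\<lambda>f. \<^bold>0)"
      by (simp add: shifts_def)
    show "unit0 \<in> supported R (if 1 \<ge> (1::int) then {0} else {})"
      by (simp add: supported_eq) (simp add: unit0_def)
    show "\<^bold>0 0 \<in> I" by (simp add: seq_module_simps I.zero_closed)
  qed (simp_all add: lin_zero)
qed

lemma koszul_exists:
  assumes "ideal I R" "set ys \<subseteq> I" "I \<subseteq> carrier R"
  shows "\<exists>J D. koszul_like I J D ys \<and> graded J (2 ^ length ys)"
  using assms(2)
proof (induction ys)
  case Nil
  have "graded (\<lambda>n. if n \<ge> 1 then {0} else {}) (2 ^ length [])"
    unfolding graded_def by (auto intro!: monoI exI[of _ 1] split: if_splits)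
  then show ?case using koszul_like_Nil[OF assms(1)] by blast
next
  case (Cons y ys)
  then obtain J D where JD: "koszul_like I J D ys" "graded J (2 ^ length ys)" by auto
  have "koszul_like I (\<lambda>n. weave_set (J n) (J (n - 1))) (koszul_ext y D) (y # ys)"
    using Cons.prems assms by (intro koszul_like_ext JD) auto
  moreover have "graded (\<lambda>n. weave_set (J n) (J (n - 1))) (2 ^ length (y # ys))"
    using graded_weave_set0(1)[OF JD(2) JD(2), of 1] by (simp add: mult_2)
  ultimately show ?case by blast
qed

lemma graded_split_zero:
  assumes "graded J m"
  shows "graded_split R J (\<lambda>f. \<^bold>0) k m"
proof -
  have "splitting R (\<lambda>f. \<^bold>0) (\<lambda>f. \<^bold>0) (\<lambda>f. f) (\<lambda>f. f) (\<lambda>f. f) (\<lambda>f. f)"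
    by (rule splittingI) (auto intro: lin_intros simp: Omega_arith)
  moreover have "shifts R J k J (\<lambda>f. \<^bold>0)" "shifts R J 0 J (\<lambda>f. f)"
    by (auto simp: shifts_def)
  ultimately show ?thesis
    unfolding graded_split_def using assms by blast
qed

text \<open>A Koszul complex of rank \<open>m\<close> together with a sum \<open>W\<close> of double contractions such that the kernels of \<open>W\<close> and
  \<open>W\<^sup>2\<close> are free of ranks \<open>r\<close> and \<open>r2\<close>.\<close>

definition stage where
  "stage I J D W xs m r r2 \<longleftrightarrow> koszul_like I J D xs \<and> contraction J D W \<and> graded J m \<and>
     graded_split R J W 2 r \<and> graded_split R J (\<lambda>f. W (W f)) 4 r2"

lemma stage_zero:
  assumes "koszul_like I J D xs" "graded J m"
  shows "stage I J D (\<lambda>f. \<^bold>0) xs m m m"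
proof -
  have "lin R D" using assms(1) by (simp add: koszul_like_def)
  then have "contraction J D (\<lambda>f. \<^bold>0)"
    by (simp add: contraction_def lin_zero lin_simps(5) shifts_def)
  then show ?thesis using assms graded_split_zero by (simp add: stage_def)
qed

lemma koszul_like_quad:
  assumes "koszul_like I J D xs" "ideal I R" "I \<subseteq> carrier R" "x \<in> I" "y \<in> I" "set xs \<subseteq> I"
  shows "koszul_like I (quad_grade J) (koszul_ext y (koszul_ext x D)) (y # x # xs)"
proof -
  have "quad_grade J = (\<lambda>n. weave_set (weave_set (J n) (J (n - 1))) (weave_set (J (n - 1)) (J (n - 1 - 1))))"
    by (simp add: quad_grade_def[abs_def])
  then show ?thesis
    by (simp only:) (intro koszul_like_ext, use assms in auto)
qed

lemma stage_step:
  assumes half: "h \<in> carrier R" "h \<otimes> (\<one> \<oplus> \<one>) = \<one>"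
    and I: "ideal I R" "I \<subseteq> carrier R" "x \<in> I" "y \<in> I" "set xs \<subseteq> I"
    and S: "stage I J D W xs m r r2" and W3: "\<And>f. f \<in> \<Omega> \<Longrightarrow> W (W (W f)) = \<^bold>0"
  shows "stage I (quad_grade J) (koszul_ext y (koszul_ext x D)) (pair_op W) (y # x # xs)
           (4 * m) (2 * r + r2) (m + 2 * r2 + r)"
proof -
  have S: "koszul_like I J D xs" "contraction J D W" "graded J m"
     "graded_split R J W 2 r" "graded_split R J (\<lambda>f. W (W f)) 4 r2"
    using S by (auto simp: stage_def)
  then have W: "lin R W" "shifts R J (-2) J W" and D: "lin R D"
    by (auto simp: contraction_def koszul_like_def)
  show ?thesis
    unfolding stage_def
    using koszul_like_quad[OF S(1) I] contraction_pair_op[OF S(2) D] I graded_quad[OF S(3)]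
      graded_split_pair_op[OF W S(4,5)] graded_split_pair_op_square[OF half W W3 S(3-5)]
    by auto
qed

lemma pair_op_cube_zero:
  assumes "lin R W" "\<And>f. f \<in> \<Omega> \<Longrightarrow> W (W f) = \<^bold>0" "f \<in> \<Omega>"
  shows "pair_op W (pair_op W (pair_op W f)) = \<^bold>0"
proof -
  note [simp] = lin_simps[OF assms(1)] assms(2)
  obtain a b c e where f: "f = quad a b c e" and [simp]: "a \<in> \<Omega>" "b \<in> \<Omega>" "c \<in> \<Omega>" "e \<in> \<Omega>"
    using assms(3) by (rule quad_cases)
  show ?thesis by (simp add: f del: weave_simps(10) weave_zero_iff) simp
qed

lemma pair_op_square_zero:
  assumes "f \<in> \<Omega>"
  shows "pair_op (\<lambda>f. \<^bold>0) (pair_op (\<lambda>f. \<^bold>0) f) = \<^bold>0"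
proof -
  obtain a b c e where f: "f = quad a b c e" and [simp]: "a \<in> \<Omega>" "b \<in> \<Omega>" "c \<in> \<Omega>" "e \<in> \<Omega>"
    using assms by (rule quad_cases)
  show ?thesis by (simp add: f del: weave_simps(10) weave_zero_iff) simp
qed

text \<open>With \<open>n = 2\<^sup>k\<close>, the triple of ranks of the complex, of the kernel of \<open>W\<close> and of that of \<open>W\<^sup>2\<close> runs
  through \<open>(n, n, n)\<close>, \<open>(4 n, 3 n, 4 n)\<close>, \<open>(16 n, 10 n, 15 n)\<close> and \<open>(64 n, 35 n, 56 n)\<close>. The last pair
  needs only the splitting of \<open>W\<close> itself, of rank \<open>2 \<cdot> 35 n + 56 n\<close>. The conditions
  \<open>W\<^sup>3 = 0\<close> hold since a sum of \<open>i\<close> double contractions has \<open>(i + 1)\<close>-st power zero.\<close>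

lemma small_contraction_exists:
  assumes half: "h \<in> carrier R" "h \<otimes> (\<one> \<oplus> \<one>) = \<one>"
    and I: "ideal I R" "I \<subseteq> carrier R" and xs: "set xs \<subseteq> I" "length xs = 8 + k"
  shows "\<exists>J D W m. koszul_like I J D xs \<and> contraction J D W \<and> graded J m \<and>
    graded_split R J W 2 (126 * 2 ^ k)"
proof -
  obtain x1 x2 x3 x4 x5 x6 x7 x8 ys where
    xs_eq: "xs = x8 # x7 # x6 # x5 # x4 # x3 # x2 # x1 # ys" and ys: "length ys = k"
    using xs(2) by (auto simp: length_Suc_conv numeral_eq_Suc)
  have ysI: "set ys \<subseteq> I" "x1 \<in> I" "x2 \<in> I" "x3 \<in> I" "x4 \<in> I" "x5 \<in> I" "x6 \<in> I" "x7 \<in> I" "x8 \<in> I"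
    using xs(1) by (simp_all add: xs_eq)
  obtain J D where JD: "koszul_like I J D ys" "graded J (2 ^ k)"
    using koszul_exists[OF I(1) ysI(1) I(2)] ys by blast
  define n where "n = (2::nat) ^ k"
  note step = stage_step[OF half I]
  define W1 where "W1 = pair_op (\<lambda>f. \<^bold>0)"
  define W2 where "W2 = pair_op W1"
  have lin: "lin R W1" "lin R W2"
    by (simp_all add: W1_def W2_def lin_pair_op lin_zero)
  have W1: "W1 (W1 f) = \<^bold>0" if "f \<in> \<Omega>" for f
    using pair_op_square_zero[OF that] by (simp add: W1_def)
  have W1': "W1 (W1 (W1 f)) = \<^bold>0" if "f \<in> \<Omega>" for f
    using W1[of "W1 f"] lin_simps(1)[OF lin(1)] that by simp
  have W2: "W2 (W2 (W2 f)) = \<^bold>0" if "f \<in> \<Omega>" for f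
    using pair_op_cube_zero[OF lin(1) W1 that] by (simp add: W2_def)
  note s0 = stage_zero[OF JD]
  note s1 = step[OF ysI(2,3) ysI(1) s0 refl, folded W1_def n_def]
  note s2 = step[OF ysI(4,5) _ s1 W1', folded W2_def]
  note s3 = step[OF ysI(6,7) _ s2 W2]
  from s3 ysI have s3: "stage I (quad_grade (quad_grade (quad_grade J)))
     (koszul_ext x6 (koszul_ext x5 (koszul_ext x4 (koszul_ext x3 (koszul_ext x2 (koszul_ext x1 D))))))
     (pair_op W2) (x6 # x5 # x4 # x3 # x2 # x1 # ys) (64 * n) (35 * n) (56 * n)"
    by (simp add: algebra_simps)
  let ?J = "quad_grade (quad_grade (quad_grade J))"
  let ?D = "koszul_ext x6 (koszul_ext x5 (koszul_ext x4 (koszul_ext x3 (koszul_ext x2 (koszul_ext x1 D)))))"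
  have K: "koszul_like I ?J ?D (x6 # x5 # x4 # x3 # x2 # x1 # ys)" "contraction ?J ?D (pair_op W2)"
    "graded ?J (64 * n)" "graded_split R ?J (pair_op W2) 2 (35 * n)"
    "graded_split R ?J (\<lambda>f. pair_op W2 (pair_op W2 f)) 4 (56 * n)"
    using s3 by (simp_all add: stage_def)
  have W: "lin R (pair_op W2)" "shifts R ?J (-2) ?J (pair_op W2)" and D: "lin R ?D"
    using K(1,2) by (simp_all add: contraction_def koszul_like_def)
  have "koszul_like I (quad_grade ?J) (koszul_ext x8 (koszul_ext x7 ?D)) xs"
    unfolding xs_eq by (rule koszul_like_quad[OF K(1) I]) (use ysI in auto)
  moreover have "contraction (quad_grade ?J) (koszul_ext x8 (koszul_ext x7 ?D)) (pair_op (pair_op W2))"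
    by (rule contraction_pair_op[OF K(2) D]) (use ysI I in auto)
  moreover have "graded (quad_grade ?J) (4 * (64 * n))"
    by (rule graded_quad[OF K(3)])
  moreover have "graded_split R (quad_grade ?J) (pair_op (pair_op W2)) 2 (126 * n)"
    using graded_split_pair_op[OF W K(4,5)] by simp
  ultimately show ?thesis unfolding n_def by blast
qed

end

section \<open>Quotient modules, bases and length\<close>

context module
begin

lemma sub_subset: "submodule N R M \<Longrightarrow> x \<in> N \<Longrightarrow> x \<in> carrier M"
  using submoduleE(1) by blast

lemma sub_zero: "submodule N R M \<Longrightarrow> \<zero>\<^bsub>M\<^esub> \<in> N"
  using submoduleE(2,4)[of N] by (metis R.zero_closed all_not_in_conv smult_l_null sub_subset)

lemma sub_minus:
  "submodule N R M \<Longrightarrow> x \<in> N \<Longrightarrow> y \<in> N \<Longrightarrow> x \<ominus>\<^bsub>M\<^esub> y \<in> N"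
  by (simp add: a_minus_def submoduleE(3,5))

lemma mem_coset_iff: "z \<in> N +>\<^bsub>M\<^esub> x \<longleftrightarrow> (\<exists>n\<in>N. z = n \<oplus>\<^bsub>M\<^esub> x)"
  by (auto simp: a_r_coset_def')

lemma coset_eq_iff:
  assumes N: "submodule N R M" and x: "x \<in> carrier M" and y: "y \<in> carrier M"
  shows "N +>\<^bsub>M\<^esub> x = N +>\<^bsub>M\<^esub> y \<longleftrightarrow> x \<ominus>\<^bsub>M\<^esub> y \<in> N"
proof
  assume "N +>\<^bsub>M\<^esub> x = N +>\<^bsub>M\<^esub> y"
  moreover have "x \<in> N +>\<^bsub>M\<^esub> x"
    unfolding mem_coset_iff using sub_zero[OF N] x by force
  ultimately obtain n where n: "n \<in> N" "x = n \<oplus>\<^bsub>M\<^esub> y" by (auto simp: mem_coset_iff)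
  moreover have "n \<in> carrier M" using sub_subset[OF N n(1)] .
  ultimately show "x \<ominus>\<^bsub>M\<^esub> y \<in> N" using y by (simp add: a_minus_def M.a_assoc M.r_neg)
next
  assume d: "x \<ominus>\<^bsub>M\<^esub> y \<in> N"
  have *: "n \<oplus>\<^bsub>M\<^esub> x = (n \<oplus>\<^bsub>M\<^esub> (x \<ominus>\<^bsub>M\<^esub> y)) \<oplus>\<^bsub>M\<^esub> y"
    "n \<oplus>\<^bsub>M\<^esub> y = (n \<ominus>\<^bsub>M\<^esub> (x \<ominus>\<^bsub>M\<^esub> y)) \<oplus>\<^bsub>M\<^esub> x" if "n \<in> N" for n
    using sub_subset[OF N that] x y
    by (simp_all add: M.sub_arith M.a_ac)
  show "N +>\<^bsub>M\<^esub> x = N +>\<^bsub>M\<^esub> y"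
  proof (intro equalityI subsetI; unfold mem_coset_iff; elim bexE)
    fix z n assume n: "n \<in> N" "z = n \<oplus>\<^bsub>M\<^esub> x"
    show "\<exists>n\<in>N. z = n \<oplus>\<^bsub>M\<^esub> y"
      unfolding n(2) *(1)[OF n(1)] using submoduleE(5)[OF N n(1) d] by (rule bexI[rotated]) (rule refl)
  next
    fix z n assume n: "n \<in> N" "z = n \<oplus>\<^bsub>M\<^esub> y"
    show "\<exists>n\<in>N. z = n \<oplus>\<^bsub>M\<^esub> x"
      unfolding n(2) *(2)[OF n(1)] using sub_minus[OF N n(1) d] by (rule bexI[rotated]) (rule refl)
  qed
qed

lemma quot_carrier: "carrier (quot_module M N) = (\<lambda>x. N +>\<^bsub>M\<^esub> x) ` carrier M"
  by (auto simp: quot_module_def A_RCOSETS_def')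

lemma quot_zero: "submodule N R M \<Longrightarrow> \<zero>\<^bsub>quot_module M N\<^esub> = N +>\<^bsub>M\<^esub> \<zero>\<^bsub>M\<^esub>"
  by (simp add: quot_module_def M.a_coset_add_zero sub_subset subsetI)

lemma quot_add:
  assumes N: "submodule N R M" and "x \<in> carrier M" "y \<in> carrier M"
  shows "(N +>\<^bsub>M\<^esub> x) \<oplus>\<^bsub>quot_module M N\<^esub> (N +>\<^bsub>M\<^esub> y) = N +>\<^bsub>M\<^esub> (x \<oplus>\<^bsub>M\<^esub> y)"
proof -
  interpret N: abelian_subgroup N M
    by (rule abelian_subgroupI2[OF M.a_comm_group submodule.axioms(1)[OF N]])
  show ?thesis using assms by (simp add: quot_module_def N.a_rcos_sum)
qed

lemma quot_smult:
  assumes N: "submodule N R M" and a: "a \<in> carrier R" and x: "x \<in> carrier M"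
  shows "a \<odot>\<^bsub>quot_module M N\<^esub> (N +>\<^bsub>M\<^esub> x) = N +>\<^bsub>M\<^esub> (a \<odot>\<^bsub>M\<^esub> x)"
proof -
  have "N +>\<^bsub>M\<^esub> (a \<odot>\<^bsub>M\<^esub> y) = N +>\<^bsub>M\<^esub> (a \<odot>\<^bsub>M\<^esub> x)" if y: "y \<in> N +>\<^bsub>M\<^esub> x" for y
  proof -
    obtain n where n: "n \<in> N" "y = n \<oplus>\<^bsub>M\<^esub> x" using y by (auto simp: mem_coset_iff)
    have nM: "n \<in> carrier M" using sub_subset[OF N n(1)] .
    have "a \<odot>\<^bsub>M\<^esub> y \<ominus>\<^bsub>M\<^esub> a \<odot>\<^bsub>M\<^esub> x = a \<odot>\<^bsub>M\<^esub> n"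
      using nM a x by (simp add: n(2) smult_r_distr a_minus_def M.a_assoc M.r_neg)
    also have "\<dots> \<in> N" using submoduleE(4)[OF N a n(1)] .
    finally show ?thesis
      using coset_eq_iff[OF N] a x nM by (simp add: n(2))
  qed
  then have "(\<Union>y\<in>N +>\<^bsub>M\<^esub> x. N +>\<^bsub>M\<^esub> (a \<odot>\<^bsub>M\<^esub> y)) = (\<Union>y\<in>N +>\<^bsub>M\<^esub> x. N +>\<^bsub>M\<^esub> (a \<odot>\<^bsub>M\<^esub> x))"
    by (rule SUP_cong[OF refl])
  also have "\<dots> = N +>\<^bsub>M\<^esub> (a \<odot>\<^bsub>M\<^esub> x)"
  proof -
    have "x \<in> N +>\<^bsub>M\<^esub> x"
      unfolding mem_coset_iff using sub_zero[OF N] x by (intro bexI[of _ "\<zero>\<^bsub>M\<^esub>"]) simp_all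
    then show ?thesis by (intro cSUP_const) blast
  qed
  finally show ?thesis by (simp add: quot_module_def)
qed

lemma quot_is_module:
  assumes N: "submodule N R M"
  shows "module R (quot_module M N)"
proof (rule moduleI)
  note [simp] = quot_carrier quot_zero[OF N] quot_add[OF N] quot_smult[OF N]
  show "cring R" by (rule R.is_cring)
  show "abelian_group (quot_module M N)"
  proof (rule abelian_groupI)
    fix C assume "C \<in> carrier (quot_module M N)"
    then obtain x where "C = N +>\<^bsub>M\<^esub> x" "x \<in> carrier M" by auto
    then show "\<exists>Y\<in>carrier (quot_module M N). Y \<oplus>\<^bsub>quot_module M N\<^esub> C = \<zero>\<^bsub>quot_module M N\<^esub>"
      by (auto simp: M.l_neg intro!: bexI[of _ "\<ominus>\<^bsub>M\<^esub> x"])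
  qed (auto simp: M.a_ac)
qed (auto simp: quot_carrier quot_add[OF N] quot_smult[OF N] smult_l_distr smult_r_distr smult_assoc1)

end

lemma finsum_hom:
  assumes M: "module R M" and N: "module R N"
    and \<phi>: "\<And>x. x \<in> carrier M \<Longrightarrow> \<phi> x \<in> carrier N"
      "\<And>x y. x \<in> carrier M \<Longrightarrow> y \<in> carrier M \<Longrightarrow> \<phi> (x \<oplus>\<^bsub>M\<^esub> y) = \<phi> x \<oplus>\<^bsub>N\<^esub> \<phi> y"
      "\<And>a x. a \<in> carrier R \<Longrightarrow> x \<in> carrier M \<Longrightarrow> \<phi> (a \<odot>\<^bsub>M\<^esub> x) = a \<odot>\<^bsub>N\<^esub> \<phi> x"
    and f: "finite A" "f \<in> A \<rightarrow> carrier M"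
  shows "\<phi> (\<Oplus>\<^bsub>M\<^esub>b\<in>A. f b) = (\<Oplus>\<^bsub>N\<^esub>b\<in>A. \<phi> (f b))"
proof -
  interpret M: module R M by fact
  interpret N: module R N by fact
  have "\<phi> \<zero>\<^bsub>M\<^esub> = \<zero>\<^bsub>N\<^esub>"
    using \<phi>(3)[of "\<zero>\<^bsub>R\<^esub>" "\<zero>\<^bsub>M\<^esub>"] \<phi>(1)[of "\<zero>\<^bsub>M\<^esub>"] by simp
  with f show ?thesis
    by (induction A rule: finite_induct) (auto simp: \<phi> Pi_def)
qed

text \<open>A basis is transported together with its coefficient functions; \<open>inv_into B \<phi>\<close> recovers the old basis
  element from the new one.\<close>

lemma free_module_transfer:
  assumes M: "module R M" and N: "module R N"
    and \<phi>: "bij_betw \<phi> (carrier M) (carrier N)"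
      "\<And>x y. x \<in> carrier M \<Longrightarrow> y \<in> carrier M \<Longrightarrow> \<phi> (x \<oplus>\<^bsub>M\<^esub> y) = \<phi> x \<oplus>\<^bsub>N\<^esub> \<phi> y"
      "\<And>a x. a \<in> carrier R \<Longrightarrow> x \<in> carrier M \<Longrightarrow> \<phi> (a \<odot>\<^bsub>M\<^esub> x) = a \<odot>\<^bsub>N\<^esub> \<phi> x"
    and B: "is_basis R M B"
  shows "is_basis R N (\<phi> ` B)"
proof -
  interpret M: module R M by fact
  interpret N: module R N by fact
  have inj: "inj_on \<phi> (carrier M)" and img: "\<phi> ` carrier M = carrier N"
    using \<phi>(1) by (auto simp: bij_betw_def)
  have BM: "B \<subseteq> carrier M" using B by (simp add: is_basis_def)
  have cl: "\<phi> x \<in> carrier N" if "x \<in> carrier M" for x using img that by blast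
  have sum: "\<phi> (\<Oplus>\<^bsub>M\<^esub>b\<in>A. a b \<odot>\<^bsub>M\<^esub> b) = (\<Oplus>\<^bsub>N\<^esub>c\<in>\<phi> ` A. a (inv_into B \<phi> c) \<odot>\<^bsub>N\<^esub> c)"
    if "finite A" "A \<subseteq> B" "a \<in> A \<rightarrow> carrier R" for A a
  proof -
    have injA: "inj_on \<phi> A" using inj_on_subset[OF inj] BM that by blast
    have injB: "inj_on \<phi> B" using inj_on_subset[OF inj] BM by blast
    have "\<phi> (\<Oplus>\<^bsub>M\<^esub>b\<in>A. a b \<odot>\<^bsub>M\<^esub> b) = (\<Oplus>\<^bsub>N\<^esub>b\<in>A. \<phi> (a b \<odot>\<^bsub>M\<^esub> b))"
      using that BM by (intro finsum_hom[OF M N cl \<phi>(2,3)]) auto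
    also have "\<dots> = (\<Oplus>\<^bsub>N\<^esub>b\<in>A. a (inv_into B \<phi> (\<phi> b)) \<odot>\<^bsub>N\<^esub> \<phi> b)"
      using that BM injB cl by (intro N.finsum_cong') (auto simp: \<phi>(3) Pi_def subset_iff)
    also have "\<dots> = (\<Oplus>\<^bsub>N\<^esub>c\<in>\<phi> ` A. a (inv_into B \<phi> c) \<odot>\<^bsub>N\<^esub> c)"
      using that BM injB cl by (intro N.finsum_reindex[symmetric] injA) (auto simp: Pi_def subset_iff)
    finally show ?thesis .
  qed
  note span = B[unfolded is_basis_def, THEN conjunct2, THEN conjunct1]
    and indep = B[unfolded is_basis_def, THEN conjunct2, THEN conjunct2]
  show ?thesis
    unfolding is_basis_def
  proof (intro conjI ballI allI impI)
    show "\<phi> ` B \<subseteq> carrier N" using BM img by blast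
  next
    fix y assume "y \<in> carrier N"
    then obtain x where x: "x \<in> carrier M" "y = \<phi> x" using img by blast
    obtain A a where A: "finite A" "A \<subseteq> B" "a \<in> A \<rightarrow> carrier R" "x = (\<Oplus>\<^bsub>M\<^esub>b\<in>A. a b \<odot>\<^bsub>M\<^esub> b)"
      using bspec[OF span x(1)] by (elim exE conjE) (rule that)
    have injB: "inj_on \<phi> B" using inj_on_subset[OF inj] BM by blast
    show "\<exists>A a. finite A \<and> A \<subseteq> \<phi> ` B \<and> a \<in> A \<rightarrow> carrier R \<and> y = (\<Oplus>\<^bsub>N\<^esub>b\<in>A. a b \<odot>\<^bsub>N\<^esub> b)"
    proof (intro exI conjI)
      show "finite (\<phi> ` A)" "\<phi> ` A \<subseteq> \<phi> ` B" using A(1,2) by blast+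
      show "(\<lambda>c. a (inv_into B \<phi> c)) \<in> \<phi> ` A \<rightarrow> carrier R"
        using A(2,3) injB by (auto simp: Pi_def subset_iff)
      show "y = (\<Oplus>\<^bsub>N\<^esub>c\<in>\<phi> ` A. a (inv_into B \<phi> c) \<odot>\<^bsub>N\<^esub> c)"
        using sum[OF A(1-3)] unfolding x(2) A(4) .
    qed
  next
    fix A a b
    assume A: "finite A" "A \<subseteq> \<phi> ` B" "a \<in> A \<rightarrow> carrier R" and z: "(\<Oplus>\<^bsub>N\<^esub>b\<in>A. a b \<odot>\<^bsub>N\<^esub> b) = \<zero>\<^bsub>N\<^esub>"
      and b: "b \<in> A"
    define A' where "A' = inv_into B \<phi> ` A"
    have injB: "inj_on \<phi> B" using inj_on_subset[OF inj] BM by blast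
    have A': "finite A'" "A' \<subseteq> B" "\<phi> ` A' = A"
    proof -
      show "finite A'" using A(1) by (simp add: A'_def)
      show "A' \<subseteq> B" using A(2) inv_into_into[of _ \<phi> B] unfolding A'_def by blast
      show "\<phi> ` A' = A" unfolding A'_def by (rule image_inv_into_cancel[OF refl A(2)])
    qed
    have "\<phi> (\<Oplus>\<^bsub>M\<^esub>b\<in>A'. (a \<circ> \<phi>) b \<odot>\<^bsub>M\<^esub> b) = (\<Oplus>\<^bsub>N\<^esub>c\<in>A. (a \<circ> \<phi>) (inv_into B \<phi> c) \<odot>\<^bsub>N\<^esub> c)"
      using sum[OF A'(1,2), of "a \<circ> \<phi>"] A A' by (auto simp: Pi_def)
    also have "\<dots> = (\<Oplus>\<^bsub>N\<^esub>c\<in>A. a c \<odot>\<^bsub>N\<^esub> c)"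
      using A BM cl by (intro N.finsum_cong') (auto simp: f_inv_into_f subset_iff Pi_def)
    also have "\<dots> = \<phi> \<zero>\<^bsub>M\<^esub>"
      using z \<phi>(3)[of "\<zero>\<^bsub>R\<^esub>" "\<zero>\<^bsub>M\<^esub>"] cl[of "\<zero>\<^bsub>M\<^esub>"] by simp
    finally have "(\<Oplus>\<^bsub>M\<^esub>b\<in>A'. (a \<circ> \<phi>) b \<odot>\<^bsub>M\<^esub> b) = \<zero>\<^bsub>M\<^esub>"
      using A A' BM by (intro inj_onD[OF inj]) (auto intro!: M.finsum_closed simp: Pi_def subset_iff)
    moreover have "a \<circ> \<phi> \<in> A' \<rightarrow> carrier R" using A A' by auto
    ultimately have "\<forall>b\<in>A'. (a \<circ> \<phi>) b = \<zero>\<^bsub>R\<^esub>"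
      using indep[THEN spec, THEN spec, THEN mp, THEN mp, THEN mp, THEN mp, OF A'(1,2)] by simp
    then show "a b = \<zero>\<^bsub>R\<^esub>" using b A'(3) by auto
  qed
qed

context module
begin

text \<open>The interval of submodules between \<open>A\<close> and \<open>C\<close> has a strictly monotone map to \<open>{0..n}\<close>. Such a rank function is
  easier to extend along an extension of submodules than a bound on the length of chains.\<close>

definition bounded_length :: "'c set \<Rightarrow> 'c set \<Rightarrow> nat \<Rightarrow> bool" where
  "bounded_length A C n \<longleftrightarrow> (\<exists>rk :: 'c set \<Rightarrow> nat.
     (\<forall>N. submodule N R M \<and> A \<subseteq> N \<and> N \<subseteq> C \<longrightarrow> rk N \<le> n) \<and>
     (\<forall>N N'. submodule N R M \<and> submodule N' R M \<and> A \<subseteq> N \<and> N \<subset> N' \<and> N' \<subseteq> C \<longrightarrow> rk N < rk N'))"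

lemma bounded_lengthE:
  assumes "bounded_length A C n"
  obtains rk where "\<And>N. submodule N R M \<Longrightarrow> A \<subseteq> N \<Longrightarrow> N \<subseteq> C \<Longrightarrow> rk N \<le> n"
    "\<And>N N'. submodule N R M \<Longrightarrow> submodule N' R M \<Longrightarrow> A \<subseteq> N \<Longrightarrow> N \<subset> N' \<Longrightarrow> N' \<subseteq> C \<Longrightarrow> rk N < rk N'"
proof -
  obtain rk :: "'c set \<Rightarrow> nat" where
    "\<forall>N. submodule N R M \<and> A \<subseteq> N \<and> N \<subseteq> C \<longrightarrow> rk N \<le> n"
    "\<forall>N N'. submodule N R M \<and> submodule N' R M \<and> A \<subseteq> N \<and> N \<subset> N' \<and> N' \<subseteq> C \<longrightarrow> rk N < rk N'"
    using assms unfolding bounded_length_def by blast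
  then show thesis by (intro that[of rk]) blast+
qed

definition adjoin :: "'c set \<Rightarrow> 'c \<Rightarrow> 'c set" where
  "adjoin N y = {n \<oplus>\<^bsub>M\<^esub> r \<odot>\<^bsub>M\<^esub> y | n r. n \<in> N \<and> r \<in> carrier R}"

lemma submodule_adjoin:
  assumes N: "submodule N R M" and y: "y \<in> carrier M"
  shows "submodule (adjoin N y) R M"
proof (rule submoduleI)
  note [simp] = sub_subset[OF N]
  show "adjoin N y \<subseteq> carrier M" using y by (auto simp: adjoin_def)
  have "\<zero>\<^bsub>M\<^esub> = \<zero>\<^bsub>M\<^esub> \<oplus>\<^bsub>M\<^esub> \<zero> \<odot>\<^bsub>M\<^esub> y" using y by simp
  then show "\<zero>\<^bsub>M\<^esub> \<in> adjoin N y" unfolding adjoin_def using sub_zero[OF N] by blast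
next
  note [simp] = sub_subset[OF N]
  fix a assume "a \<in> adjoin N y"
  then obtain n r where a: "a = n \<oplus>\<^bsub>M\<^esub> r \<odot>\<^bsub>M\<^esub> y" "n \<in> N" "r \<in> carrier R" by (auto simp: adjoin_def)
  have "\<ominus>\<^bsub>M\<^esub> a = \<ominus>\<^bsub>M\<^esub> n \<oplus>\<^bsub>M\<^esub> (\<ominus> r) \<odot>\<^bsub>M\<^esub> y"
    using a y by (simp add: M.minus_add smult_l_minus)
  then show "\<ominus>\<^bsub>M\<^esub> a \<in> adjoin N y"
    unfolding adjoin_def using submoduleE(3)[OF N a(2)] a(3) by blast
  fix b assume "b \<in> adjoin N y"
  then obtain m s where b: "b = m \<oplus>\<^bsub>M\<^esub> s \<odot>\<^bsub>M\<^esub> y" "m \<in> N" "s \<in> carrier R" by (auto simp: adjoin_def)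
  have "a \<oplus>\<^bsub>M\<^esub> b = (n \<oplus>\<^bsub>M\<^esub> m) \<oplus>\<^bsub>M\<^esub> (r \<oplus> s) \<odot>\<^bsub>M\<^esub> y"
    using a b y by (simp add: smult_l_distr M.a_ac)
  then show "a \<oplus>\<^bsub>M\<^esub> b \<in> adjoin N y"
    unfolding adjoin_def using submoduleE(5)[OF N a(2) b(2)] a(3) b(3) R.a_closed by blast
next
  note [simp] = sub_subset[OF N]
  fix c a assume c: "c \<in> carrier R" and "a \<in> adjoin N y"
  then obtain n r where a: "a = n \<oplus>\<^bsub>M\<^esub> r \<odot>\<^bsub>M\<^esub> y" "n \<in> N" "r \<in> carrier R" by (auto simp: adjoin_def)
  have "c \<odot>\<^bsub>M\<^esub> a = c \<odot>\<^bsub>M\<^esub> n \<oplus>\<^bsub>M\<^esub> (c \<otimes> r) \<odot>\<^bsub>M\<^esub> y"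
    using a y c by (simp add: smult_r_distr smult_assoc1)
  then show "c \<odot>\<^bsub>M\<^esub> a \<in> adjoin N y"
    unfolding adjoin_def using submoduleE(4)[OF N c a(2)] a(3) c R.m_closed by blast
qed

lemma adjoin_supset:
  assumes "submodule N R M" "y \<in> carrier M"
  shows "N \<subseteq> adjoin N y" "y \<in> adjoin N y"
proof -
  have "n = n \<oplus>\<^bsub>M\<^esub> \<zero> \<odot>\<^bsub>M\<^esub> y" if "n \<in> N" for n using that assms(2) sub_subset[OF assms(1)] by simp
  then show "N \<subseteq> adjoin N y" unfolding adjoin_def by blast
  have "y = \<zero>\<^bsub>M\<^esub> \<oplus>\<^bsub>M\<^esub> \<one> \<odot>\<^bsub>M\<^esub> y" using assms(2) by simp
  then show "y \<in> adjoin N y" unfolding adjoin_def using sub_zero[OF assms(1)] by blast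
qed

lemma adjoin_mono: "N \<subseteq> N' \<Longrightarrow> adjoin N y \<subseteq> adjoin N' y"
  by (auto simp: adjoin_def)

lemma adjoin_least:
  assumes "submodule C R M" "N \<subseteq> C" "y \<in> C"
  shows "adjoin N y \<subseteq> C"
  using assms submoduleE(4,5)[OF assms(1)] by (auto simp: adjoin_def subset_iff)

text \<open>Adjoining \<open>y\<close> to \<open>A\<close> is a simple extension, so the rank of \<open>N\<close> can be taken as the given rank of the
  submodule generated by \<open>N\<close> and \<open>y\<close>, plus one if \<open>y\<close> already lies in \<open>N\<close>.\<close>

lemma bounded_length_adjoin:
  assumes A: "submodule A R M" and C: "submodule C R M" and y: "y \<in> C"
    and simple: "\<And>r. r \<in> carrier R \<Longrightarrow> r \<in> Units R \<or> r \<odot>\<^bsub>M\<^esub> y \<in> A"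
    and len: "bounded_length (adjoin A y) C n"
  shows "bounded_length A C (Suc n)"
proof -
  have yM: "y \<in> carrier M" using sub_subset[OF C y] .
  obtain rk where rk: "\<And>N. submodule N R M \<Longrightarrow> adjoin A y \<subseteq> N \<Longrightarrow> N \<subseteq> C \<Longrightarrow> rk N \<le> n"
    "\<And>N N'. submodule N R M \<Longrightarrow> submodule N' R M \<Longrightarrow> adjoin A y \<subseteq> N \<Longrightarrow> N \<subset> N' \<Longrightarrow> N' \<subseteq> C \<Longrightarrow> rk N < rk N'"
    using len by (rule bounded_lengthE) blast
  define k where "k N = rk (adjoin N y) + (if y \<in> N then 1 else 0)" for N
  have "k N \<le> Suc n" if "submodule N R M" "A \<subseteq> N" "N \<subseteq> C" for N
    using rk(1)[OF submodule_adjoin[OF that(1) yM] adjoin_mono[OF that(2)] adjoin_least[OF C that(3) y]]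
    by (simp add: k_def)
  moreover have "k N < k N'"
    if N: "submodule N R M" and N': "submodule N' R M" and AN: "A \<subseteq> N" and NN': "N \<subset> N'" and N'C: "N' \<subseteq> C" for N N'
  proof -
    have sub: "adjoin N y \<subseteq> adjoin N' y" using NN' by (intro adjoin_mono) blast
    show ?thesis
    proof (cases "adjoin N y = adjoin N' y")
      case False
      then have "rk (adjoin N y) < rk (adjoin N' y)"
        using sub by (intro rk(2) submodule_adjoin N N' yM adjoin_mono[OF AN] adjoin_least[OF C N'C y]) auto
      then show ?thesis using NN' by (auto simp: k_def)
    next
      case True
      have "y \<in> N' \<and> y \<notin> N"
      proof (rule ccontr)
        assume c: "\<not> (y \<in> N' \<and> y \<notin> N)"
        obtain x where x: "x \<in> N'" "x \<notin> N" using NN' by blast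
        have "x \<in> adjoin N y" using x(1) adjoin_supset(1)[OF N' yM] True by blast
        then obtain m r where m: "x = m \<oplus>\<^bsub>M\<^esub> r \<odot>\<^bsub>M\<^esub> y" "m \<in> N" "r \<in> carrier R" by (auto simp: adjoin_def)
        have mM: "m \<in> carrier M" using sub_subset[OF N m(2)] .
        have nin: "r \<odot>\<^bsub>M\<^esub> y \<notin> N" using x(2) m submoduleE(5)[OF N m(2)] by blast
        then have r: "r \<in> Units R" using simple[OF m(3)] AN by blast
        have "r \<odot>\<^bsub>M\<^esub> y = x \<ominus>\<^bsub>M\<^esub> m"
          using mM m yM by (simp add: M.sub_arith M.a_ac)
        also have "\<dots> \<in> N'" using x(1) m(2) NN' by (intro sub_minus[OF N']) auto
        finally have "inv r \<odot>\<^bsub>M\<^esub> (r \<odot>\<^bsub>M\<^esub> y) \<in> N'"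
          by (rule submoduleE(4)[OF N' R.Units_inv_closed[OF r]])
        moreover have "inv r \<odot>\<^bsub>M\<^esub> (r \<odot>\<^bsub>M\<^esub> y) = y"
          using smult_assoc1[OF R.Units_inv_closed[OF r] m(3) yM] R.Units_l_inv[OF r] yM by simp
        ultimately have "y \<in> N'" by simp
        then have "y \<in> N" using c by blast
        then show False using nin submoduleE(4)[OF N m(3)] by blast
      qed
      then show ?thesis using True by (simp add: k_def)
    qed
  qed
  ultimately show ?thesis unfolding bounded_length_def by (intro exI[of _ k]) blast
qed

lemma bounded_length_refl: "bounded_length C C 0"
  unfolding bounded_length_def by (intro exI[of _ "\<lambda>_. 0"]) auto

text \<open>Chains of submodules of \<open>Z / A\<close> are pulled back to chains between \<open>A\<close> and \<open>Z\<close>.\<close>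

lemma mod_length_le:
  assumes A: "submodule A R M" and Z: "submodule Z R M" and AZ: "A \<subseteq> Z" and len: "bounded_length A Z n"
  shows "mod_length R (quot_module (M\<lparr>carrier := Z\<rparr>) A) \<le> enat n"
proof -
  let ?Z = "M\<lparr>carrier := Z\<rparr>"
  let ?Q = "quot_module ?Z A"
  interpret Z: module R ?Z by (rule submodule.submodule_is_module[OF Z module_axioms])
  have ZM: "x \<in> Z \<Longrightarrow> x \<in> carrier M" for x using sub_subset[OF Z] .
  have inv: "\<ominus>\<^bsub>?Z\<^esub> x = \<ominus>\<^bsub>M\<^esub> x" if "x \<in> Z" for x
    using Z.smult_l_minus[of \<one> x] smult_l_minus[of \<one> x] ZM[OF that] that Z.smult_one[of x] by simp
  have A': "submodule A R ?Z"
    using AZ sub_zero[OF A] submoduleE(3-5)[OF A] inv by (intro Z.submoduleI) (auto simp: subset_iff)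
  interpret Q: module R ?Q by (rule Z.quot_is_module[OF A'])
  obtain rk where rk: "\<And>N. submodule N R M \<Longrightarrow> A \<subseteq> N \<Longrightarrow> N \<subseteq> Z \<Longrightarrow> rk N \<le> n"
    "\<And>N N'. submodule N R M \<Longrightarrow> submodule N' R M \<Longrightarrow> A \<subseteq> N \<Longrightarrow> N \<subset> N' \<Longrightarrow> N' \<subseteq> Z \<Longrightarrow> rk N < rk N'"
    using len by (rule bounded_lengthE) blast
  define pre where "pre N = {z \<in> Z. A +>\<^bsub>?Z\<^esub> z \<in> N}" for N
  have car: "carrier ?Q = (\<lambda>z. A +>\<^bsub>?Z\<^esub> z) ` Z" using Z.quot_carrier[of A] by simp
  have pre: "submodule (pre N) R M \<and> A \<subseteq> pre N \<and> pre N \<subseteq> Z" if N: "submodule N R ?Q" for N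
  proof (intro conjI submoduleI)
    have zero: "A +>\<^bsub>?Z\<^esub> \<zero>\<^bsub>M\<^esub> \<in> N" using Q.sub_zero[OF N] Z.quot_zero[OF A'] by simp
    show "\<zero>\<^bsub>M\<^esub> \<in> pre N" using zero sub_zero[OF Z] by (simp add: pre_def)
    show "pre N \<subseteq> Z" "pre N \<subseteq> carrier M" using ZM by (auto simp: pre_def)
    show "A \<subseteq> pre N"
    proof
      fix a assume a: "a \<in> A"
      then have "A +>\<^bsub>?Z\<^esub> a = A +>\<^bsub>?Z\<^esub> \<zero>\<^bsub>M\<^esub>"
        using AZ Z.coset_eq_iff[OF A', of a "\<zero>\<^bsub>M\<^esub>"] Z.sub_minus[OF A' a Z.sub_zero[OF A']] sub_zero[OF Z] by auto
      then show "a \<in> pre N" using a AZ zero by (auto simp: pre_def)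
    qed
    fix a assume a: "a \<in> pre N"
    show ad: "a \<oplus>\<^bsub>M\<^esub> b \<in> pre N" if "b \<in> pre N" for b
      using a that Z.quot_add[OF A', of a b] Q.submoduleE(5)[OF N, of "A +>\<^bsub>?Z\<^esub> a" "A +>\<^bsub>?Z\<^esub> b"]
        submoduleE(5)[OF Z, of a b] by (auto simp: pre_def)
    show sm: "c \<odot>\<^bsub>M\<^esub> a \<in> pre N" if "c \<in> carrier R" for c
      using a that Z.quot_smult[OF A', of c a] Q.submoduleE(4)[OF N, of c "A +>\<^bsub>?Z\<^esub> a"]
        submoduleE(4)[OF Z, of c a] by (auto simp: pre_def)
    show "\<ominus>\<^bsub>M\<^esub> a \<in> pre N"
      using sm[of "\<ominus> \<one>"] a ZM[of a] by (simp add: smult_l_minus pre_def)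
  qed
  have strict: "pre N \<subset> pre N'" if "N \<subset> N'" "submodule N' R ?Q" for N N'
  proof -
    obtain C where C: "C \<in> N'" "C \<notin> N" using \<open>N \<subset> N'\<close> by blast
    then have "C \<in> carrier ?Q" using Q.sub_subset[OF that(2)] by blast
    then obtain z where "z \<in> Z" "C = A +>\<^bsub>?Z\<^esub> z" unfolding car by blast
    then have "z \<in> pre N'" "z \<notin> pre N" using C by (auto simp: pre_def)
    moreover have "pre N \<subseteq> pre N'" using that(1) by (auto simp: pre_def)
    ultimately show ?thesis by blast
  qed
  show ?thesis
    unfolding mod_length_def
  proof (rule Sup_least, clarify)
    fix k N assume N: "\<forall>i\<le>k. submodule (N i) R ?Q" "\<forall>i<k. N i \<subset> N (Suc i)"
    have "i \<le> k \<Longrightarrow> i \<le> rk (pre (N i))" for i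
    proof (induction i)
      case (Suc i)
      have "rk (pre (N i)) < rk (pre (N (Suc i)))"
      proof (rule rk(2))
        show "submodule (pre (N i)) R M" "submodule (pre (N (Suc i))) R M" "A \<subseteq> pre (N i)"
          "pre (N (Suc i)) \<subseteq> Z"
          using pre[of "N i"] pre[of "N (Suc i)"] N(1) Suc.prems by simp_all
        show "pre (N i) \<subset> pre (N (Suc i))"
          using N Suc.prems by (intro strict) simp_all
      qed
      then show ?case using Suc by simp
    qed simp
    from this[of k] show "enat k \<le> enat n"
      using rk(1)[of "pre (N k)"] pre[of "N k"] N by simp
  qed
qed

lemma mod_length_nonzero:
  assumes A: "submodule A R M" and Z: "submodule Z R M" and AZ: "A \<subseteq> Z" and z: "z \<in> Z" "z \<notin> A"
  shows "mod_length R (quot_module (M\<lparr>carrier := Z\<rparr>) A) \<noteq> 0"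
proof -
  let ?Z = "M\<lparr>carrier := Z\<rparr>"
  let ?Q = "quot_module ?Z A"
  interpret Z: module R ?Z by (rule submodule.submodule_is_module[OF Z module_axioms])
  have ZM: "x \<in> Z \<Longrightarrow> x \<in> carrier M" for x using sub_subset[OF Z] .
  have inv: "\<ominus>\<^bsub>?Z\<^esub> x = \<ominus>\<^bsub>M\<^esub> x" if "x \<in> Z" for x
    using Z.smult_l_minus[of \<one> x] smult_l_minus[of \<one> x] ZM[OF that] that Z.smult_one[of x] by simp
  have A': "submodule A R ?Z"
    using AZ sub_zero[OF A] submoduleE(3-5)[OF A] inv by (intro Z.submoduleI) (auto simp: subset_iff)
  interpret Q: module R ?Q by (rule Z.quot_is_module[OF A'])
  have "submodule {\<zero>\<^bsub>?Q\<^esub>} R ?Q" by (rule Q.submoduleI) auto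
  moreover have "submodule (carrier ?Q) R ?Q" by (rule Q.carrier_is_submodule)
  moreover have "{\<zero>\<^bsub>?Q\<^esub>} \<subset> carrier ?Q"
  proof -
    have "z \<ominus>\<^bsub>?Z\<^esub> \<zero>\<^bsub>M\<^esub> = z" using z(1) Z.M.sub_arith(6)[of z "\<zero>\<^bsub>M\<^esub>" z] sub_zero[OF Z] ZM by simp
    then have "A +>\<^bsub>?Z\<^esub> z \<noteq> \<zero>\<^bsub>?Q\<^esub>"
      using Z.coset_eq_iff[OF A', of z "\<zero>\<^bsub>M\<^esub>"] Z.quot_zero[OF A'] z sub_zero[OF Z] by auto
    moreover have "A +>\<^bsub>?Z\<^esub> z \<in> carrier ?Q" using z(1) Z.quot_carrier[of A] by auto
    ultimately show ?thesis by blast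
  qed
  ultimately have "enat 1 \<in> {enat n | n. \<exists>N. (\<forall>i\<le>n. submodule (N i) R ?Q) \<and> (\<forall>i<n. N i \<subset> N (Suc i))}"
    by (intro CollectI exI[of _ "1::nat"] conjI refl
        exI[of _ "\<lambda>i::nat. if i = 0 then {\<zero>\<^bsub>?Q\<^esub>} else carrier ?Q"]) simp_all
  then have "enat 1 \<le> mod_length R ?Q"
    unfolding mod_length_def by (rule Sup_upper)
  then show ?thesis by (auto simp: zero_enat_def)
qed

end

context seq_operators
begin

section \<open>Finite length over a noetherian ring\<close>

lemma submodule_supported: "submodule (supported R I) R (seq_module R)"
  by (rule Om.submoduleI) (auto simp del: seq_module_simps)

lemma submodule_Int:
  assumes "submodule A R (seq_module R)" "submodule B R (seq_module R)"
  shows "submodule (A \<inter> B) R (seq_module R)"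
  by (rule Om.submoduleI)
    (use Om.sub_subset[OF assms(1)] Om.sub_zero[OF assms(1)] Om.sub_zero[OF assms(2)]
      Om.submoduleE(3-5)[OF assms(1)] Om.submoduleE(3-5)[OF assms(2)] in auto)

lemma ideal_of_coordinates:
  assumes N: "submodule N R (seq_module R)"
  shows "ideal ((\<lambda>f. f i) ` N) R"
proof (rule idealI)
  show "ring R" by (rule ring_axioms)
  have NO: "f \<in> N \<Longrightarrow> f k \<in> carrier R" for f k using Om.sub_subset[OF N] by (simp add: in_Omega_iff)
  show "subgroup ((\<lambda>f. f i) ` N) (add_monoid R)"
  proof (rule add.subgroupI)
    show "(\<lambda>f. f i) ` N \<subseteq> carrier R" using NO by blast
    show "(\<lambda>f. f i) ` N \<noteq> {}" using Om.sub_zero[OF N] by blast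
    show "\<ominus> a \<in> (\<lambda>f. f i) ` N" if a: "a \<in> (\<lambda>f. f i) ` N" for a
    proof -
      obtain f where f: "a = f i" "f \<in> N" using a by blast
      have "\<ominus> a = (\<^bold>- f) i" using f Om.sub_subset[OF N] by (simp only: neg_apply)
      then show ?thesis using Om.submoduleE(3)[OF N f(2)] by blast
    qed
    show "a \<oplus> b \<in> (\<lambda>f. f i) ` N" if ab: "a \<in> (\<lambda>f. f i) ` N" "b \<in> (\<lambda>f. f i) ` N" for a b
    proof -
      obtain f g where f: "a = f i" "f \<in> N" "b = g i" "g \<in> N" using ab by blast
      have "a \<oplus> b = (f \<^bold>+ g) i" using f by (simp add: seq_module_simps)
      then show ?thesis using Om.submoduleE(5)[OF N f(2,4)] by blast
    qed
  qed
  fix a x assume a: "a \<in> (\<lambda>f. f i) ` N" and x: "x \<in> carrier R"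
  obtain f where f: "a = f i" "f \<in> N" using a by blast
  have "x \<otimes> a = (x \<bullet> f) i" using f by (simp add: seq_module_simps)
  then show "x \<otimes> a \<in> (\<lambda>f. f i) ` N" using Om.submoduleE(4)[OF N x f(2)] by blast
  then show "a \<otimes> x \<in> (\<lambda>f. f i) ` N" using m_comm x NO f by auto
qed

lemma ideal_sequence_stabilises:
  assumes "noetherian_ring R" "\<And>n. ideal (L n) R" "mono (L :: nat \<Rightarrow> 'a set)"
  shows "\<exists>n. \<forall>m\<ge>n. L m = L n"
proof -
  interpret noetherian_ring R by fact
  have "subset.chain {I. ideal I R} (range L)"
    using assms(2) monoD[OF assms(3)] unfolding subset_chain_def
    by (auto, metis nat_le_linear subsetD)
  then have "\<Union> (range L) \<in> range L" by (intro ideal_chain_is_trivial) auto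
  then obtain n where n: "\<Union> (range L) = L n" by auto
  then have "L m = L n" if "m \<ge> n" for m
    using monoD[OF assms(3) that] by blast
  then show ?thesis by blast
qed

text \<open>The usual proof that a free module of finite rank is noetherian, by induction on the rank: an increasing
  sequence of submodules is constant once its elements without \<open>i\<close>-th coordinate and the ideals of its \<open>i\<close>-th coordinates are.\<close>

lemma submodule_sequence_stabilises:
  assumes noeth: "noetherian_ring R" and "finite I"
    and "\<And>n. submodule (N n) R (seq_module R)" "mono (N :: nat \<Rightarrow> (nat \<Rightarrow> 'a) set)" "\<And>n. N n \<subseteq> supported R I"
  shows "\<exists>n. \<forall>m\<ge>n. N m = N n"
  using assms(2-)
proof (induction I arbitrary: N rule: finite_induct)
  case empty
  then have "N n = {\<^bold>0}" for n using supported_empty Om.sub_zero by blast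
  then show ?case by blast
next
  case (insert i I)
  have mono: "x \<le> y \<Longrightarrow> N x \<subseteq> N y" for x y using monoD[OF insert.prems(2)] .
  have "\<exists>n. \<forall>m\<ge>n. N m \<inter> supported R I = N n \<inter> supported R I"
    using mono by (intro insert.IH submodule_Int insert.prems submodule_supported monoI) blast+
  then obtain n1 where n1: "\<And>m. m \<ge> n1 \<Longrightarrow> N m \<inter> supported R I = N n1 \<inter> supported R I" by blast
  have "\<exists>n. \<forall>m\<ge>n. (\<lambda>f. f i) ` N m = (\<lambda>f. f i) ` N n"
    using mono by (intro ideal_sequence_stabilises[OF noeth] ideal_of_coordinates insert.prems monoI image_mono)
  then obtain n2 where n2: "\<And>m. m \<ge> n2 \<Longrightarrow> (\<lambda>f. f i) ` N m = (\<lambda>f. f i) ` N n2" by blast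
  define n where "n = max n1 n2"
  have "N m = N n" if m: "m \<ge> n" for m
  proof
    show "N n \<subseteq> N m" using mono[OF m] .
    show "N m \<subseteq> N n"
    proof
      fix f assume f: "f \<in> N m"
      have "(\<lambda>f. f i) ` N m = (\<lambda>f. f i) ` N n" using n2[of m] n2[of n] m by (simp add: n_def)
      then obtain g where g: "g \<in> N n" "f i = g i" using f by (metis (no_types, lifting) image_iff)
      have gm: "g \<in> N m" using g(1) mono[OF m] by blast
      have fg: "f \<in> \<Omega>" "g \<in> \<Omega>" using f gm Om.sub_subset[OF insert.prems(1)] by blast+
      define d where "d = f \<^bold>+ \<^bold>- g"
      have d: "d \<in> N m"
        unfolding d_def using insert.prems(1) f gm by (intro Om.submoduleE(5)[OF insert.prems(1)] Om.submoduleE(3)[OF insert.prems(1)])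
      have "d i = f i \<oplus> \<ominus> g i" by (simp add: d_def seq_module_simps(3) neg_apply[OF fg(2)])
      also have "\<dots> = \<zero>" using g(2) fg(2) by (simp add: in_Omega_iff r_neg)
      finally have "d \<in> supported R I"
        using d insert.prems(3)[of m] unfolding supported_def by (auto simp: subset_iff)
      then have "d \<in> N n"
        using d n1[of m] n1[of n] m by (auto simp: n_def)
      then have "g \<^bold>+ d \<in> N n" using g(1) by (intro Om.submoduleE(5)[OF insert.prems(1)])
      moreover have "g \<^bold>+ d = f" using fg by (simp add: d_def Omega_arith Om.M.a_ac)
      ultimately show "f \<in> N n" by simp
    qed
  qed
  then show ?case by blast
qed

text \<open>Noetherian induction on the lower end \<open>B\<close> of the interval. If \<open>B \<noteq> Z\<close>, multiply an element of \<open>Z\<close> outside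
  \<open>B\<close> by those \<open>x\<close> in turn that keep it outside; since each \<open>x\<^sup>2\<close> maps \<open>Z\<close> into \<open>B\<close>, the result \<open>y\<close> satisfies
  \<open>x y \<in> B\<close> for all \<open>x\<close>. Adjoining \<open>y\<close> is a simple extension, and the induction hypothesis applies to it.\<close>

lemma bounded_length_of_killed:
  assumes noeth: "noetherian_ring R" and fin: "finite I"
    and A: "submodule A R (seq_module R)" and Z: "submodule Z R (seq_module R)" and AZ: "A \<subseteq> Z" and ZI: "Z \<subseteq> supported R I"
    and xs: "set xs \<subseteq> carrier R" and kill: "\<And>x z. x \<in> set xs \<Longrightarrow> z \<in> Z \<Longrightarrow> x \<bullet> (x \<bullet> z) \<in> A"
    and loc: "\<And>r. r \<in> carrier R \<Longrightarrow> r \<in> Units R \<or> r \<in> Idl (set xs)"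
  shows "\<exists>n. Om.bounded_length A Z n"
proof -
  define P where "P B \<longleftrightarrow> submodule B R (seq_module R) \<and> A \<subseteq> B \<and> B \<subseteq> Z" for B
  define rel where "rel = {(B', B). P B \<and> P B' \<and> B \<subset> B'}"
  have "wf rel"
    unfolding wf_iff_no_infinite_down_chain
  proof
    assume "\<exists>f. \<forall>i. (f (Suc i), f i) \<in> rel"
    then obtain f where f: "\<And>i. (f (Suc i), f i) \<in> rel" by blast
    have Pf: "P (f i)" and less: "f i \<subset> f (Suc i)" for i
      using f[of i] by (simp_all add: rel_def)
    have mf: "mono f"
      using less by (intro incseq_SucI) (rule psubset_imp_subset)
    have sf: "submodule (f i) R (seq_module R)" and fI: "f i \<subseteq> supported R I" for i
      using conjunct1[OF Pf[of i, unfolded P_def]] subset_trans[OF conjunct2[OF conjunct2[OF Pf[of i, unfolded P_def]]] ZI] .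
    obtain n where n: "\<forall>m\<ge>n. f m = f n"
      using submodule_sequence_stabilises[OF noeth fin sf mf fI] ..
    have "f (Suc n) = f n" by (rule n[rule_format]) simp
    then show False using less[of n] by blast
  qed
  then have "P B \<longrightarrow> (\<exists>n. Om.bounded_length B Z n)" for B
  proof (induction B rule: wf_induct_rule)
    case (less B)
    show ?case
    proof
      assume PB: "P B"
      then have B: "submodule B R (seq_module R)" "A \<subseteq> B" "B \<subseteq> Z" by (auto simp: P_def)
      show "\<exists>n. Om.bounded_length B Z n"
      proof (cases "B = Z")
        case True
        then show ?thesis using Om.bounded_length_refl by blast
      next
        case False
        have "\<exists>y\<in>Z. y \<notin> B \<and> (\<forall>x\<in>set ys. x \<bullet> y \<in> B)" if "set ys \<subseteq> set xs" for ys
          using that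
        proof (induction ys)
          case Nil
          then show ?case using False B(3) by auto
        next
          case (Cons x ys)
          then obtain y where y: "y \<in> Z" "y \<notin> B" "\<forall>x\<in>set ys. x \<bullet> y \<in> B" by auto
          have x: "x \<in> carrier R" "x \<in> set xs" using Cons.prems xs by auto
          have yO: "y \<in> \<Omega>" using Om.sub_subset[OF Z y(1)] .
          show ?case
          proof (cases "x \<bullet> y \<in> B")
            case True
            then show ?thesis using y by auto
          next
            case False
            have "x' \<bullet> (x \<bullet> y) \<in> B" if "x' \<in> set ys" for x'
            proof -
              have x': "x' \<in> carrier R" using that Cons.prems xs by auto
              have "x' \<bullet> (x \<bullet> y) = x \<bullet> (x' \<bullet> y)"
                using x x' yO by (simp add: m_comm flip: Om.smult_assoc1)
              then show ?thesis using Om.submoduleE(4)[OF B(1) x(1)] y(3) that by auto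
            qed
            moreover have "x \<bullet> (x \<bullet> y) \<in> B" using kill[OF x(2) y(1)] B(2) by blast
            moreover have "x \<bullet> y \<in> Z" using Om.submoduleE(4)[OF Z x(1) y(1)] .
            ultimately show ?thesis using False by auto
          qed
        qed
        from this[of xs] obtain y where y: "y \<in> Z" "y \<notin> B" "\<And>x. x \<in> set xs \<Longrightarrow> x \<bullet> y \<in> B" by blast
        have yO: "y \<in> \<Omega>" using Om.sub_subset[OF Z y(1)] .
        have "ideal {r \<in> carrier R. r \<bullet> y \<in> B} R"
        proof (rule idealI)
          show "ring R" by (rule ring_axioms)
          show "subgroup {r \<in> carrier R. r \<bullet> y \<in> B} (add_monoid R)"
            using Om.sub_zero[OF B(1)] Om.submoduleE(3,5)[OF B(1)] yO
            by (intro add.subgroupI) (auto simp: Om.smult_l_distr Om.smult_l_minus simp flip: a_inv_def)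
          fix a x assume a: "a \<in> {r \<in> carrier R. r \<bullet> y \<in> B}" and x: "x \<in> carrier R"
          show "x \<otimes> a \<in> {r \<in> carrier R. r \<bullet> y \<in> B}"
            using a x yO Om.submoduleE(4)[OF B(1) x] by (simp add: Om.smult_assoc1)
          then show "a \<otimes> x \<in> {r \<in> carrier R. r \<bullet> y \<in> B}"
            using a x by (simp add: m_comm)
        qed
        then have "Idl (set xs) \<subseteq> {r \<in> carrier R. r \<bullet> y \<in> B}"
          using y(3) xs by (intro genideal_minimal) auto
        then have simple: "r \<in> Units R \<or> r \<bullet> y \<in> B" if "r \<in> carrier R" for r
          using loc[OF that] by blast
        have "P (Om.adjoin B y)"
          unfolding P_def using Om.submodule_adjoin[OF B(1) yO] Om.adjoin_supset(1)[OF B(1) yO] B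
            Om.adjoin_least[OF Z B(3) y(1)] by blast
        moreover have "B \<subset> Om.adjoin B y"
          using Om.adjoin_supset[OF B(1) yO] y(2) by blast
        ultimately obtain n where "Om.bounded_length (Om.adjoin B y) Z n"
          using less[of "Om.adjoin B y"] PB by (auto simp: rel_def)
        then show ?thesis
          using Om.bounded_length_adjoin[OF B(1) Z y(1) simple] by blast
      qed
    qed
  qed
  then show ?thesis using A AZ by (simp add: P_def)
qed

section \<open>The differential module of small rank\<close>

abbreviation "Fm I \<equiv> seq_module R\<lparr>carrier := supported R I\<rparr>"

lemma Fm_module: "module R (Fm I)"
  by (rule submodule.submodule_is_module[OF submodule_supported Om.module_axioms])

definition unit_vec :: "nat \<Rightarrow> nat \<Rightarrow> 'a" where
  "unit_vec i = (\<lambda>k. if k = i then \<one> else \<zero>)"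

lemma unit_vec_supported: "i \<in> I \<Longrightarrow> unit_vec i \<in> supported R I"
  by (auto simp: unit_vec_def supported_def)

lemma inj_unit_vec: "\<one> \<noteq> \<zero> \<Longrightarrow> inj unit_vec"
  by (auto intro!: injI simp: unit_vec_def fun_eq_iff split: if_splits)

lemma Fm_finsum:
  assumes "\<one> \<noteq> \<zero>" "finite A" "A \<subseteq> unit_vec ` I" "a \<in> A \<rightarrow> carrier R"
  shows "(\<Oplus>\<^bsub>Fm I\<^esub>b\<in>A. a b \<odot>\<^bsub>Fm I\<^esub> b) k = (if unit_vec k \<in> A then a (unit_vec k) else \<zero>)"
  using assms(2-)
proof (induction A rule: finite_induct)
  case empty
  interpret F: module R "Fm I" by (rule Fm_module)
  show ?case by (simp add: seq_module_simps)
next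
  case (insert b A)
  interpret F: module R "Fm I" by (rule Fm_module)
  obtain i where b: "b = unit_vec i" "i \<in> I" using insert.prems by auto
  have ab: "a b \<in> carrier R" "a \<in> A \<rightarrow> carrier R" using insert.prems by auto
  have cl: "(\<lambda>b. a b \<odot>\<^bsub>seq_module R\<^esub> b) \<in> A \<rightarrow> supported R I"
    using insert.prems unit_vec_supported by (auto intro!: supported_closed(4))
  have sum: "(\<Oplus>\<^bsub>Fm I\<^esub>c\<in>insert b A. a c \<odot>\<^bsub>Fm I\<^esub> c) =
      a b \<odot>\<^bsub>Fm I\<^esub> b \<oplus>\<^bsub>Fm I\<^esub> (\<Oplus>\<^bsub>Fm I\<^esub>c\<in>A. a c \<odot>\<^bsub>Fm I\<^esub> c)"
    using insert.hyps cl ab(1) b unit_vec_supported by (intro F.finsum_insert) (auto intro!: supported_closed(4))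
  have "(\<Oplus>\<^bsub>Fm I\<^esub>c\<in>insert b A. a c \<odot>\<^bsub>Fm I\<^esub> c) k = a b \<otimes> b k \<oplus> (\<Oplus>\<^bsub>Fm I\<^esub>c\<in>A. a c \<odot>\<^bsub>Fm I\<^esub> c) k"
    unfolding sum by (simp add: seq_module_simps)
  also have "\<dots> = a b \<otimes> b k \<oplus> (if unit_vec k \<in> A then a (unit_vec k) else \<zero>)"
    using insert.IH insert.prems ab by simp
  also have "\<dots> = (if unit_vec k \<in> insert b A then a (unit_vec k) else \<zero>)"
  proof (cases "k = i")
    case True
    then show ?thesis using insert.hyps(2) ab b by (simp add: unit_vec_def)
  next
    case False
    then have "unit_vec k \<noteq> b" using inj_unit_vec[OF assms(1)] b by (auto dest: injD)
    moreover have "b k = \<zero>" using False b by (simp add: unit_vec_def)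
    ultimately show ?thesis using ab by (auto simp: Pi_def)
  qed
  finally show ?case .
qed

lemma Fm_basis:
  assumes "\<one> \<noteq> \<zero>" "finite I"
  shows "is_basis R (Fm I) (unit_vec ` I)"
  unfolding is_basis_def
proof (intro conjI ballI allI impI)
  show "unit_vec ` I \<subseteq> carrier (Fm I)" using unit_vec_supported by auto
next
  fix x assume "x \<in> carrier (Fm I)"
  then have x: "x \<in> supported R I" by simp
  let ?a = "\<lambda>b. x (inv_into UNIV unit_vec b)"
  have a: "?a \<in> unit_vec ` I \<rightarrow> carrier R" using x by (auto simp: supported_def)
  have "x k = (\<Oplus>\<^bsub>Fm I\<^esub>b\<in>unit_vec ` I. ?a b \<odot>\<^bsub>Fm I\<^esub> b) k" for k
    unfolding Fm_finsum[OF assms(1) finite_imageI[OF assms(2)] order_refl a]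
    using x inj_unit_vec[OF assms(1)] by (auto simp: inj_image_mem_iff supported_def)
  then have "x = (\<Oplus>\<^bsub>Fm I\<^esub>b\<in>unit_vec ` I. ?a b \<odot>\<^bsub>Fm I\<^esub> b)" by blast
  then show "\<exists>A a. finite A \<and> A \<subseteq> unit_vec ` I \<and> a \<in> A \<rightarrow> carrier R \<and> x = (\<Oplus>\<^bsub>Fm I\<^esub>b\<in>A. a b \<odot>\<^bsub>Fm I\<^esub> b)"
    using a assms(2) by (intro exI[of _ "unit_vec ` I"] exI[of _ ?a] conjI finite_imageI order_refl)
next
  fix A a b
  assume A: "finite A" "A \<subseteq> unit_vec ` I" "a \<in> A \<rightarrow> carrier R"
    "(\<Oplus>\<^bsub>Fm I\<^esub>b\<in>A. a b \<odot>\<^bsub>Fm I\<^esub> b) = \<zero>\<^bsub>Fm I\<^esub>" "b \<in> A"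
  obtain k where k: "b = unit_vec k" using A by auto
  have "(\<Oplus>\<^bsub>Fm I\<^esub>b\<in>A. a b \<odot>\<^bsub>Fm I\<^esub> b) k = \<zero>" unfolding A(4) by (simp add: seq_module_simps)
  then show "a b = \<zero>" using Fm_finsum[OF assms(1) A(1-3), of k] A(5) k by simp
qed

lemma mod_rank_Fm_le:
  assumes "\<one> \<noteq> \<zero>" "finite I"
  shows "mod_rank R (Fm I) \<le> enat (card I)"
proof -
  have "mod_rank R (Fm I) \<le> (if finite (unit_vec ` I) then enat (card (unit_vec ` I)) else \<infinity>)"
    unfolding mod_rank_def by (rule INF_lower) (simp add: Fm_basis[OF assms])
  then show ?thesis
    using assms inj_unit_vec[OF assms(1)] by (simp add: card_image inj_on_subset)
qed

lemma submodule_of_Fm: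
  assumes A: "submodule A R (seq_module R)" and AI: "A \<subseteq> supported R I"
  shows "submodule A R (Fm I)"
proof -
  interpret F: module R "Fm I" by (rule Fm_module)
  show ?thesis
  proof (rule F.submoduleI)
    show "A \<subseteq> carrier (Fm I)" "\<zero>\<^bsub>Fm I\<^esub> \<in> A" using AI Om.sub_zero[OF A] by simp_all
    fix a assume a: "a \<in> A"
    have "\<ominus>\<^bsub>Fm I\<^esub> a = (\<ominus> \<one>) \<odot>\<^bsub>Fm I\<^esub> a"
      using F.smult_l_minus[of \<one> a] AI a F.smult_one[of a] by auto
    then show "\<ominus>\<^bsub>Fm I\<^esub> a \<in> A" using Om.submoduleE(4)[OF A _ a, of "\<ominus> \<one>"] by simp
    show "a \<oplus>\<^bsub>Fm I\<^esub> b \<in> A" if "b \<in> A" for b using Om.submoduleE(5)[OF A a that] by simp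
    show "c \<odot>\<^bsub>Fm I\<^esub> a \<in> A" if "c \<in> carrier R" for c using Om.submoduleE(4)[OF A that a] by simp
  qed
qed

text \<open>The quotient is isomorphic to the module of the sequences supported in \<open>J - I\<close>.\<close>

lemma free_quotient:
  assumes "\<one> \<noteq> \<zero>" "finite J" "I \<subseteq> J"
  shows "free_module R (quot_module (Fm J) (supported R I))"
proof -
  interpret F: module R "Fm J" by (rule Fm_module)
  have sub: "submodule (supported R I) R (Fm J)"
    using supported_mono[OF assms(3)] by (intro submodule_of_Fm submodule_supported) blast
  let ?\<phi> = "\<lambda>f. supported R I +>\<^bsub>Fm J\<^esub> f"
  have inJ: "f \<in> supported R (J - I) \<Longrightarrow> f \<in> supported R J" for f using supported_mono[of "J - I" J] by blast
  have minus: "f \<ominus>\<^bsub>Fm J\<^esub> g = f \<^bold>+ \<^bold>- g" if "f \<in> supported R J" "g \<in> supported R J" for f g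
  proof -
    have "\<ominus>\<^bsub>Fm J\<^esub> g = (\<ominus> \<one>) \<odot>\<^bsub>Fm J\<^esub> g"
      using F.smult_l_minus[of \<one> g] F.smult_one[of g] that by simp
    also have "\<dots> = \<^bold>- g" using supported_Omega[OF that(2)] by (simp add: Om.smult_l_minus)
    finally show ?thesis by (simp add: a_minus_def)
  qed
  have minus_at: "(f \<ominus>\<^bsub>Fm J\<^esub> g) i = f i \<ominus> g i" if "f \<in> supported R J" "g \<in> supported R J" for f g i
    using minus[OF that] that by (simp add: seq_module_simps(3) neg_apply[OF supported_Omega] a_minus_def)
  have "bij_betw ?\<phi> (carrier (Fm (J - I))) (carrier (quot_module (Fm J) (supported R I)))"
    unfolding bij_betw_def
  proof
    show "inj_on ?\<phi> (carrier (Fm (J - I)))"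
    proof (rule inj_onI)
      fix f g assume "f \<in> carrier (Fm (J - I))" "g \<in> carrier (Fm (J - I))" and eq: "?\<phi> f = ?\<phi> g"
      then have fg: "f \<in> supported R (J - I)" "g \<in> supported R (J - I)" by simp_all
      then have d: "f \<ominus>\<^bsub>Fm J\<^esub> g \<in> supported R I"
        using eq F.coset_eq_iff[OF sub, of f g] inJ by simp
      show "f = g"
      proof
        fix i
        show "f i = g i"
        proof (cases "i \<in> I")
          case True
          then show ?thesis using fg by (simp add: supported_def)
        next
          case False
          then have "f i \<ominus> g i = \<zero>" using d minus_at[OF inJ[OF fg(1)] inJ[OF fg(2)], of i] by (simp add: supported_eq)
          moreover have "f i \<in> carrier R" "g i \<in> carrier R" using fg by (auto simp: supported_def)
          ultimately show ?thesis by simp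
        qed
      qed
    qed
    show "?\<phi> ` carrier (Fm (J - I)) = carrier (quot_module (Fm J) (supported R I))"
      unfolding F.quot_carrier
    proof
      show "?\<phi> ` carrier (Fm (J - I)) \<subseteq> ?\<phi> ` carrier (Fm J)" using inJ by auto
      show "?\<phi> ` carrier (Fm J) \<subseteq> ?\<phi> ` carrier (Fm (J - I))"
      proof
        fix C assume "C \<in> ?\<phi> ` carrier (Fm J)"
        then obtain f where f: "C = ?\<phi> f" "f \<in> supported R J" by auto
        define g where "g = (\<lambda>i. if i \<in> I then \<zero> else f i)"
        have g: "g \<in> supported R (J - I)" using f(2) by (auto simp: g_def supported_def)
        have "f i \<ominus> g i = (if i \<in> I then f i else \<zero>)" for i
          using f(2) by (auto simp: g_def supported_def a_minus_def r_neg)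
        then have "f \<ominus>\<^bsub>Fm J\<^esub> g = (\<lambda>i. if i \<in> I then f i else \<zero>)"
          using minus_at[OF f(2) inJ[OF g]] by (simp add: fun_eq_iff)
        also have "\<dots> \<in> supported R I" using f(2) by (auto simp: supported_def)
        finally have "?\<phi> f = ?\<phi> g" using F.coset_eq_iff[OF sub, of f g] f(2) inJ[OF g] by simp
        then show "C \<in> ?\<phi> ` carrier (Fm (J - I))" using f(1) g by auto
      qed
    qed
  qed
  then have "is_basis R (quot_module (Fm J) (supported R I)) (?\<phi> ` unit_vec ` (J - I))"
    using inJ F.quot_add[OF sub] F.quot_smult[OF sub] Fm_basis[OF assms(1), of "J - I"] assms(2)
    by (intro free_module_transfer[OF Fm_module F.quot_is_module[OF sub]]) auto
  then show ?thesis unfolding free_module_def by blast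
qed

text \<open>The reduced cone of \<open>small_contraction_exists\<close>, restricted to its finitely many coordinates. Its cycles are
  multiplied into its boundaries by all squares \<open>x\<^sup>2\<close>, which gives finite length.\<close>

theorem small_differential_module:
  assumes noeth: "noetherian_ring R" and nontriv: "\<one> \<noteq> \<zero>"
    and half: "h \<in> carrier R" "h \<otimes> (\<one> \<oplus> \<one>) = \<one>"
    and xs: "set xs \<subseteq> carrier R" "length xs = 8 + k"
    and proper: "\<one> \<notin> Idl (set xs)"
    and loc: "\<And>r. r \<in> carrier R \<Longrightarrow> r \<in> Units R \<or> r \<in> Idl (set xs)"
  shows "\<exists>(D :: ('a, nat \<Rightarrow> 'a) module) \<delta>. differential_module R D \<delta> \<and>
    mod_length R (homology D \<delta>) \<noteq> 0 \<and> mod_length R (homology D \<delta>) < \<infinity> \<and>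
    admits_free_flag R D \<delta> \<and> mod_rank R D \<le> enat (252 * 2 ^ k)"
proof -
  let ?I = "Idl (set xs)"
  have I: "ideal ?I R" "?I \<subseteq> carrier R" "set xs \<subseteq> ?I"
  proof -
    show "ideal ?I R" by (rule genideal_ideal[OF xs(1)])
    then show "?I \<subseteq> carrier R" by (auto dest: ideal.Icarr)
    show "set xs \<subseteq> ?I" by (rule genideal_self[OF xs(1)])
  qed
  obtain J D W m where K: "koszul_like ?I J D xs" "contraction J D W" "graded J m"
    "graded_split R J W 2 (126 * 2 ^ k)"
    using small_contraction_exists[OF half I xs(2)] by blast
  obtain \<delta> G B where \<delta>: "lin R \<delta>" "\<And>f. f \<in> \<Omega> \<Longrightarrow> \<delta> (\<delta> f) = \<^bold>0"
    and B: "finite B" "card B = 2 * (126 * 2 ^ k)"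
    and G: "mono G" "G (0::nat) = {}" "(\<Union>i. G i) = B"
      "\<And>i f. f \<in> supported R (G (Suc i)) \<Longrightarrow> \<delta> f \<in> supported R (G i)"
    and kill: "\<And>x z. x \<in> set xs \<Longrightarrow> z \<in> supported R B \<Longrightarrow> \<delta> z = \<^bold>0 \<Longrightarrow> \<exists>w\<in>supported R B. \<delta> w = x \<bullet> (x \<bullet> z)"
    and nz: "\<exists>z\<in>supported R B. \<delta> z = \<^bold>0 \<and> (\<forall>w\<in>\<Omega>. \<delta> w \<noteq> z)"
    by (rule reduced_cone[OF K xs(1) proper]) (rule that)
  note [simp] = lin_simps[OF \<delta>(1)]
  define F where "F = Fm B"
  have Fs: "carrier F = supported R B" "\<zero>\<^bsub>F\<^esub> = \<^bold>0" "\<And>x y. x \<oplus>\<^bsub>F\<^esub> y = x \<^bold>+ y" "\<And>a x. a \<odot>\<^bsub>F\<^esub> x = a \<bullet> x"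
    by (simp_all add: F_def)
  have GB: "G i \<subseteq> B" for i
    unfolding G(3)[symmetric] by (rule UN_upper[OF UNIV_I])
  have "\<exists>n. A \<subseteq> G n" if "finite A" "A \<subseteq> B" for A
    using that
  proof (induction A rule: finite_induct)
    case (insert a A)
    then obtain n where n: "A \<subseteq> G n" by blast
    have "a \<in> (\<Union>i. G i)" unfolding G(3) using insert.prems by blast
    then obtain l where l: "a \<in> G l" by blast
    have "insert a A \<subseteq> G (max n l)"
      using n l monoD[OF G(1), of n "max n l"] monoD[OF G(1), of l "max n l"] by auto
    then show ?case ..
  qed simp
  from this[OF B(1) order_refl] obtain n where "B \<subseteq> G n" ..
  then have n: "B = G n" using GB[of n] by (rule antisym)
  have \<delta>B: "\<delta> f \<in> supported R B" if "f \<in> supported R B" for f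
  proof -
    have "f \<in> supported R (G (Suc n))" using supported_mono[OF monoD[OF G(1), of n "Suc n"]] that n by auto
    then show ?thesis using G(4) n by simp
  qed
  interpret F: module R F unfolding F_def by (rule Fm_module)
  have 1: "differential_module R F \<delta>"
    by unfold_locales (auto simp: Fs \<delta>B supported_Omega \<delta>(2))
  define Z where "Z = {x \<in> supported R B. \<delta> x = \<^bold>0}"
  define A where "A = \<delta> ` supported R B"
  have H: "homology F \<delta> = quot_module (seq_module R\<lparr>carrier := Z\<rparr>) A"
    by (simp add: homology_def Z_def A_def Fs) (simp add: F_def)
  have Z: "submodule Z R (seq_module R)"
    by (rule Om.submoduleI) (auto simp: Z_def supported_Omega)
  have A: "submodule A R (seq_module R)"
  proof (rule Om.submoduleI)
    show "A \<subseteq> \<Omega>" using supported_Omega by (auto simp: A_def)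
    show "\<^bold>0 \<in> A" unfolding A_def by (intro image_eqI[of _ _ "\<^bold>0"]) simp_all
    fix a assume "a \<in> A"
    then obtain f where f: "a = \<delta> f" "f \<in> supported R B" by (auto simp: A_def)
    show "\<^bold>- a \<in> A" unfolding A_def using f by (intro image_eqI[of _ _ "\<^bold>- f"]) (simp_all add: supported_Omega)
    show "c \<bullet> a \<in> A" if "c \<in> carrier R" for c
      unfolding A_def using f that by (intro image_eqI[of _ _ "c \<bullet> f"]) (simp_all add: supported_Omega)
    show "a \<^bold>+ b \<in> A" if "b \<in> A" for b
    proof -
      obtain g where "b = \<delta> g" "g \<in> supported R B" using \<open>b \<in> A\<close> by (auto simp: A_def)
      then show ?thesis
        unfolding A_def using f by (intro image_eqI[of _ _ "f \<^bold>+ g"]) (simp_all add: supported_Omega)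
    qed
  qed
  have AZ: "A \<subseteq> Z" using \<delta>B \<delta>(2) supported_Omega by (auto simp: A_def Z_def)
  have ZB: "Z \<subseteq> supported R B" by (auto simp: Z_def)
  have "x \<bullet> (x \<bullet> z) \<in> A" if "x \<in> set xs" "z \<in> Z" for x z
    using kill[OF that(1)] that(2) unfolding Z_def A_def by (metis (mono_tags, lifting) imageI mem_Collect_eq)
  then obtain l where "Om.bounded_length A Z l"
    using bounded_length_of_killed[OF noeth B(1) A Z AZ ZB xs(1) _ loc] by blast
  then have "mod_length R (homology F \<delta>) \<le> enat l"
    unfolding H by (rule Om.mod_length_le[OF A Z AZ])
  then have 2: "mod_length R (homology F \<delta>) < \<infinity>"
    by (rule le_less_trans) simp
  obtain z where "z \<in> supported R B" "\<delta> z = \<^bold>0" "\<And>w. w \<in> \<Omega> \<Longrightarrow> \<delta> w \<noteq> z" using nz by blast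
  then have z: "z \<in> Z" "z \<notin> A" using supported_Omega by (auto simp: Z_def A_def)
  have 3: "mod_length R (homology F \<delta>) \<noteq> 0"
    unfolding H by (rule Om.mod_length_nonzero[OF A Z AZ z])
  have "is_free_flag R F \<delta> (\<lambda>i. supported R (G i))"
    unfolding is_free_flag_def
  proof (intro conjI allI)
    show "submodule (supported R (G i)) R F" for i
      unfolding F_def using supported_mono[OF GB] by (intro submodule_of_Fm submodule_supported) blast
    show "supported R (G 0) = {\<zero>\<^bsub>F\<^esub>}" by (simp add: G(2) Fs supported_empty)
    show "supported R (G i) \<subseteq> supported R (G (Suc i))" for i
      using supported_mono[OF monoD[OF G(1), of i "Suc i"]] by auto
    show "(\<Union>i. supported R (G i)) = carrier F"
      using supported_mono[OF GB] n by (auto simp: Fs)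
    show "free_module R (quot_module (F\<lparr>carrier := supported R (G (Suc i))\<rparr>) (supported R (G i)))" for i
    proof -
      have "free_module R (quot_module (Fm (G (Suc i))) (supported R (G i)))"
        using finite_subset[OF GB B(1)] monoD[OF G(1), of i "Suc i"] by (intro free_quotient nontriv) auto
      then show ?thesis by (simp add: F_def)
    qed
    show "\<delta> ` supported R (G (Suc i)) \<subseteq> supported R (G i)" for i using G(4) by blast
  qed
  then have 4: "admits_free_flag R F \<delta>" unfolding admits_free_flag_def by blast
  have 5: "mod_rank R F \<le> enat (252 * 2 ^ k)"
    using mod_rank_Fm_le[OF nontriv B(1)] by (simp add: F_def B(2))
  show ?thesis
    using 1 2 3 4 5 by blast
qed

end

section \<open>Polynomial rings: noetherianity and finite dimension\<close>

text \<open>Polynomial rings are treated as types, so that adding a variable is an application of the type constructor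
  \<open>poly\<close>. The predicates with prefix \<open>t\<close> are the notions of ideal theory for a ring that is a whole type.\<close>

definition tideal :: "'a::comm_ring_1 set \<Rightarrow> bool" where
  "tideal I \<longleftrightarrow> 0 \<in> I \<and> (\<forall>a\<in>I. \<forall>b\<in>I. a + b \<in> I) \<and> (\<forall>a\<in>I. \<forall>c. c * a \<in> I)"

definition tprime :: "'a::comm_ring_1 set \<Rightarrow> bool" where
  "tprime P \<longleftrightarrow> tideal P \<and> 1 \<notin> P \<and> (\<forall>a b. a * b \<in> P \<longrightarrow> a \<in> P \<or> b \<in> P)"

definition tnoeth :: "'a::comm_ring_1 itself \<Rightarrow> bool" where
  "tnoeth _ \<longleftrightarrow> (\<forall>I :: 'a set. tideal I \<longrightarrow> (\<exists>G. finite G \<and> G \<subseteq> I \<and> (\<forall>J. tideal J \<and> G \<subseteq> J \<longrightarrow> I \<subseteq> J)))"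

lemma tidealI:
  assumes "0 \<in> I" "\<And>a b. a \<in> I \<Longrightarrow> b \<in> I \<Longrightarrow> a + b \<in> I" "\<And>a c. a \<in> I \<Longrightarrow> c * a \<in> I"
  shows "tideal I"
  using assms by (auto simp: tideal_def)

lemma tidealD:
  assumes "tideal I"
  shows "0 \<in> I" "a \<in> I \<Longrightarrow> b \<in> I \<Longrightarrow> a + b \<in> I" "a \<in> I \<Longrightarrow> c * a \<in> I" "a \<in> I \<Longrightarrow> a * c \<in> I"
    "a \<in> I \<Longrightarrow> - a \<in> I" "a \<in> I \<Longrightarrow> b \<in> I \<Longrightarrow> a - b \<in> I"
proof -
  show 1: "0 \<in> I" "a \<in> I \<Longrightarrow> b \<in> I \<Longrightarrow> a + b \<in> I" "a \<in> I \<Longrightarrow> c * a \<in> I" for a b c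
    using assms by (auto simp: tideal_def)
  show "a \<in> I \<Longrightarrow> a * c \<in> I" using 1(3)[of a c] by (simp add: mult.commute)
  show 2: "a \<in> I \<Longrightarrow> - a \<in> I" for a using 1(3)[of a "-1"] by simp
  show "a \<in> I \<Longrightarrow> b \<in> I \<Longrightarrow> a - b \<in> I" using 1(2)[of a "- b"] 2 by simp
qed

lemma tnoethE:
  assumes "tnoeth TYPE('a::comm_ring_1)" "tideal (I :: 'a set)"
  obtains G where "finite G" "G \<subseteq> I" "\<And>J. tideal J \<Longrightarrow> G \<subseteq> J \<Longrightarrow> I \<subseteq> J"
proof -
  have "\<exists>G. finite G \<and> G \<subseteq> I \<and> (\<forall>J. tideal J \<and> G \<subseteq> J \<longrightarrow> I \<subseteq> J)"
    by (rule assms(1)[unfolded tnoeth_def, THEN spec[of _ I], THEN mp, OF assms(2)])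
  then obtain G where G: "finite G" "G \<subseteq> I" "\<forall>J. tideal J \<and> G \<subseteq> J \<longrightarrow> I \<subseteq> J"
    by (elim exE conjE)
  show thesis by (rule that[OF G(1,2)]) (simp add: G(3))
qed

lemma sum_in_tideal:
  "tideal I \<Longrightarrow> (\<And>x. x \<in> A \<Longrightarrow> f x \<in> I) \<Longrightarrow> sum f A \<in> I"
  by (induction A rule: infinite_finite_induct) (auto simp: tidealD)

lemma tnoeth_field: "tnoeth TYPE('a::field)"
  unfolding tnoeth_def
proof (intro allI impI)
  fix I :: "'a set" assume I: "tideal I"
  show "\<exists>G. finite G \<and> G \<subseteq> I \<and> (\<forall>J. tideal J \<and> G \<subseteq> J \<longrightarrow> I \<subseteq> J)"
  proof (cases "I \<subseteq> {0}")
    case True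
    then show ?thesis using tidealD(1) by (intro exI[of _ "{}"]) blast
  next
    case False
    then obtain a where a: "a \<in> I" "a \<noteq> 0" by blast
    have "x \<in> J" if "tideal J" "a \<in> J" for J x
      using tidealD(3)[OF that, of "x / a"] a by simp
    then show ?thesis using a by (intro exI[of _ "{a}"]) auto
  qed
qed

text \<open>Hilbert's basis theorem. The ideals \<open>L I n\<close> of coefficients in degree \<open>n\<close> increase to an ideal that is finitely
  generated, hence equal to some \<open>L I N\<close>. Polynomials realising generators of \<open>L I n\<close> for all \<open>n \<le> N\<close> generate \<open>I\<close>:
  with them the leading term of any element of \<open>I\<close> can be cancelled.\<close>

lemma tnoeth_poly:
  assumes "tnoeth TYPE('a::comm_ring_1)"
  shows "tnoeth TYPE('a poly)"
  unfolding tnoeth_def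
proof (intro allI impI)
  fix I :: "'a poly set" assume I: "tideal I"
  define L :: "'a poly set \<Rightarrow> nat \<Rightarrow> 'a set" where "L K n = {Polynomial.coeff f n | f. f \<in> K \<and> (\<forall>i>n. Polynomial.coeff f i = 0)}" for K n
  have L_ideal: "tideal (L K n)" if K: "tideal K" for K n
  proof (rule tidealI)
    show "0 \<in> L K n" unfolding L_def using tidealD(1)[OF K] by (auto intro!: exI[of _ 0])
    show "a + b \<in> L K n" if ab: "a \<in> L K n" "b \<in> L K n" for a b
    proof -
      obtain f g where "a = Polynomial.coeff f n" "f \<in> K" "\<forall>i>n. Polynomial.coeff f i = 0"
        "b = Polynomial.coeff g n" "g \<in> K" "\<forall>i>n. Polynomial.coeff g i = 0"
        using ab unfolding L_def by blast
      then show ?thesis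
        using tidealD(2)[OF K, of f g] unfolding L_def by (auto intro!: exI[of _ "f + g"])
    qed
    show "c * a \<in> L K n" if ab: "a \<in> L K n" for a c
    proof -
      obtain f where "a = Polynomial.coeff f n" "f \<in> K" "\<forall>i>n. Polynomial.coeff f i = 0"
        using ab unfolding L_def by blast
      then show ?thesis
        using tidealD(3)[OF K, of f "[:c:]"] unfolding L_def by (auto intro!: exI[of _ "[:c:] * f"])
    qed
  qed
  have L_Suc: "L I n \<subseteq> L I (Suc n)" for n
  proof
    fix a assume "a \<in> L I n"
    then obtain f where f: "a = Polynomial.coeff f n" "f \<in> I" "\<forall>i>n. Polynomial.coeff f i = 0" unfolding L_def by blast
    have "pCons 0 f \<in> I" using tidealD(3)[OF I f(2), of "[:0, 1:]"] by simp
    moreover have "\<forall>i>Suc n. Polynomial.coeff (pCons 0 f) i = 0"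
      using f(3) by (auto simp: coeff_pCons split: nat.splits)
    ultimately show "a \<in> L I (Suc n)" using f(1) unfolding L_def by (auto intro!: exI[of _ "pCons 0 f"])
  qed
  have L_mono: "n \<le> m \<Longrightarrow> L I n \<subseteq> L I m" for n m
    by (rule lift_Suc_mono_le[of "L I"]) (rule L_Suc)
  have L_max: "L I n \<subseteq> L I (max n m)" "L I m \<subseteq> L I (max n m)" for n m
    by (rule L_mono; simp)+
  have "tideal (\<Union>n. L I n)"
  proof (rule tidealI)
    show "0 \<in> (\<Union>n. L I n)" using tidealD(1)[OF L_ideal[OF I]] by blast
    show "c * a \<in> (\<Union>n. L I n)" if "a \<in> (\<Union>n. L I n)" for a c
      using that tidealD(3)[OF L_ideal[OF I]] by blast
    show "a + b \<in> (\<Union>n. L I n)" if ab: "a \<in> (\<Union>n. L I n)" "b \<in> (\<Union>n. L I n)" for a b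
    proof -
      obtain n m where "a \<in> L I n" "b \<in> L I m" using ab by blast
      then have "a + b \<in> L I (max n m)"
        by (intro tidealD(2)[OF L_ideal[OF I]] subsetD[OF L_max(1)] subsetD[OF L_max(2)])
      then show ?thesis by blast
    qed
  qed
  from tnoethE[OF assms this] obtain G0 where G0: "finite G0" "G0 \<subseteq> (\<Union>n. L I n)"
    "\<And>J. tideal J \<Longrightarrow> G0 \<subseteq> J \<Longrightarrow> (\<Union>n. L I n) \<subseteq> J"
    by metis
  have "\<exists>N. A \<subseteq> L I N" if "finite A" "A \<subseteq> (\<Union>n. L I n)" for A
    using that
  proof (induction A rule: finite_induct)
    case (insert a A)
    then obtain n where "A \<subseteq> L I n" by blast
    moreover obtain m where "a \<in> L I m" using insert.prems by blast
    ultimately have "insert a A \<subseteq> L I (max n m)" using L_max(1)[of n m] L_max(2)[of m n] by auto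
    then show ?case ..
  qed simp
  then obtain N where N: "G0 \<subseteq> L I N" using G0(1,2) by blast
  have LN: "L I n \<subseteq> L I N" for n
    using G0(3)[OF L_ideal[OF I] N] by blast
  have "\<exists>G. finite G \<and> G \<subseteq> I \<and> (\<forall>J. tideal J \<and> G \<subseteq> J \<longrightarrow> L I n \<subseteq> L (J \<inter> I) n)" for n
  proof -
    obtain H where H: "finite H" "H \<subseteq> L I n" "\<And>J. tideal J \<Longrightarrow> H \<subseteq> J \<Longrightarrow> L I n \<subseteq> J"
      using tnoethE[OF assms L_ideal[OF I, of n]] by metis
    have "\<forall>a\<in>H. \<exists>f. a = Polynomial.coeff f n \<and> f \<in> I \<and> (\<forall>i>n. Polynomial.coeff f i = 0)"
      using H(2) unfolding L_def by blast
    then obtain F where F: "\<And>a. a \<in> H \<Longrightarrow> a = Polynomial.coeff (F a) n \<and> F a \<in> I \<and> (\<forall>i>n. Polynomial.coeff (F a) i = 0)"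
      by metis
    have "L I n \<subseteq> L (J \<inter> I) n" if J: "tideal J" "F ` H \<subseteq> J" for J
    proof (rule H(3))
      have "tideal (J \<inter> I)" using J(1) I by (auto simp: tideal_def)
      then show "tideal (L (J \<inter> I) n)" by (rule L_ideal)
      show "H \<subseteq> L (J \<inter> I) n" using F J(2) unfolding L_def by blast
    qed
    then show ?thesis using H(1) F by (intro exI[of _ "F ` H"]) auto
  qed
  then obtain G where G: "\<And>n. finite (G n)" "\<And>n. G n \<subseteq> I"
    "\<And>n J. tideal J \<Longrightarrow> G n \<subseteq> J \<Longrightarrow> L I n \<subseteq> L (J \<inter> I) n"
    by metis
  have "I \<subseteq> J" if J: "tideal J" "(\<Union>n\<le>N. G n) \<subseteq> J" for J
  proof -
    have "f \<in> J" if "f \<in> I" "\<forall>i\<ge>n. Polynomial.coeff f i = 0" for f n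
      using that
    proof (induction n arbitrary: f)
      case 0
      then have "f = 0" by (intro poly_eqI) simp
      then show ?case using tidealD(1)[OF J(1)] by simp
    next
      case (Suc n)
      define k where "k = min n N"
      have "Polynomial.coeff f n \<in> L I n" using Suc.prems unfolding L_def by auto
      then have "Polynomial.coeff f n \<in> L I k" using LN by (auto simp: k_def min_def)
      then have "Polynomial.coeff f n \<in> L (J \<inter> I) k"
      proof -
        have "G k \<subseteq> (\<Union>n\<le>N. G n)" by (rule UN_upper) (simp add: k_def)
        then have "G k \<subseteq> J" using J(2) by (rule subset_trans)
        then show ?thesis using G(3)[OF J(1)] \<open>Polynomial.coeff f n \<in> L I k\<close> by blast
      qed
      then obtain h where h: "Polynomial.coeff f n = Polynomial.coeff h k" "h \<in> J" "h \<in> I" "\<forall>i>k. Polynomial.coeff h i = 0"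
        unfolding L_def by blast
      define g where "g = Polynomial.monom 1 (n - k) * h"
      have g: "g \<in> J" "g \<in> I" unfolding g_def using tidealD(3) J(1) I h by blast+
      have cg: "Polynomial.coeff g i = (if i < n - k then 0 else Polynomial.coeff h (i - (n - k)))" for i
        by (simp add: g_def coeff_monom_mult)
      have "\<forall>i\<ge>n. Polynomial.coeff (f - g) i = 0"
      proof (intro allI impI)
        fix i assume i: "i \<ge> n"
        show "Polynomial.coeff (f - g) i = 0"
        proof (cases "i = n")
          case True
          then show ?thesis using h(1) by (simp add: cg k_def)
        next
          case False
          then have "i - (n - k) > k" using i by (simp add: k_def min_def split: if_splits)
          then show ?thesis using False i Suc.prems(2) h(4) by (simp add: cg)
        qed
      qed
      then have "f - g \<in> J" using Suc.IH tidealD(6)[OF I Suc.prems(1) g(2)] by blast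
      then have "(f - g) + g \<in> J" using g(1) by (rule tidealD(2)[OF J(1)])
      then show ?case by simp
    qed
    note * = this
    show ?thesis
    proof
      fix f assume "f \<in> I"
      then show "f \<in> J" by (rule *[where n = "Suc (Polynomial.degree f)"]) (auto simp: coeff_eq_0)
    qed
  qed
  moreover have "finite (\<Union>n\<le>N. G n)" "(\<Union>n\<le>N. G n) \<subseteq> I" using G(1,2) by blast+
  ultimately show "\<exists>G. finite G \<and> G \<subseteq> I \<and> (\<forall>J. tideal J \<and> G \<subseteq> J \<longrightarrow> I \<subseteq> J)"
    by (intro exI[of _ "\<Union>n\<le>N. G n"] conjI allI impI) simp_all
qed

text \<open>A strictly monotone function from the primes to \<open>{0..n}\<close> bounds the length of all chains of primes.\<close>

definition tdim_le :: "'a::comm_ring_1 itself \<Rightarrow> nat \<Rightarrow> bool" where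
  "tdim_le _ n \<longleftrightarrow> (\<exists>rk :: 'a set \<Rightarrow> nat. (\<forall>P. tprime P \<longrightarrow> rk P \<le> n) \<and>
     (\<forall>P Q. tprime P \<and> tprime Q \<and> P \<subset> Q \<longrightarrow> rk P < rk Q))"

lemma tprimeD:
  assumes "tprime P"
  shows "tideal P" "1 \<notin> P" "a * b \<in> P \<Longrightarrow> a \<in> P \<or> b \<in> P"
  using assms by (auto simp: tprime_def)

lemma tprime_power: "tprime P \<Longrightarrow> a ^ n \<in> P \<Longrightarrow> a \<in> P"
  by (induction n) (auto dest: tprimeD)

lemma tdim_le_field: "tdim_le TYPE('a::field) 0"
proof -
  have "P = {0}" if P: "tprime P" for P :: "'a set"
  proof -
    have "a = 0" if "a \<in> P" for a
      using tidealD(3)[OF tprimeD(1)[OF P] that, of "inverse a"] tprimeD(2)[OF P] by (cases "a = 0") auto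
    then show ?thesis using tidealD(1)[OF tprimeD(1)[OF P]] by blast
  qed
  then show ?thesis unfolding tdim_le_def by (intro exI[of _ "\<lambda>_. 0"]) blast
qed

definition contracted :: "'a::comm_ring_1 poly set \<Rightarrow> 'a set" where
  "contracted Q = {a. [:a:] \<in> Q}"

definition extended :: "'a::comm_ring_1 set \<Rightarrow> 'a poly set" where
  "extended P = {f. \<forall>i. Polynomial.coeff f i \<in> P}"

lemma contracted_prime: "tprime Q \<Longrightarrow> tprime (contracted Q)"
proof -
  assume Q: "tprime Q"
  note I = tidealD[OF tprimeD(1)[OF Q]]
  have "tideal (contracted Q)"
  proof (rule tidealI)
    show "0 \<in> contracted Q" using I(1) by (simp add: contracted_def)
    show "a + b \<in> contracted Q" if "a \<in> contracted Q" "b \<in> contracted Q" for a b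
      using I(2)[of "[:a:]" "[:b:]"] that by (simp add: contracted_def)
    show "c * a \<in> contracted Q" if "a \<in> contracted Q" for a c
      using I(3)[of "[:a:]" "[:c:]"] that by (simp add: contracted_def mult.commute)
  qed
  moreover have "a \<in> contracted Q \<or> b \<in> contracted Q" if "a * b \<in> contracted Q" for a b
    using tprimeD(3)[OF Q, of "[:a:]" "[:b:]"] that by (simp add: contracted_def mult.commute)
  ultimately show ?thesis using tprimeD(2)[OF Q] by (auto simp: tprime_def contracted_def one_pCons)
qed

lemma extended_subset:
  assumes "tideal Q" shows "extended (contracted Q) \<subseteq> Q"
proof
  fix f assume "f \<in> extended (contracted Q)"
  then show "f \<in> Q"
  proof (induction f)
    case 0
    then show ?case using tidealD(1)[OF assms] by simp
  next
    case (pCons a f)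
    have "Polynomial.coeff (pCons a f) (Suc i) \<in> contracted Q" "Polynomial.coeff (pCons a f) 0 \<in> contracted Q" for i
      using pCons.prems unfolding extended_def by blast+
    then have "f \<in> Q" "[:a:] \<in> Q" using pCons.IH by (auto simp: extended_def contracted_def)
    then have "[:a:] + [:0, 1:] * f \<in> Q" using tidealD(2,3)[OF assms] by blast
    then show ?case by simp
  qed
qed

text \<open>At most two primes in a chain of primes of \<open>'a poly\<close> lie over the same prime \<open>p\<close>, and the smaller one is then
  the extension of \<open>p\<close>. Otherwise take \<open>f\<close> in \<open>Q\<close> and \<open>f'\<close> in \<open>Q'\<close> of least degree outside the extension; their leading coefficients
  lie outside \<open>p\<close>. Pseudo-division of \<open>f\<close> by \<open>f'\<close> leaves a remainder in the extension. Its quotient has a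
  smaller degree than \<open>f\<close>; if it lay in \<open>Q\<close>, then it would lie in the extension, and so would \<open>f\<close>. Hence \<open>f'\<close> lies in \<open>Q\<close>, and pseudo-division of an
  arbitrary element of \<open>Q'\<close> by \<open>f'\<close> shows \<open>Q' \<subseteq> Q\<close>.\<close>

lemma no_three_primes_over:
  fixes Q Q' :: "'a::idom poly set"
  assumes Q: "tprime Q" and Q': "tprime Q'" and less: "Q \<subset> Q'" and c: "contracted Q = contracted Q'"
  shows "Q = extended (contracted Q)"
proof (rule ccontr)
  assume ne: "Q \<noteq> extended (contracted Q)"
  define p where "p = contracted Q"
  have p: "tprime p" unfolding p_def by (rule contracted_prime[OF Q])
  have E: "extended p \<subseteq> Q" "extended p \<subseteq> Q'"
    using extended_subset[OF tprimeD(1)[OF Q]] extended_subset[OF tprimeD(1)[OF Q']] c by (simp_all add: p_def)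
  have least: "\<exists>f\<in>K. f \<notin> extended p \<and> Polynomial.lead_coeff f \<notin> p \<and> Polynomial.degree f > 0 \<and>
      (\<forall>g\<in>K. Polynomial.degree g < Polynomial.degree f \<longrightarrow> g \<in> extended p)"
    if K: "tideal K" "contracted K = p" "extended p \<subseteq> K" "K \<noteq> extended p" for K
  proof -
    obtain f0 where "f0 \<in> K \<and> f0 \<notin> extended p" using K(3,4) by blast
    then obtain f where f: "f \<in> K" "f \<notin> extended p"
      and min: "\<And>g. g \<in> K \<Longrightarrow> Polynomial.degree g < Polynomial.degree f \<Longrightarrow> g \<in> extended p"
      using ex_has_least_nat[of "\<lambda>f. f \<in> K \<and> f \<notin> extended p" f0 Polynomial.degree]
      by (metis (no_types, lifting) leD)
    have deg: "Polynomial.degree f > 0"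
    proof (rule ccontr)
      assume "\<not> Polynomial.degree f > 0"
      then obtain a where a: "f = [:a:]" using degree_eq_zeroE by blast
      then have "a \<in> p" using f(1) K(2) by (auto simp: contracted_def)
      then have "f \<in> extended p" using a tidealD(1)[OF tprimeD(1)[OF p]]
        by (auto simp: extended_def coeff_pCons split: nat.splits)
      then show False using f(2) by simp
    qed
    have "Polynomial.lead_coeff f \<notin> p"
    proof
      assume l: "Polynomial.lead_coeff f \<in> p"
      define t where "t = Polynomial.monom (Polynomial.lead_coeff f) (Polynomial.degree f)"
      have t: "t \<in> extended p" using l tidealD(1)[OF tprimeD(1)[OF p]] by (auto simp: t_def extended_def)
      have "f - t \<in> K" using tidealD(6)[OF K(1) f(1)] t K(3) by blast
      moreover have "Polynomial.degree (f - t) < Polynomial.degree f"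
      proof -
        have "Polynomial.degree (f - t) \<le> Polynomial.degree f - 1"
          by (rule degree_le) (auto simp: t_def coeff_eq_0 not_less_eq)
        then show ?thesis using deg by linarith
      qed
      ultimately have ft: "f - t \<in> extended p" by (rule min)
      have "Polynomial.coeff f i \<in> p" for i
        using tidealD(2)[OF tprimeD(1)[OF p], of "Polynomial.coeff (f - t) i" "Polynomial.coeff t i"] ft t
        by (simp add: extended_def)
      then show False using f(2) by (simp add: extended_def)
    qed
    then show ?thesis using f deg min by blast
  qed
  have "Q' \<noteq> extended p" using less E(1) by blast
  then obtain f' where f': "f' \<in> Q'" "f' \<notin> extended p" "Polynomial.lead_coeff f' \<notin> p" "Polynomial.degree f' > 0"
    "\<And>g. g \<in> Q' \<Longrightarrow> Polynomial.degree g < Polynomial.degree f' \<Longrightarrow> g \<in> extended p"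
    using least[OF tprimeD(1)[OF Q'] _ E(2)] c by (auto simp: p_def)
  obtain f where f: "f \<in> Q" "f \<notin> extended p"
    "\<And>g. g \<in> Q \<Longrightarrow> Polynomial.degree g < Polynomial.degree f \<Longrightarrow> g \<in> extended p"
    using least[OF tprimeD(1)[OF Q] _ E(1)] ne by (auto simp: p_def)
  define b where "b = Polynomial.lead_coeff f'"
  have divide: "\<exists>k q r. [:b ^ k:] * g = f' * q + r \<and> r \<in> extended p \<and>
      (Polynomial.degree r < Polynomial.degree f' \<or> r = 0)" if g: "g \<in> Q'" for g
  proof -
    define q r where "q = fst (pseudo_divmod g f')" and "r = snd (pseudo_divmod g f')"
    have f'0: "f' \<noteq> 0" using f'(4) by auto
    define k where "k = Suc (Polynomial.degree g) - Polynomial.degree f'"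
    have qr: "Polynomial.smult (b ^ k) g = f' * q + r" "r = 0 \<or> Polynomial.degree r < Polynomial.degree f'"
      using pseudo_divmod[OF f'0, of g q r] by (simp_all add: q_def r_def b_def k_def)
    have "r = [:b ^ k:] * g - f' * q" using qr(1) by simp
    then have "r \<in> Q'"
      using tidealD(3,4,6)[OF tprimeD(1)[OF Q']] g f'(1) by metis
    then have "r \<in> extended p"
      using f'(5) qr(2) tidealD(1)[OF tprimeD(1)[OF p]] by (auto simp: extended_def)
    then show ?thesis using qr by (intro exI[of _ k] exI[of _ q] exI[of _ r]) auto
  qed
  have b: "b ^ k \<notin> p" for k using tprime_power[OF p] f'(3) by (auto simp: b_def)
  then have bQ: "[:b ^ k:] \<notin> Q" for k by (auto simp: p_def contracted_def)
  have "f' \<in> Q"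
  proof -
    obtain k q r where d: "[:b ^ k:] * f = f' * q + r" "r \<in> extended p"
      "Polynomial.degree r < Polynomial.degree f' \<or> r = 0"
      using divide[of f] f(1) less by blast
    have "f' * q = [:b ^ k:] * f - r" using d(1) by simp
    also have "\<dots> \<in> Q" using tidealD(3,6)[OF tprimeD(1)[OF Q]] f(1) d(2) E(1) by blast
    finally have "f' \<in> Q \<or> q \<in> Q" by (rule tprimeD(3)[OF Q])
    moreover have "q \<notin> Q"
    proof
      assume q: "q \<in> Q"
      have "q \<in> extended p"
      proof (cases "q = 0")
        case True
        then show ?thesis using tidealD(1)[OF tprimeD(1)[OF p]] by (simp add: extended_def)
      next
        case False
        have f'0: "f' \<noteq> 0" using f'(4) by auto
        have le: "Polynomial.degree f' \<le> Polynomial.degree f"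
        proof (rule ccontr)
          assume "\<not> Polynomial.degree f' \<le> Polynomial.degree f"
          then show False using f'(5)[of f] f(1,2) less by auto
        qed
        have "Polynomial.degree f' + Polynomial.degree q = Polynomial.degree (f' * q)"
          using False f'0 by (simp add: degree_mult_eq)
        also have "f' * q = [:b ^ k:] * f - r" using d(1) by simp
        also have "Polynomial.degree ([:b ^ k:] * f - r) \<le> Polynomial.degree f"
          using d(3) le by (intro degree_diff_le) (auto intro: order_trans[OF degree_smult_le])
        finally have "Polynomial.degree q < Polynomial.degree f" using f'(4) by linarith
        then show ?thesis using f(3) q by blast
      qed
      then have "Polynomial.coeff (f' * q) i \<in> p" for i
        unfolding coeff_mult using tidealD(3)[OF tprimeD(1)[OF p]]
        by (intro sum_in_tideal[OF tprimeD(1)[OF p]]) (auto simp: extended_def)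
      then have "b ^ k * Polynomial.coeff f i \<in> p" for i
        using tidealD(2)[OF tprimeD(1)[OF p], of "Polynomial.coeff (f' * q) i" "Polynomial.coeff r i"] d(1,2)
        by (simp add: extended_def flip: coeff_smult coeff_add)
      then have "f \<in> extended p" using tprimeD(3)[OF p] b unfolding extended_def by blast
      then show False using f(2) by simp
    qed
    ultimately show ?thesis by blast
  qed
  have "Q' \<subseteq> Q"
  proof
    fix g assume "g \<in> Q'"
    then obtain k q r where d: "[:b ^ k:] * g = f' * q + r" "r \<in> extended p" using divide by blast
    then have "[:b ^ k:] * g \<in> Q"
      using tidealD(2,4)[OF tprimeD(1)[OF Q]] \<open>f' \<in> Q\<close> E(1) by (metis subsetD)
    then show "g \<in> Q" using tprimeD(3)[OF Q] bQ by blast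
  qed
  then show False using less by blast
qed

text \<open>Over each prime of \<open>'a\<close> a chain has at most two members, which an additional binary digit of the rank tells
  apart. This weak bound suffices for the finiteness of the dimension.\<close>

lemma tdim_le_poly:
  assumes "tdim_le TYPE('a::idom) n"
  shows "tdim_le TYPE('a poly) (2 * n + 1)"
proof -
  obtain rk :: "'a set \<Rightarrow> nat" where rk: "\<forall>P. tprime P \<longrightarrow> rk P \<le> n"
    "\<forall>P Q. tprime P \<and> tprime Q \<and> P \<subset> Q \<longrightarrow> rk P < rk Q"
    using assms unfolding tdim_le_def by blast
  define rk' where "rk' Q = 2 * rk (contracted Q) + (if Q = extended (contracted Q) then 0 else 1)" for Q :: "'a poly set"
  have "rk' Q \<le> 2 * n + 1" if "tprime Q" for Q
    using rk(1) contracted_prime[OF that] by (auto simp: rk'_def)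
  moreover have "rk' P < rk' Q" if PQ: "tprime P" "tprime Q" "P \<subset> Q" for P Q
  proof (cases "contracted P = contracted Q")
    case True
    then have "P = extended (contracted P)" by (intro no_three_primes_over[OF PQ])
    then show ?thesis using True PQ(3) by (auto simp: rk'_def)
  next
    case False
    then have "contracted P \<subset> contracted Q" using PQ(3) by (auto simp: contracted_def)
    then have "rk (contracted P) < rk (contracted Q)" using rk(2) contracted_prime PQ by blast
    then show ?thesis by (simp add: rk'_def)
  qed
  ultimately show ?thesis unfolding tdim_le_def by blast
qed

text \<open>The data of an affine space with a rational point: \<open>ev\<close> is the evaluation at the point, its kernel is
  generated by \<open>n\<close> coordinates \<open>ys\<close>, and the chain \<open>P\<close> of \<open>n + 1\<close> primes in the kernel shows that the dimension at
  the point is at least \<open>n\<close>.\<close>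

definition pointed :: "('a::idom \<Rightarrow> rat) \<Rightarrow> nat \<Rightarrow> bool" where
  "pointed ev n \<longleftrightarrow> (\<forall>a b. ev (a + b) = ev a + ev b) \<and> (\<forall>a b. ev (a * b) = ev a * ev b) \<and> ev 1 = 1 \<and>
     (\<exists>ys. length ys = n \<and> (\<forall>y\<in>set ys. ev y = 0) \<and> (\<forall>J. tideal J \<and> set ys \<subseteq> J \<longrightarrow> {a. ev a = 0} \<subseteq> J)) \<and>
     (\<exists>P::nat \<Rightarrow> 'a set. (\<forall>i\<le>n. tprime (P i) \<and> P i \<subseteq> {a. ev a = 0}) \<and> (\<forall>i<n. P i \<subset> P (Suc i)))"

lemma pointedE:
  assumes "pointed ev n"
  obtains ys P where "length ys = n" "\<And>y. y \<in> set ys \<Longrightarrow> ev y = 0"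
    "\<And>J. tideal J \<Longrightarrow> set ys \<subseteq> J \<Longrightarrow> {a. ev a = 0} \<subseteq> J"
    "\<And>i. i \<le> n \<Longrightarrow> tprime (P i)" "\<And>i. i \<le> n \<Longrightarrow> P i \<subseteq> {a. ev a = 0}" "\<And>i. i < n \<Longrightarrow> P i \<subset> P (Suc i)"
proof -
  from assms obtain ys P where "length ys = n" "\<forall>y\<in>set ys. ev y = 0"
    and ys: "\<forall>J. tideal J \<and> set ys \<subseteq> J \<longrightarrow> {a. ev a = 0} \<subseteq> J"
    and P: "\<forall>i\<le>n. tprime (P i) \<and> P i \<subseteq> {a. ev a = 0}" "\<forall>i<n. P i \<subset> P (Suc i)"
    unfolding pointed_def by (elim conjE exE)
  then show thesis
    by (intro that[of ys P]) (use ys[rule_format] P[rule_format] in \<open>(assumption | simp)+\<close>)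
qed

lemma tprime_zero: "tprime ({0} :: 'a::idom set)"
  by (auto simp: tprime_def tideal_def)

lemma pointed_id: "pointed (\<lambda>x. x) 0"
  unfolding pointed_def
  by (auto intro!: exI[of _ "\<lambda>_. {0}"] tprime_zero dest: tidealD(1))

text \<open>The new coordinate is the variable of \<open>'a poly\<close>, and the point gets the value \<open>0\<close> for it. The chain of
  primes is the preimage of the old one under \<open>p \<mapsto> p(0)\<close>, preceded by the zero ideal.\<close>

lemma pointed_poly:
  fixes ev :: "'a::idom \<Rightarrow> rat"
  assumes "pointed ev n"
  shows "pointed (\<lambda>p. ev (Polynomial.coeff p 0)) (Suc n)"
proof -
  have ev: "\<And>a b. ev (a + b) = ev a + ev b" "\<And>a b. ev (a * b) = ev a * ev b" "ev 1 = 1"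
    using assms by (simp_all add: pointed_def)
  obtain ys P where ys: "length ys = n" "\<And>y. y \<in> set ys \<Longrightarrow> ev y = 0"
      "\<And>J. tideal J \<Longrightarrow> set ys \<subseteq> J \<Longrightarrow> {a. ev a = 0} \<subseteq> J"
    and P: "\<And>i. i \<le> n \<Longrightarrow> tprime (P i)" "\<And>i. i \<le> n \<Longrightarrow> P i \<subseteq> {a. ev a = 0}" "\<And>i. i < n \<Longrightarrow> P i \<subset> P (Suc i)"
    by (rule pointedE[OF assms]) (rule that)
  have ev0: "ev 0 = 0" using ev(1)[of 0 0] by simp
  define zs where "zs = [:0, 1:] # map (\<lambda>y. [:y:]) ys"
  have zs: "{p. ev (Polynomial.coeff p 0) = 0} \<subseteq> J" if J: "tideal J" "set zs \<subseteq> J" for J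
  proof
    fix p assume "p \<in> {p. ev (Polynomial.coeff p 0) = 0}"
    moreover obtain a q where p: "p = pCons a q" by (rule pCons_cases)
    ultimately have "ev a = 0" by simp
    have "tideal (contracted J)"
    proof (rule tidealI)
      show "0 \<in> contracted J" using tidealD(1)[OF J(1)] by (simp add: contracted_def)
      show "a + b \<in> contracted J" if "a \<in> contracted J" "b \<in> contracted J" for a b
        using tidealD(2)[OF J(1), of "[:a:]" "[:b:]"] that by (simp add: contracted_def)
      show "c * a \<in> contracted J" if "a \<in> contracted J" for a c
        using tidealD(3)[OF J(1), of "[:a:]" "[:c:]"] that by (simp add: contracted_def mult.commute)
    qed
    moreover have "set ys \<subseteq> contracted J" using J(2) by (auto simp: zs_def contracted_def)
    ultimately have "[:a:] \<in> J" using ys(3)[of "contracted J"] \<open>ev a = 0\<close> by (auto simp: contracted_def)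
    moreover have "[:0, 1:] * q \<in> J" using J by (intro tidealD(4)) (auto simp: zs_def)
    ultimately have "[:a:] + [:0, 1:] * q \<in> J" by (rule tidealD(2)[OF J(1)])
    then show "p \<in> J" by (simp add: p)
  qed
  define Q where "Q i = (if i = 0 then {0} else {p. Polynomial.coeff p 0 \<in> P (i - 1)})" for i
  have Q: "tprime (Q i) \<and> Q i \<subseteq> {p. ev (Polynomial.coeff p 0) = 0}" if "i \<le> Suc n" for i
  proof (cases i)
    case 0
    then show ?thesis using ev0 by (auto simp: Q_def tprime_zero)
  next
    case (Suc j)
    have pr: "tprime (P j)" and sub: "P j \<subseteq> {a. ev a = 0}" using that P(1,2)[of j] Suc by auto
    note I = tidealD[OF tprimeD(1)[OF pr]]
    have "tideal (Q i)"
      by (rule tidealI) (auto simp: Q_def Suc I coeff_mult_0)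
    then have "tprime (Q i)"
      using tprimeD(2,3)[OF pr] by (auto simp: tprime_def Q_def Suc coeff_mult_0)
    then show ?thesis using sub by (auto simp: Q_def Suc)
  qed
  have Q_less: "Q i \<subset> Q (Suc i)" if "i < Suc n" for i
  proof (cases i)
    case 0
    have "0 \<in> P 0" using tidealD(1)[OF tprimeD(1)[OF P(1)[of 0]]] by simp
    then have "Q 0 \<subseteq> Q (Suc 0)" "[:0, 1:] \<in> Q (Suc 0)" "[:0, 1:] \<notin> Q 0" by (auto simp: Q_def)
    then show ?thesis unfolding 0 by blast
  next
    case (Suc j)
    then have "P j \<subset> P (Suc j)" using that P(3) by simp
    then obtain a where a: "a \<in> P (Suc j)" "a \<notin> P j" "P j \<subseteq> P (Suc j)" by blast
    then have "[:a:] \<in> Q (Suc i)" "[:a:] \<notin> Q i" "Q i \<subseteq> Q (Suc i)" by (auto simp: Q_def Suc)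
    then show ?thesis by blast
  qed
  show ?thesis
    unfolding pointed_def
  proof (intro conjI allI)
    show "\<exists>ys. length ys = Suc n \<and> (\<forall>y\<in>set ys. ev (Polynomial.coeff y 0) = 0) \<and>
      (\<forall>J. tideal J \<and> set ys \<subseteq> J \<longrightarrow> {p. ev (Polynomial.coeff p 0) = 0} \<subseteq> J)"
      using zs ys(1,2) ev0 by (intro exI[of _ zs]) (auto simp: zs_def)
    show "\<exists>P. (\<forall>i\<le>Suc n. tprime (P i) \<and> P i \<subseteq> {p. ev (Polynomial.coeff p 0) = 0}) \<and> (\<forall>i<Suc n. P i \<subset> P (Suc i))"
      using Q Q_less by (intro exI[of _ Q]) blast
  qed (simp_all add: ev coeff_mult_0)
qed

section \<open>Localisation at a point\<close>

text \<open>The ring \<open>R\<close> consists of the fractions \<open>\<iota> a / \<iota> b\<close> with \<open>ev b \<noteq> 0\<close>; it is characterised by these properties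
  so that its elements may be of any type.\<close>

locale localisation_at_point = cring R for R (structure) +
  fixes ev :: "'t::idom \<Rightarrow> rat" and n m :: nat and \<iota> :: "'t \<Rightarrow> 'a"
  assumes pt: "pointed ev n" and tnoeth: "tnoeth TYPE('t)" and tdim: "tdim_le TYPE('t) m"
    and \<iota>_closed [simp, intro]: "\<iota> a \<in> carrier R" and \<iota>_add: "\<iota> (a + b) = \<iota> a \<oplus> \<iota> b"
    and \<iota>_mult: "\<iota> (a * b) = \<iota> a \<otimes> \<iota> b" and \<iota>_one: "\<iota> 1 = \<one>" and inj: "inj \<iota>"
    and frac: "r \<in> carrier R \<Longrightarrow> \<exists>a b. ev b \<noteq> 0 \<and> r \<otimes> \<iota> b = \<iota> a"
    and unit: "\<iota> b \<in> Units R \<longleftrightarrow> ev b \<noteq> 0"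
begin

lemma ev: "ev (a + b) = ev a + ev b" "ev (a * b) = ev a * ev b" "ev 1 = 1" "ev 0 = 0"
proof -
  show 1: "ev (a + b) = ev a + ev b" "ev (a * b) = ev a * ev b" "ev 1 = 1" for a b
    using pt by (simp_all add: pointed_def)
  show "ev 0 = 0" using 1(1)[of 0 0] by simp
qed

lemma \<iota>_zero: "\<iota> 0 = \<zero>"
  using \<iota>_add[of 0 0] by (metis \<iota>_closed add.l_cancel_one add_0)

definition pullback :: "'a set \<Rightarrow> 't set" where
  "pullback I = {a. \<iota> a \<in> I}"

lemma pullback_ideal: "ideal I R \<Longrightarrow> tideal (pullback I)"
proof -
  assume "ideal I R"
  then interpret I: ideal I R .
  show ?thesis
    by (rule tidealI) (auto simp: pullback_def \<iota>_zero \<iota>_add \<iota>_mult I.zero_closed I.a_closed I.I_l_closed)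
qed

lemma eq_frac:
  assumes "r \<in> carrier R" "ev b \<noteq> 0" "r \<otimes> \<iota> b = \<iota> a"
  shows "r = \<iota> a \<otimes> inv (\<iota> b)"
  using assms unit[of b] by (metis Units_closed Units_inv_closed Units_r_inv m_assoc r_one)

text \<open>The denominators are units. So an ideal of \<open>R\<close> is determined by its pullback, and all questions about
  ideals of \<open>R\<close> reduce to the polynomial ring.\<close>

lemma mem_ideal_iff:
  assumes I: "ideal I R" and r: "r \<in> carrier R" "ev b \<noteq> 0" "r \<otimes> \<iota> b = \<iota> a"
  shows "r \<in> I \<longleftrightarrow> a \<in> pullback I"
proof -
  interpret ideal I R by fact
  have b: "\<iota> b \<in> Units R" using unit r(2) by simp
  show ?thesis
  proof
    assume "r \<in> I"
    then have "r \<otimes> \<iota> b \<in> I" by (rule I_r_closed) simp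
    then show "a \<in> pullback I" by (simp add: pullback_def r(3))
  next
    assume "a \<in> pullback I"
    then have "\<iota> a \<otimes> inv (\<iota> b) \<in> I" using b by (intro I_r_closed) (auto simp: pullback_def)
    then show "r \<in> I" using eq_frac[OF r] by simp
  qed
qed

lemma unit_iff:
  assumes r: "r \<in> carrier R" "ev b \<noteq> 0" "r \<otimes> \<iota> b = \<iota> a"
  shows "r \<in> Units R \<longleftrightarrow> ev a \<noteq> 0"
proof -
  have b: "\<iota> b \<in> Units R" using unit r(2) by simp
  show ?thesis
  proof
    assume "r \<in> Units R"
    then have "r \<otimes> \<iota> b \<in> Units R" using b by (rule Units_m_closed)
    then show "ev a \<noteq> 0" using unit r(3) by simp
  next
    assume "ev a \<noteq> 0"
    then have "\<iota> a \<otimes> inv (\<iota> b) \<in> Units R" using b unit by (intro Units_m_closed) auto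
    then show "r \<in> Units R" using eq_frac[OF r] by simp
  qed
qed

lemma pullback_subset:
  assumes "ideal I R" "ideal J R" "pullback I \<subseteq> pullback J"
  shows "I \<subseteq> J"
proof
  fix r assume r: "r \<in> I"
  then have rc: "r \<in> carrier R" using ideal.Icarr[OF assms(1)] by blast
  obtain a b where ab: "ev b \<noteq> 0" "r \<otimes> \<iota> b = \<iota> a" using frac[OF rc] by blast
  show "r \<in> J"
    using mem_ideal_iff[OF assms(1) rc ab] mem_ideal_iff[OF assms(2) rc ab] r assms(3) by blast
qed

lemma noetherian: "noetherian_ring R"
proof (rule noetherian_ringI)
  fix I assume I: "ideal I R"
  obtain G where G: "finite G" "G \<subseteq> pullback I" "\<And>J. tideal J \<Longrightarrow> G \<subseteq> J \<Longrightarrow> pullback I \<subseteq> J"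
    using tnoethE[OF tnoeth pullback_ideal[OF I]] by metis
  have c: "\<iota> ` G \<subseteq> carrier R" by blast
  have "\<iota> ` G \<subseteq> I" using G(2) by (auto simp: pullback_def)
  then have "Idl (\<iota> ` G) \<subseteq> I" by (rule genideal_minimal[OF I])
  moreover have "I \<subseteq> Idl (\<iota> ` G)"
    using genideal_self[OF c] by (intro pullback_subset I genideal_ideal c G(3) pullback_ideal) (auto simp: pullback_def)
  ultimately show "\<exists>A\<subseteq>carrier R. finite A \<and> I = Idl A"
    using G(1) c by (intro exI[of _ "\<iota> ` G"]) auto
qed

definition localise :: "'t set \<Rightarrow> 'a set" where
  "localise Q = {r \<in> carrier R. \<exists>a b. ev b \<noteq> 0 \<and> r \<otimes> \<iota> b = \<iota> a \<and> a \<in> Q}"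

lemma ker_prime: "tprime {a. ev a = 0}"
  by (auto simp: tprime_def tideal_def ev)

lemma mem_localise_iff:
  assumes Q: "tprime Q" "Q \<subseteq> {a. ev a = 0}" and r: "r \<in> carrier R" "ev b \<noteq> 0" "r \<otimes> \<iota> b = \<iota> a"
  shows "r \<in> localise Q \<longleftrightarrow> a \<in> Q"
proof
  assume "r \<in> localise Q"
  then obtain a' b' where a': "ev b' \<noteq> 0" "r \<otimes> \<iota> b' = \<iota> a'" "a' \<in> Q" by (auto simp: localise_def)
  have "\<iota> (a * b') = \<iota> (a' * b)"
    using r(1) by (simp add: \<iota>_mult flip: r(3) a'(2)) (simp add: m_ac)
  then have "a * b' = a' * b" using inj by (simp add: inj_eq)
  also have "\<dots> \<in> Q" using a'(3) tidealD(4)[OF tprimeD(1)[OF Q(1)]] by blast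
  finally show "a \<in> Q" using tprimeD(3)[OF Q(1)] Q(2) a'(1) by blast
qed (use r in \<open>auto simp: localise_def\<close>)

lemma localise_prime:
  assumes Q: "tprime Q" "Q \<subseteq> {a. ev a = 0}"
  shows "primeideal (localise Q) R"
proof (rule primeidealI)
  note I = tidealD[OF tprimeD(1)[OF Q(1)]] and mem = mem_localise_iff[OF Q]
  show "cring R" by (rule is_cring)
  show "ideal (localise Q) R"
  proof (rule idealI)
    show "ring R" by (rule ring_axioms)
    show "subgroup (localise Q) (add_monoid R)"
    proof (rule add.subgroupI)
      show "localise Q \<subseteq> carrier R" by (auto simp: localise_def)
      have "\<zero> \<in> localise Q" using mem[of \<zero> 1 0] I(1) by (simp add: ev \<iota>_zero \<iota>_one)
      then show "localise Q \<noteq> {}" by blast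
      fix r assume "r \<in> localise Q"
      then obtain a b where r: "r \<in> carrier R" "ev b \<noteq> 0" "r \<otimes> \<iota> b = \<iota> a" "a \<in> Q" by (auto simp: localise_def)
      have "\<iota> (- a) = \<ominus> \<iota> a"
        using \<iota>_add[of "- a" a] by (simp add: \<iota>_zero minus_equality)
      then show "\<ominus> r \<in> localise Q"
        using mem[of "\<ominus> r" b "- a"] r I(5) by (simp add: l_minus)
      fix s assume "s \<in> localise Q"
      then obtain c d where s: "s \<in> carrier R" "ev d \<noteq> 0" "s \<otimes> \<iota> d = \<iota> c" "c \<in> Q" by (auto simp: localise_def)
      have "(r \<oplus> s) \<otimes> \<iota> (b * d) = (r \<otimes> \<iota> b) \<otimes> \<iota> d \<oplus> (s \<otimes> \<iota> d) \<otimes> \<iota> b"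
        using r(1) s(1) by (simp add: \<iota>_mult l_distr r_distr m_ac)
      also have "\<dots> = \<iota> (a * d + c * b)" by (simp add: r(3) s(3) \<iota>_add \<iota>_mult)
      finally show "r \<oplus> s \<in> localise Q"
        using mem[of "r \<oplus> s" "b * d" "a * d + c * b"] r s I(2,4) by (simp add: ev)
    qed
    fix r x assume "r \<in> localise Q" and x: "x \<in> carrier R"
    then obtain a b where r: "r \<in> carrier R" "ev b \<noteq> 0" "r \<otimes> \<iota> b = \<iota> a" "a \<in> Q" by (auto simp: localise_def)
    obtain c d where c: "ev d \<noteq> 0" "x \<otimes> \<iota> d = \<iota> c" using frac[OF x] by blast
    have "(x \<otimes> r) \<otimes> \<iota> (d * b) = (x \<otimes> \<iota> d) \<otimes> (r \<otimes> \<iota> b)"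
      using r(1) x by (simp add: \<iota>_mult m_ac)
    also have "\<dots> = \<iota> (c * a)" by (simp add: r(3) c(2) \<iota>_mult)
    finally show "x \<otimes> r \<in> localise Q"
      using mem[of "x \<otimes> r" "d * b" "c * a"] r(1,2,4) x c(1) I(3) by (simp add: ev)
    then show "r \<otimes> x \<in> localise Q" using x r(1) by (simp add: m_comm)
  qed
  have "\<one> \<notin> localise Q" using mem[of \<one> 1 1] tprimeD(2)[OF Q(1)] by (simp add: ev \<iota>_one)
  then show "carrier R \<noteq> localise Q" by blast
  fix r s assume rs: "r \<in> carrier R" "s \<in> carrier R" "r \<otimes> s \<in> localise Q"
  obtain a b where a: "ev b \<noteq> 0" "r \<otimes> \<iota> b = \<iota> a" using frac[OF rs(1)] by blast
  obtain c d where c: "ev d \<noteq> 0" "s \<otimes> \<iota> d = \<iota> c" using frac[OF rs(2)] by blast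
  have "(r \<otimes> s) \<otimes> \<iota> (b * d) = (r \<otimes> \<iota> b) \<otimes> (s \<otimes> \<iota> d)"
    using rs by (simp add: \<iota>_mult m_ac)
  also have "\<dots> = \<iota> (a * c)" by (simp add: a c \<iota>_mult)
  finally have "a * c \<in> Q" using mem[of "r \<otimes> s" "b * d" "a * c"] rs a(1) c(1) by (simp add: ev)
  then show "r \<in> localise Q \<or> s \<in> localise Q"
    using tprimeD(3)[OF Q(1)] mem[OF rs(1) a] mem[OF rs(2) c] by blast
qed

lemma pullback_prime:
  assumes P: "primeideal P R"
  shows "tprime (pullback P)"
proof -
  interpret P: primeideal P R by fact
  have "1 \<notin> pullback P" using P.I_notcarr P.one_imp_carrier by (auto simp: pullback_def \<iota>_one)
  then show ?thesis
    using pullback_ideal[OF P.is_ideal] P.I_prime by (auto simp: tprime_def pullback_def \<iota>_mult)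
qed

text \<open>The upper bound comes from pulling chains of primes back, the lower one from localising the chain of primes at
  the point.\<close>

lemma krull_dim_bounds: "\<exists>d. krull_dim R = enat d \<and> n \<le> d"
proof -
  obtain rk :: "'t set \<Rightarrow> nat" where "\<forall>P. tprime P \<longrightarrow> rk P \<le> m"
    "\<forall>P Q. tprime P \<and> tprime Q \<and> P \<subset> Q \<longrightarrow> rk P < rk Q"
    using tdim unfolding tdim_le_def by blast
  then have rk: "\<And>P. tprime P \<Longrightarrow> rk P \<le> m"
    "\<And>P Q. tprime P \<Longrightarrow> tprime Q \<Longrightarrow> P \<subset> Q \<Longrightarrow> rk P < rk Q"
    by simp_all
  have "krull_dim R \<le> enat m"
    unfolding krull_dim_def
  proof (rule Sup_least, clarify)
    fix k P assume P: "\<forall>i\<le>k. primeideal (P i) R" "\<forall>i<k. P i \<subset> P (Suc i)"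
    have "i \<le> k \<Longrightarrow> i \<le> rk (pullback (P i))" for i
    proof (induction i)
      case (Suc i)
      have pr: "primeideal (P i) R" "primeideal (P (Suc i)) R" and less: "P i \<subset> P (Suc i)"
        using P Suc.prems by simp_all
      have "pullback (P i) \<subseteq> pullback (P (Suc i))" using less by (auto simp: pullback_def)
      moreover have "pullback (P i) \<noteq> pullback (P (Suc i))"
        using pullback_subset[of "P (Suc i)" "P i"] pr[THEN primeideal.axioms(1)] less by blast
      ultimately have "rk (pullback (P i)) < rk (pullback (P (Suc i)))"
        by (intro rk(2) pullback_prime pr) blast
      then show ?case using Suc by simp
    qed simp
    from this[of k] show "enat k \<le> enat m"
      using rk(1)[OF pullback_prime[of "P k"]] P by simp
  qed
  moreover have "enat n \<le> krull_dim R"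
  proof -
    obtain Q :: "nat \<Rightarrow> 't set" where Q: "\<And>i. i \<le> n \<Longrightarrow> tprime (Q i)" "\<And>i. i \<le> n \<Longrightarrow> Q i \<subseteq> {a. ev a = 0}"
      "\<And>i. i < n \<Longrightarrow> Q i \<subset> Q (Suc i)"
      by (rule pointedE[OF pt]) (rule that)
    have "localise (Q i) \<subset> localise (Q (Suc i))" if i: "i < n" for i
    proof -
      obtain a where a: "a \<in> Q (Suc i)" "a \<notin> Q i" using Q(3)[OF i] by blast
      have "\<iota> a \<otimes> \<iota> 1 = \<iota> a" by (simp add: \<iota>_one)
      then have "\<iota> a \<in> localise (Q (Suc i))" "\<iota> a \<notin> localise (Q i)"
        using mem_localise_iff[OF Q(1,2), of _ "\<iota> a" 1 a] a i by (auto simp: ev)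
      moreover have "localise (Q i) \<subseteq> localise (Q (Suc i))" using Q(3)[OF i] by (auto simp: localise_def)
      ultimately show ?thesis by blast
    qed
    then show ?thesis
      unfolding krull_dim_def using localise_prime[OF Q(1,2)]
      by (intro Sup_upper CollectI exI[of _ n] exI[of _ "\<lambda>i. localise (Q i)"] conjI refl) auto
  qed
  ultimately show ?thesis by (cases "krull_dim R") auto
qed

lemma nonunits_eq: "localise {a. ev a = 0} = carrier R - Units R"
proof -
  have "r \<in> localise {a. ev a = 0} \<longleftrightarrow> r \<notin> Units R" if r: "r \<in> carrier R" for r
  proof -
    obtain a b where ab: "ev b \<noteq> 0" "r \<otimes> \<iota> b = \<iota> a" using frac[OF r] by blast
    show ?thesis using mem_localise_iff[OF ker_prime order_refl r ab] unit_iff[OF r ab] by simp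
  qed
  then show ?thesis by (auto simp: localise_def)
qed

lemma nonunits_generated:
  "\<exists>xs. set xs \<subseteq> carrier R \<and> length xs = n \<and> Idl (set xs) = carrier R - Units R"
proof -
  obtain ys where ys: "length ys = n" "\<And>y. y \<in> set ys \<Longrightarrow> ev y = 0"
    "\<And>J. tideal J \<Longrightarrow> set ys \<subseteq> J \<Longrightarrow> {a. ev a = 0} \<subseteq> J"
    by (rule pointedE[OF pt]) (rule that)
  define xs where "xs = map \<iota> ys"
  have c: "set xs \<subseteq> carrier R" by (auto simp: xs_def)
  have M: "ideal (localise {a. ev a = 0}) R" using localise_prime[OF ker_prime order_refl] by (rule primeideal.axioms(1))
  have pullback_M: "pullback (localise {a. ev a = 0}) = {a. ev a = 0}"
    using unit by (auto simp: nonunits_eq pullback_def)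
  have "Idl (set xs) \<subseteq> localise {a. ev a = 0}"
    using ys(2) unit by (intro genideal_minimal M) (auto simp: nonunits_eq xs_def)
  moreover have "localise {a. ev a = 0} \<subseteq> Idl (set xs)"
  proof (rule pullback_subset[OF M genideal_ideal[OF c]])
    have "set ys \<subseteq> pullback (Idl (set xs))"
      using genideal_self[OF c] by (auto simp: pullback_def xs_def)
    then show "pullback (localise {a. ev a = 0}) \<subseteq> pullback (Idl (set xs))"
      unfolding pullback_M by (intro ys(3) pullback_ideal genideal_ideal c)
  qed
  ultimately show ?thesis
    using c ys(1) nonunits_eq by (intro exI[of _ xs]) (auto simp: xs_def)
qed

lemma is_local_ring: "local_ring R"
proof -
  define N where "N = carrier R - Units R"
  have N: "ideal N R" unfolding N_def nonunits_eq[symmetric]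
    using localise_prime[OF ker_prime order_refl] by (rule primeideal.axioms(1))
  have proper: "I \<subseteq> N" if I: "ideal I R" "carrier R \<noteq> I" for I
  proof
    fix r assume r: "r \<in> I"
    interpret I: ideal I R by fact
    have "r \<notin> Units R"
    proof
      assume u: "r \<in> Units R"
      then have "r \<otimes> inv r \<in> I" using r by (intro I.I_r_closed) auto
      then show False using I(2) I.one_imp_carrier u by (simp add: Units_r_inv)
    qed
    then show "r \<in> N" using r I.Icarr by (simp add: N_def)
  qed
  have "\<one> \<notin> N" by (simp add: N_def)
  then have ne: "carrier R \<noteq> N" by blast
  have "maximalideal N R"
    using N ne
  proof (rule maximalidealI)
    fix J assume J: "ideal J R" "N \<subseteq> J" "J \<subseteq> carrier R"
    show "J = N \<or> J = carrier R" using proper[OF J(1)] J by blast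
  qed
  moreover have "I = N" if "maximalideal I R" for I
  proof -
    interpret I: maximalideal I R by fact
    have "N \<subseteq> carrier R" by (auto simp: N_def)
    then show ?thesis using I.I_maximal[OF N proper[OF I.is_ideal I.I_notcarr]] ne by blast
  qed
  ultimately show ?thesis
    by (intro local_ring.intro local_ring_axioms.intro is_cring noetherian) blast
qed

end

section \<open>Local rings\<close>

lemma (in noetherian_ring) exists_maximalideal:
  assumes I: "ideal I R" and "\<one> \<notin> I"
  shows "\<exists>M. maximalideal M R \<and> I \<subseteq> M"
proof -
  define A where "A = {J. ideal J R \<and> I \<subseteq> J \<and> \<one> \<notin> J}"
  have "\<exists>M\<in>A. \<forall>J\<in>A. M \<subseteq> J \<longrightarrow> J = M"
  proof (rule subset_Zorn_nonempty)
    show "A \<noteq> {}" using assms by (auto simp: A_def)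
    fix C assume C: "C \<noteq> {}" "subset.chain A C"
    then have "subset.chain {I. ideal I R} C" unfolding subset_chain_def A_def by blast
    then have "\<Union>C \<in> C" using C(1) by (intro ideal_chain_is_trivial)
    then show "\<Union>C \<in> A" using C(2) unfolding subset_chain_def by blast
  qed
  then obtain M where M: "M \<in> A" "\<And>J. J \<in> A \<Longrightarrow> M \<subseteq> J \<Longrightarrow> J = M" by blast
  have "maximalideal M R"
  proof (rule maximalidealI)
    show "ideal M R" using M(1) by (simp add: A_def)
    show "carrier R \<noteq> M" using M(1) by (auto simp: A_def)
    fix J assume J: "ideal J R" "M \<subseteq> J" "J \<subseteq> carrier R"
    show "J = M \<or> J = carrier R"
    proof (cases "\<one> \<in> J")
      case True
      then show ?thesis using ideal.one_imp_carrier[OF J(1)] by blast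
    next
      case False
      then have "J \<in> A" using J(1,2) M(1) by (auto simp: A_def)
      then show ?thesis using M(2) J(2) by blast
    qed
  qed
  then show ?thesis using M(1) by (auto simp: A_def)
qed

context local_ring
begin

lemma max_ideal: "maximalideal (max_ideal R) R"
  unfolding max_ideal_def using ex1_maximalideal by (rule theI')

lemma max_ideal_unique: "maximalideal M R \<Longrightarrow> M = max_ideal R"
  using ex1_maximalideal max_ideal by blast

lemma one_notin_max_ideal: "\<one> \<notin> max_ideal R"
proof -
  interpret M: maximalideal "max_ideal R" R by (rule max_ideal)
  show ?thesis using M.I_notcarr M.one_imp_carrier by blast
qed

lemma unit_or_max_ideal:
  assumes r: "r \<in> carrier R"
  shows "r \<in> Units R \<or> r \<in> max_ideal R"
proof (cases "\<one> \<in> PIdl r")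
  case True
  then obtain s where "s \<in> carrier R" "s \<otimes> r = \<one>" by (auto simp: cgenideal_def)
  moreover from this have "r \<otimes> s = \<one>" using r m_comm by simp
  ultimately show ?thesis using r unfolding Units_def by blast
next
  case False
  then obtain M where "maximalideal M R" "PIdl r \<subseteq> M"
    using exists_maximalideal[OF cgenideal_ideal[OF r]] by blast
  then show ?thesis using max_ideal_unique cgenideal_self[OF r] by blast
qed

text \<open>The characteristic of the residue field enters only in this form: if it is not \<open>2\<close>, then
  \<open>1 + 1\<close> is a unit of the local ring.\<close>

lemma residue_char_2:
  assumes "\<one> \<oplus> \<one> \<in> max_ideal R"
  shows "ring_char (residue_field R) = 2"
proof -
  let ?m = "max_ideal R" and ?k = "residue_field R"
  interpret m: ideal ?m R using max_ideal by (rule maximalideal.axioms(1))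
  interpret k: ring ?k unfolding residue_field_def by (rule m.quotient_is_ring)
  have hom: "(+>) ?m \<in> ring_hom R ?k" unfolding residue_field_def by (rule m.rcos_ring_hom)
  have zero: "\<zero>\<^bsub>?k\<^esub> = ?m" by (simp add: residue_field_def FactRing_def)
  have one: "\<one>\<^bsub>?k\<^esub> = ?m +> \<one>" by (simp add: residue_field_def FactRing_def)
  have "\<one>\<^bsub>?k\<^esub> \<oplus>\<^bsub>?k\<^esub> \<one>\<^bsub>?k\<^esub> = ?m +> (\<one> \<oplus> \<one>)"
    using ring_hom_add[OF hom one_closed one_closed] by (simp add: one)
  also have "\<dots> = \<zero>\<^bsub>?k\<^esub>"
    using assms m.a_rcos_const by (simp add: zero)
  finally have two: "[(2::nat)] \<cdot>\<^bsub>?k\<^esub> \<one>\<^bsub>?k\<^esub> = \<zero>\<^bsub>?k\<^esub>"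
    by (simp add: numeral_2_eq_2)
  have "\<one>\<^bsub>?k\<^esub> \<noteq> \<zero>\<^bsub>?k\<^esub>"
    using one_notin_max_ideal m.a_rcos_self[of \<one>] by (auto simp: zero one)
  then have ge: "2 \<le> n" if "n > 0 \<and> [n] \<cdot>\<^bsub>?k\<^esub> \<one>\<^bsub>?k\<^esub> = \<zero>\<^bsub>?k\<^esub>" for n :: nat
    using that by (cases "n = 1") auto
  have "(LEAST n::nat. n > 0 \<and> [n] \<cdot>\<^bsub>?k\<^esub> \<one>\<^bsub>?k\<^esub> = \<zero>\<^bsub>?k\<^esub>) = 2"
    using two ge by (intro Least_equality) auto
  then show ?thesis using two unfolding ring_char_def by (auto intro: exI[of _ 2])
qed

lemma max_ideal_generators:
  "\<exists>xs. set xs \<subseteq> carrier R \<and> length xs = min_generators R (max_ideal R) \<and> Idl (set xs) = max_ideal R"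
proof -
  have "\<exists>n. \<exists>S\<subseteq>carrier R. finite S \<and> card S = n \<and> max_ideal R = Idl S"
    using finetely_gen[OF maximalideal.axioms(1)[OF max_ideal]] by blast
  then have "\<exists>S\<subseteq>carrier R. finite S \<and> card S = min_generators R (max_ideal R) \<and> max_ideal R = Idl S"
    unfolding min_generators_def by (rule LeastI_ex)
  then obtain S where S: "S \<subseteq> carrier R" "finite S" "card S = min_generators R (max_ideal R)" "max_ideal R = Idl S"
    by blast
  obtain xs where "set xs = S" "distinct xs" using finite_distinct_list[OF S(2)] by blast
  moreover from this have "length xs = card S" using distinct_card[of xs] by simp
  ultimately show ?thesis using S by (intro exI[of _ xs]) simp
qed

lemma small_flagged_module:
  assumes xs: "set xs \<subseteq> carrier R" "length xs = 8 + k" "Idl (set xs) = max_ideal R"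
    and two: "\<one> \<oplus> \<one> \<notin> max_ideal R"
  shows "\<exists>(D :: ('a, nat \<Rightarrow> 'a) module) \<delta>. differential_module R D \<delta> \<and>
    mod_length R (homology D \<delta>) \<noteq> 0 \<and> mod_length R (homology D \<delta>) < \<infinity> \<and>
    admits_free_flag R D \<delta> \<and> mod_rank R D \<le> enat (252 * 2 ^ k)"
proof -
  interpret seq_operators R ..
  have "\<zero> \<in> max_ideal R" using max_ideal by (meson additive_subgroup.zero_closed ideal.axioms(1) maximalideal.axioms(1))
  then have nontriv: "\<one> \<noteq> \<zero>" using one_notin_max_ideal by auto
  have u: "\<one> \<oplus> \<one> \<in> Units R" using unit_or_max_ideal[of "\<one> \<oplus> \<one>"] two by simp
  show ?thesis
    using unit_or_max_ideal one_notin_max_ideal unfolding xs(3)[symmetric]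
    by (intro small_differential_module[OF noetherian_ring_axioms nontriv _ _ xs(1,2), of "inv (\<one> \<oplus> \<one>)"]
        Units_inv_closed Units_l_inv u)
qed

end

section \<open>A local ring of real numbers\<close>

text \<open>Any injection into the reals would do; this one numbers the fractions by a chosen numerator and
  denominator.\<close>

definition fract_code :: "'t::{idom,countable} fract \<Rightarrow> real" where
  "fract_code x = real (to_nat (SOME p. snd p \<noteq> 0 \<and> x = Fract (fst p) (snd p)))"

lemma inj_fract_code: "inj fract_code"
proof (rule injI)
  fix x y :: "'t::{idom,countable} fract" assume eq: "fract_code x = fract_code y"
  define rep where "rep x = (SOME p. snd p \<noteq> 0 \<and> x = Fract (fst p) (snd p))" for x :: "'t fract"
  have rep: "x = Fract (fst (rep x)) (snd (rep x))" for x
  proof -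
    have "\<exists>p. snd p \<noteq> 0 \<and> x = Fract (fst p) (snd p)" by (cases x) auto
    then have "snd (rep x) \<noteq> 0 \<and> x = Fract (fst (rep x)) (snd (rep x))" unfolding rep_def by (rule someI_ex)
    then show ?thesis by blast
  qed
  have "rep x = rep y" using eq by (simp add: fract_code_def rep_def)
  then show "x = y" using rep[of x] rep[of y] by simp
qed

text \<open>The localisation of the ring at the kernel of \<open>ev\<close>, as a subring of the field of fractions, with
  its structure transported to the reals along \<open>fract_code\<close>.\<close>

definition local_ring_on_reals :: "('t::{idom,countable} \<Rightarrow> rat) \<Rightarrow> real ring" where
  "local_ring_on_reals ev =
     (let dec = inv_into UNIV (fract_code :: 't fract \<Rightarrow> real) in
       \<lparr>carrier = fract_code ` {Fract a b | a b. ev b \<noteq> 0},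
        monoid.mult = (\<lambda>x y. fract_code (dec x * dec y)), monoid.one = fract_code (1 :: 't fract),
        ring.zero = fract_code (0 :: 't fract), ring.add = (\<lambda>x y. fract_code (dec x + dec y))\<rparr>)"

lemma localisation_on_reals:
  fixes ev :: "'t::{idom,countable} \<Rightarrow> rat"
  assumes pt: "pointed ev n" and noeth: "tnoeth TYPE('t)" and dim: "tdim_le TYPE('t) m"
  shows "localisation_at_point (local_ring_on_reals ev) ev n m (\<lambda>a. fract_code (Fract a 1))"
proof -
  let ?R = "local_ring_on_reals ev"
  have ev: "ev (a + b) = ev a + ev b" "ev (a * b) = ev a * ev b" "ev 1 = 1" for a b
    using pt by (simp_all add: pointed_def)
  have ev0: "ev 0 = 0" using ev(1)[of 0 0] by simp
  have nz: "b \<noteq> 0" if "ev b \<noteq> 0" for b using that ev0 by auto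
  define S where "S = {Fract a b | a b. ev b \<noteq> 0}"
  have SE: "\<exists>a b. x = Fract a b \<and> ev b \<noteq> 0" if "x \<in> S" for x using that by (auto simp: S_def)
  have SI: "Fract a b \<in> S" if "ev b \<noteq> 0" for a b using that by (auto simp: S_def)
  have S1: "Fract a 1 \<in> S" for a using SI ev(3) by simp
  have S01: "0 \<in> S" "1 \<in> S" using S1 by (metis Zero_fract_def, metis One_fract_def)
  have Sadd: "x + y \<in> S" and Smult: "x * y \<in> S" if xy: "x \<in> S" "y \<in> S" for x y
  proof -
    obtain a b c d where "x = Fract a b" "ev b \<noteq> 0" "y = Fract c d" "ev d \<noteq> 0"
      using SE[OF xy(1)] SE[OF xy(2)] by blast
    then show "x + y \<in> S" "x * y \<in> S"
      using nz[of b] nz[of d] by (auto intro!: SI simp: ev)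
  qed
  have Sneg: "- x \<in> S" if "x \<in> S" for x
    using Smult[OF S1[of "-1"] that] by (simp add: One_fract_def[symmetric] flip: minus_fract)
  have dec [simp]: "inv_into UNIV fract_code (fract_code x) = x" for x :: "'t fract"
    by (rule inv_into_f_f[OF inj_fract_code UNIV_I])
  have R: "carrier ?R = fract_code ` S" "\<zero>\<^bsub>?R\<^esub> = fract_code (0 :: 't fract)" "\<one>\<^bsub>?R\<^esub> = fract_code (1 :: 't fract)"
    "fract_code x \<otimes>\<^bsub>?R\<^esub> fract_code y = fract_code (x * y)"
    "fract_code x \<oplus>\<^bsub>?R\<^esub> fract_code y = fract_code (x + y)" for x y :: "'t fract"
    by (simp_all add: local_ring_on_reals_def S_def Let_def)
  have cring: "cring ?R"
  proof (rule cringI)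
    show "abelian_group ?R"
    proof (rule abelian_groupI)
      fix x assume "x \<in> carrier ?R"
      then obtain y where "x = fract_code y" "y \<in> S" by (auto simp: R)
      then show "\<exists>y\<in>carrier ?R. y \<oplus>\<^bsub>?R\<^esub> x = \<zero>\<^bsub>?R\<^esub>"
        using Sneg by (intro bexI[of _ "fract_code (- y)"]) (auto simp: R)
    qed (auto simp: R Sadd S01 add_ac)
    show "comm_monoid ?R"
      by (rule comm_monoidI) (auto simp: R Smult S01 mult_ac)
  qed (auto simp: R distrib_right)
  have code_eq: "fract_code x = fract_code y \<longleftrightarrow> x = y" for x y :: "'t fract"
    by (rule inj_eq[OF inj_fract_code])
  show ?thesis
  proof (intro localisation_at_point.intro localisation_at_point_axioms.intro cring pt noeth dim)
    fix a b :: 't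
    show "fract_code (Fract a 1) \<in> carrier ?R" unfolding R by (rule imageI[OF S1])
    show "fract_code (Fract (a + b) 1) = fract_code (Fract a 1) \<oplus>\<^bsub>?R\<^esub> fract_code (Fract b 1)"
      "fract_code (Fract (a * b) 1) = fract_code (Fract a 1) \<otimes>\<^bsub>?R\<^esub> fract_code (Fract b 1)"
      by (simp_all add: R)
    show "fract_code (Fract (1::'t) 1) = \<one>\<^bsub>?R\<^esub>" by (simp add: R One_fract_def)
    show "inj (\<lambda>a. fract_code (Fract (a::'t) 1))"
      by (rule injI) (simp add: code_eq eq_fract)
  next
    fix r assume "r \<in> carrier ?R"
    then obtain x where x: "x \<in> S" "r = fract_code x" unfolding R by blast
    then obtain a b where r: "r = fract_code (Fract a b)" "ev b \<noteq> 0" using SE[OF x(1)] by blast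
    then show "\<exists>(a::'t) b. ev b \<noteq> 0 \<and> r \<otimes>\<^bsub>?R\<^esub> fract_code (Fract b 1) = fract_code (Fract a 1)"
      using nz[OF r(2)] by (intro exI[of _ a] exI[of _ b]) (simp add: R code_eq eq_fract)
  next
    fix b :: 't
    interpret cring ?R by (rule cring)
    show "fract_code (Fract b 1) \<in> Units ?R \<longleftrightarrow> ev b \<noteq> 0"
    proof
      assume "fract_code (Fract b 1) \<in> Units ?R"
      then obtain y where y: "y \<in> carrier ?R" "y \<otimes>\<^bsub>?R\<^esub> fract_code (Fract b 1) = \<one>\<^bsub>?R\<^esub>"
        by (auto simp: Units_def)
      then obtain x where x: "x \<in> S" "y = fract_code x" unfolding R by blast
      then obtain c d where c: "y = fract_code (Fract c d)" "ev d \<noteq> 0" using SE[OF x(1)] by blast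
      have "Fract (c * b) d = Fract 1 1" using y(2) by (simp add: c(1) R code_eq One_fract_def)
      then have "c * b = d" using nz[OF c(2)] by (simp add: eq_fract)
      then show "ev b \<noteq> 0" using c(2) ev(2)[of c b] by auto
    next
      assume b: "ev b \<noteq> 0"
      have "fract_code (Fract 1 b) \<in> carrier ?R" unfolding R by (rule imageI[OF SI[OF b]])
      moreover have "fract_code (Fract 1 b) \<otimes>\<^bsub>?R\<^esub> fract_code (Fract b 1) = \<one>\<^bsub>?R\<^esub>"
        using nz[OF b] by (simp add: R code_eq One_fract_def eq_fract)
      moreover have "fract_code (Fract b 1) \<in> carrier ?R" unfolding R by (rule imageI[OF S1])
      ultimately show "fract_code (Fract b 1) \<in> Units ?R"
        using m_comm unfolding Units_def by auto
    qed
  qed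
qed

instance poly :: ("{countable,zero}") countable
  by (rule countable_classI[of "\<lambda>p. to_nat (coeffs p)"]) (simp add: coeffs_eq_iff)

type_synonym rat_poly8 = "rat poly poly poly poly poly poly poly poly"

lemma pointed_poly_ex: "\<exists>ev :: 'a::idom \<Rightarrow> rat. pointed ev n \<Longrightarrow> \<exists>ev :: 'a poly \<Rightarrow> rat. pointed ev (Suc n)"
  using pointed_poly by blast

lemma tdim_le_poly_ex: "\<exists>m. tdim_le TYPE('a::idom) m \<Longrightarrow> \<exists>m. tdim_le TYPE('a poly) m"
  using tdim_le_poly by blast

lemma rat_poly8:
  "\<exists>ev :: rat_poly8 \<Rightarrow> rat. pointed ev 8" "tnoeth TYPE(rat_poly8)" "\<exists>m. tdim_le TYPE(rat_poly8) m"
proof -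
  have "\<exists>ev :: rat_poly8 \<Rightarrow> rat. pointed ev (Suc (Suc (Suc (Suc (Suc (Suc (Suc (Suc 0))))))))"
    by (intro pointed_poly_ex) (use pointed_id in blast)
  then show "\<exists>ev :: rat_poly8 \<Rightarrow> rat. pointed ev 8" by (simp add: numeral_eq_Suc)
  show "tnoeth TYPE(rat_poly8)" by (intro tnoeth_poly tnoeth_field)
  show "\<exists>m. tdim_le TYPE(rat_poly8) m" by (intro tdim_le_poly_ex) (use tdim_le_field in blast)
qed

text \<open>The localisation of \<open>\<rat>[x\<^sub>1, \<dots>, x\<^sub>8]\<close> at the origin. It carries a flagged module of rank at most
  \<open>252\<close>, and its dimension \<open>d\<close> is finite and at least \<open>8\<close>.\<close>

lemma counterexample_on_reals:
  "\<exists>(R :: real ring) d (F :: (real, nat \<Rightarrow> real) module) \<delta>.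
    local_ring R \<and> krull_dim R = enat d \<and> differential_module R F \<delta> \<and> admits_free_flag R F \<delta> \<and>
    mod_length R (homology F \<delta>) < \<infinity> \<and> mod_length R (homology F \<delta>) \<noteq> 0 \<and> mod_rank R F < enat (2 ^ d)"
proof -
  obtain ev :: "rat_poly8 \<Rightarrow> rat" where ev: "pointed ev 8" using rat_poly8(1) ..
  obtain m where m: "tdim_le TYPE(rat_poly8) m" using rat_poly8(3) ..
  let ?R = "local_ring_on_reals ev"
  interpret L: localisation_at_point ?R ev 8 m "\<lambda>a. fract_code (Fract a 1)"
    by (rule localisation_on_reals[OF ev rat_poly8(2) m])
  interpret local_ring ?R by (rule L.is_local_ring)
  obtain d where d: "krull_dim ?R = enat d" "8 \<le> d" using L.krull_dim_bounds by blast
  obtain xs where xs: "set xs \<subseteq> carrier ?R" "length xs = 8" "genideal ?R (set xs) = carrier ?R - Units ?R"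
    using L.nonunits_generated by blast
  have max: "max_ideal ?R = carrier ?R - Units ?R"
  proof
    interpret M: maximalideal "max_ideal ?R" ?R by (rule max_ideal)
    show "carrier ?R - Units ?R \<subseteq> max_ideal ?R" using unit_or_max_ideal by blast
    show "max_ideal ?R \<subseteq> carrier ?R - Units ?R"
    proof
      fix r assume r: "r \<in> max_ideal ?R"
      have "r \<notin> Units ?R"
      proof
        assume u: "r \<in> Units ?R"
        have "r \<otimes>\<^bsub>?R\<^esub> inv\<^bsub>?R\<^esub> r \<in> max_ideal ?R" using r u by (intro M.I_r_closed) auto
        then show False using u one_notin_max_ideal by (simp add: L.Units_r_inv)
      qed
      then show "r \<in> carrier ?R - Units ?R" using r M.Icarr by blast
    qed
  qed
  have "fract_code (Fract (1 + 1 :: rat_poly8) 1) \<in> Units ?R"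
    using L.unit[of "1 + 1"] by (simp only: L.ev)
  then have "\<one>\<^bsub>?R\<^esub> \<oplus>\<^bsub>?R\<^esub> \<one>\<^bsub>?R\<^esub> \<in> Units ?R" by (simp only: L.\<iota>_add L.\<iota>_one)
  then have two: "\<one>\<^bsub>?R\<^esub> \<oplus>\<^bsub>?R\<^esub> \<one>\<^bsub>?R\<^esub> \<notin> max_ideal ?R" by (simp add: max)
  obtain F :: "(real, nat \<Rightarrow> real) module" and \<delta> where F: "differential_module ?R F \<delta>"
    "mod_length ?R (homology F \<delta>) \<noteq> 0" "mod_length ?R (homology F \<delta>) < \<infinity>"
    "admits_free_flag ?R F \<delta>" "mod_rank ?R F \<le> enat (252 * 2 ^ 0)"
    using small_flagged_module[OF xs(1) _ _ two, of 0] xs(2,3) max by auto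
  have "(252::nat) < 2 ^ 8" by simp
  also have "\<dots> \<le> 2 ^ d" using d(2) by (intro power_increasing) simp_all
  finally have "mod_rank ?R F < enat (2 ^ d)"
    using F(5) by (simp add: le_less_trans)
  then show ?thesis using L.is_local_ring d(1) F by blast
qed

theorem corollary4p6:
  shows "(\<forall>(R :: ('a, 'm) ring_scheme) (d :: nat).
            regular_local_ring R \<and> krull_dim R = enat d \<and>
            ring_char (residue_field R) \<noteq> 2 \<and> d \<ge> 8 \<longrightarrow>
            (\<exists>(D :: ('a, nat \<Rightarrow> 'a) module) \<delta>.
               differential_module R D \<delta> \<and>
               mod_length R (homology D \<delta>) \<noteq> 0 \<and> mod_length R (homology D \<delta>) < \<infinity> \<and>
               admits_free_flag R D \<delta> \<and>
               mod_rank R D < enat (2 ^ d)))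
       \<and> \<not> (\<forall>(R :: real ring) (d :: nat) (F :: (real, nat \<Rightarrow> real) module) \<delta>.
            local_ring R \<and> krull_dim R = enat d \<and>
            differential_module R F \<delta> \<and> admits_free_flag R F \<delta> \<and>
            mod_length R (homology F \<delta>) < \<infinity> \<and> mod_length R (homology F \<delta>) \<noteq> 0 \<longrightarrow>
            mod_rank R F \<ge> enat (2 ^ d))"
proof (intro conjI allI impI)
  fix R :: "('a, 'm) ring_scheme" and d :: nat
  assume *: "regular_local_ring R \<and> krull_dim R = enat d \<and> ring_char (residue_field R) \<noteq> 2 \<and> d \<ge> 8"
  then interpret regular_local_ring R by blast
  have "min_generators R (max_ideal R) = d" using regular * by simp
  then obtain xs where xs: "set xs \<subseteq> carrier R" "length xs = d" "genideal R (set xs) = max_ideal R"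
    using max_ideal_generators by blast
  have two: "\<one>\<^bsub>R\<^esub> \<oplus>\<^bsub>R\<^esub> \<one>\<^bsub>R\<^esub> \<notin> max_ideal R" using residue_char_2 * by blast
  have len: "length xs = 8 + (d - 8)" using xs(2) * by simp
  obtain D :: "('a, nat \<Rightarrow> 'a) module" and \<delta> where D: "differential_module R D \<delta>"
    "mod_length R (homology D \<delta>) \<noteq> 0" "mod_length R (homology D \<delta>) < \<infinity>"
    "admits_free_flag R D \<delta>" "mod_rank R D \<le> enat (252 * 2 ^ (d - 8))"
    using small_flagged_module[OF xs(1) len xs(3) two] by blast
  have "252 * 2 ^ (d - 8) < (2 ^ 8 * 2 ^ (d - 8) :: nat)" by simp
  also have "\<dots> = 2 ^ d" using * by (simp only: power_add[symmetric] le_add_diff_inverse)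
  finally have "mod_rank R D < enat (2 ^ d)" using D(5) by (simp add: le_less_trans)
  then show "\<exists>(D :: ('a, nat \<Rightarrow> 'a) module) \<delta>. differential_module R D \<delta> \<and>
      mod_length R (homology D \<delta>) \<noteq> 0 \<and> mod_length R (homology D \<delta>) < \<infinity> \<and>
      admits_free_flag R D \<delta> \<and> mod_rank R D < enat (2 ^ d)"
    using D by blast
next
  show "\<not> (\<forall>(R :: real ring) (d :: nat) (F :: (real, nat \<Rightarrow> real) module) \<delta>.
            local_ring R \<and> krull_dim R = enat d \<and>
            differential_module R F \<delta> \<and> admits_free_flag R F \<delta> \<and>
            mod_length R (homology F \<delta>) < \<infinity> \<and> mod_length R (homology F \<delta>) \<noteq> 0 \<longrightarrow>
            mod_rank R F \<ge> enat (2 ^ d))"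
    using counterexample_on_reals by (metis not_less)
qed

end
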